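(* Let $\Omega\subset\mathbb{C}^n$ be a bounded strongly pseudoconvex domain, let $u_0,u_1\in\mathcal{PSH}(\Omega)\cap C(\overline\Omega)$, and let $u_t$, $0<t<1$, be the geodesic joining $u_0$ and $u_1$. Then: (i) If $u_0,u_1$ are $\alpha$-Hölder continuous on $\overline\Omega$ for some $0<\alpha\le1$, then $u_t$ is $\frac{\alpha}{2}$-Hölder continuous on $\overline\Omega$, uniformly in $t\in[0,1]$; that is, there is a constant $C$ such that $|u_t(z)-u_t(w)|\le C|z-w|^{\alpha/2}$ for all $z,w\in\overline\Omega$ and $t\in[0,1]$. (ii) If $u_0,u_1\in C^{1,1}(\overline\Omega)$ and $u_0-u_1$ is constant on $\partial\Omega$, then $u_t$ is Lipschitz on $\overline\Omega$, uniformly in $t\in[0,1]$.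
   Context: $\mathcal{PSH}(G)$ denotes the plurisubharmonic (psh) functions on a domain $G$. A domain $\Omega$ is strongly pseudoconvex if there is a ($C^2$) strictly psh function $\rho$ in a neighborhood of $\overline\Omega$ such that $\Omega=\{\rho<0\}$ and $\nabla\rho\ne0$ on $\partial\Omega$. $\mathcal A=\{\zeta\in\mathbb C: 0<\log|\zeta|<1\}$, $\mathcal A_j=\{\log|\zeta|=j\}$, $j=0,1$. $W(u_0,u_1)$ is the class of $v\in\mathcal{PSH}(\Omega\times\mathcal A)$ such that $\limsup v(z,\zeta)\le u_j(z)$ as $\zeta\to\mathcal A_j$, for every $z\in\Omega$, $j=0,1$. The envelope $\widehat u(z,\zeta)=\sup\{v(z,\zeta):v\in W(u_0,u_1)\}$ is psh and depends on $\zeta$ only through $|\zeta|$; the geodesic joining $u_0$ and $u_1$ is the family $u_t(z)$, $0<t<1$, defined by $u_{\log|\zeta|}(z)=\widehat u(z,\zeta)$. At $t=0,1$ it is $u_0,u_1$. For the continuous data considered here $\widehat u$ extends continuously to $\overline{\Omega\times\mathcal A}$, and $u_t$ on $\partial\Omega$ denotes this extension. *)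

theory Defs
  imports "HOL-Analysis.Analysis"
begin

text \<open>
  For a function that is bounded above on the circle the positive part has finite integral, so
  the difference below is the integral with values in [-\<infinity>, \<infinity>). The map
  e2ennreal truncates negative values to 0.
\<close>

definition circle_mean :: "(real \<Rightarrow> ereal) \<Rightarrow> ereal" where
  "circle_mean g =
     (enn2ereal (\<integral>\<^sup>+\<theta>\<in>{0..2 * pi}. e2ennreal (g \<theta>) \<partial>lborel)
      - enn2ereal (\<integral>\<^sup>+\<theta>\<in>{0..2 * pi}. e2ennreal (- g \<theta>) \<partial>lborel)) / ereal (2 * pi)"

definition usc_on :: "'a::topological_space set \<Rightarrow> ('a \<Rightarrow> ereal) \<Rightarrow> bool" where
  "usc_on G f \<longleftrightarrow> (\<forall>c. openin (top_of_set G) {x \<in> G. f x < c})"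

text \<open>
  The parameter sc is the complex scalar multiplication of the ambient space. As usual,
  the value -\<infinity> is allowed (including the function that is identically -\<infinity>), the value
  \<infinity> is not.
\<close>

definition psh_wrt ::
    "(complex \<Rightarrow> 'a \<Rightarrow> 'a) \<Rightarrow> 'a::real_normed_vector set \<Rightarrow> ('a \<Rightarrow> ereal) \<Rightarrow> bool" where
  "psh_wrt sc G f \<longleftrightarrow>
     usc_on G f \<and> (\<forall>x\<in>G. f x < \<infinity>) \<and>
     (\<forall>a b. (\<forall>\<tau>\<in>cball 0 1. a + sc \<tau> b \<in> G) \<longrightarrow>
            f a \<le> circle_mean (\<lambda>\<theta>. f (a + sc (cis \<theta>) b)))"

abbreviation psh_on :: "(complex ^ 'n) set \<Rightarrow> (complex ^ 'n \<Rightarrow> ereal) \<Rightarrow> bool" where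
  "psh_on \<equiv> psh_wrt (*s)"

abbreviation psh_prod_on ::
    "((complex ^ 'n) \<times> complex) set \<Rightarrow> ((complex ^ 'n) \<times> complex \<Rightarrow> ereal) \<Rightarrow> bool" where
  "psh_prod_on \<equiv> psh_wrt (\<lambda>c (z, \<zeta>). (c *s z, c * \<zeta>))"

definition C2_on :: "'a::real_normed_vector set \<Rightarrow> ('a \<Rightarrow> real) \<Rightarrow> bool" where
  "C2_on N f \<longleftrightarrow>
     (\<exists>(D :: 'a \<Rightarrow> 'a \<Rightarrow>\<^sub>L real) (D2 :: 'a \<Rightarrow> 'a \<Rightarrow>\<^sub>L 'a \<Rightarrow>\<^sub>L real).
        (\<forall>z\<in>N. (f has_derivative blinfun_apply (D z)) (at z) \<and>
                (D has_derivative blinfun_apply (D2 z)) (at z)) \<and>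
        continuous_on N D2)"

text \<open>
  The Wirtinger derivatives; axis j 1 and axis j \<i> are the directions of the real
  coordinates Re z_j and Im z_j.
\<close>

definition dz :: "'n::finite \<Rightarrow> (complex ^ 'n \<Rightarrow> complex) \<Rightarrow> complex ^ 'n \<Rightarrow> complex" where
  "dz j f z = (frechet_derivative f (at z) (axis j 1)
               - \<i> * frechet_derivative f (at z) (axis j \<i>)) / 2"

definition dzbar :: "'n::finite \<Rightarrow> (complex ^ 'n \<Rightarrow> complex) \<Rightarrow> complex ^ 'n \<Rightarrow> complex" where
  "dzbar j f z = (frechet_derivative f (at z) (axis j 1)
                  + \<i> * frechet_derivative f (at z) (axis j \<i>)) / 2"

definition levi_form :: "(complex ^ 'n::finite \<Rightarrow> real) \<Rightarrow> complex ^ 'n \<Rightarrow> complex ^ 'n \<Rightarrow> complex" where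
  "levi_form \<rho> z b =
     (\<Sum>j\<in>UNIV. \<Sum>k\<in>UNIV. dz j (dzbar k (\<lambda>w. of_real (\<rho> w))) z * b $ j * cnj (b $ k))"

text \<open>For a C^2 function the Levi form is Hermitian, hence its values are real.\<close>

definition C2_strictly_psh_on :: "(complex ^ 'n::finite) set \<Rightarrow> (complex ^ 'n \<Rightarrow> real) \<Rightarrow> bool" where
  "C2_strictly_psh_on N \<rho> \<longleftrightarrow>
     C2_on N \<rho> \<and> (\<forall>z\<in>N. \<forall>b. b \<noteq> 0 \<longrightarrow> 0 < Re (levi_form \<rho> z b))"

definition strongly_pseudoconvex_domain :: "(complex ^ 'n::finite) set \<Rightarrow> bool" where
  "strongly_pseudoconvex_domain \<Omega> \<longleftrightarrow>
     open \<Omega> \<and> connected \<Omega> \<and> \<Omega> \<noteq> {} \<and>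
     (\<exists>N \<rho>. open N \<and> closure \<Omega> \<subseteq> N \<and> C2_strictly_psh_on N \<rho> \<and>
            \<Omega> = {z \<in> N. \<rho> z < 0} \<and>
            (\<forall>z\<in>frontier \<Omega>. \<exists>g. g \<noteq> 0 \<and> (GDERIV \<rho> z :> g)))"

definition holder_on :: "real \<Rightarrow> 'a::metric_space set \<Rightarrow> ('a \<Rightarrow> real) \<Rightarrow> bool" where
  "holder_on \<alpha> S f \<longleftrightarrow> (\<exists>C. \<forall>z\<in>S. \<forall>w\<in>S. \<bar>f z - f w\<bar> \<le> C * dist z w powr \<alpha>)"

text \<open>
  C^{1,1} up to the boundary: f is continuous on the closure, differentiable in \<Omega>, and
  its first derivative extends to a Lipschitz map on the closure.
\<close>

definition C11_on_closure :: "'a::real_normed_vector set \<Rightarrow> ('a \<Rightarrow> real) \<Rightarrow> bool" where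
  "C11_on_closure \<Omega> f \<longleftrightarrow>
     continuous_on (closure \<Omega>) f \<and>
     (\<exists>(D :: 'a \<Rightarrow> 'a \<Rightarrow>\<^sub>L real) L.
        (\<forall>z\<in>\<Omega>. (f has_derivative blinfun_apply (D z)) (at z)) \<and>
        L-lipschitz_on (closure \<Omega>) D)"

definition annulus :: "complex set" where
  "annulus = {\<zeta>. \<zeta> \<noteq> 0 \<and> 0 < ln (norm \<zeta>) \<and> ln (norm \<zeta>) < 1}"

definition annulus_bdry :: "real \<Rightarrow> complex set" where
  "annulus_bdry s = {\<zeta>. \<zeta> \<noteq> 0 \<and> ln (norm \<zeta>) = s}"

text \<open>
  The filter expresses that \<zeta> tends to the circle within the annulus: a property holds
  eventually iff it holds on the intersection of the annulus with a neighbourhood of the circle.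
\<close>

definition envelope_class ::
    "(complex ^ 'n) set \<Rightarrow> (complex ^ 'n \<Rightarrow> real) \<Rightarrow> (complex ^ 'n \<Rightarrow> real) \<Rightarrow>
     ((complex ^ 'n) \<times> complex \<Rightarrow> ereal) set" where
  "envelope_class \<Omega> u0 u1 =
     {v. psh_prod_on (\<Omega> \<times> annulus) v \<and>
         (\<forall>z\<in>\<Omega>.
            Limsup (SUP a\<in>annulus_bdry 0. at a within annulus) (\<lambda>\<zeta>. v (z, \<zeta>)) \<le> ereal (u0 z) \<and>
            Limsup (SUP a\<in>annulus_bdry 1. at a within annulus) (\<lambda>\<zeta>. v (z, \<zeta>)) \<le> ereal (u1 z))}"

definition envelope ::
    "(complex ^ 'n) set \<Rightarrow> (complex ^ 'n \<Rightarrow> real) \<Rightarrow> (complex ^ 'n \<Rightarrow> real) \<Rightarrow>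
     (complex ^ 'n) \<times> complex \<Rightarrow> ereal" where
  "envelope \<Omega> u0 u1 p = (SUP v\<in>envelope_class \<Omega> u0 u1. v p)"

text \<open>
  The envelope depends on \<zeta> only through its modulus, so it is evaluated at \<zeta> = exp t.
  For z on the boundary of \<Omega> and 0 < t < 1 the value is that of the continuous extension,
  i.e. the limit of the envelope from inside. Only t in [0,1] and z in the closure are meaningful.
\<close>

definition geodesic ::
    "(complex ^ 'n) set \<Rightarrow> (complex ^ 'n \<Rightarrow> real) \<Rightarrow> (complex ^ 'n \<Rightarrow> real) \<Rightarrow>
     real \<Rightarrow> complex ^ 'n \<Rightarrow> ereal" where
  "geodesic \<Omega> u0 u1 t z =
     (if t = 0 then ereal (u0 z)
      else if t = 1 then ereal (u1 z)
      else if z \<in> \<Omega> then envelope \<Omega> u0 u1 (z, of_real (exp t))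
      else Lim (at (z, of_real (exp t)) within \<Omega> \<times> annulus) (envelope \<Omega> u0 u1))"

end

theory Submission
  imports Defs "HOL-Complex_Analysis.Complex_Analysis"
begin

text \<open>
  The proof follows the translation method of Walsh, for the chord
  \<open>h_t(z) = (1 - t) u0(z) + t u1(z)\<close> with \<open>t = ln |\<zeta>|\<close>. On a slice \<open>{z} \<times> annulus\<close> the chord is harmonic,
  and a competitor is subharmonic with boundary limits at most those of the chord. By the maximum
  principle the competitors are exactly the plurisubharmonic functions below the chord
  (\<open>envelope_class_le_chord\<close>, \<open>envelope_classI\<close>).

  Nothing is prescribed on \<open>frontier \<Omega> \<times> annulus\<close>, so the boundary behaviour has to come from a barrier: a
  continuous plurisubharmonic \<open>b\<close> below the chord with \<open>h_t(w) - C |z - w|\<^sup>\<beta> \<le> b(z, \<zeta>)\<close> for all \<open>w\<close>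
  in the frontier (locale \<open>geodesic_barrier\<close>). It squeezes the envelope to the value \<open>h_t(w)\<close> at the
  frontier. It also allows translations: for a competitor \<open>v\<close> and a nonzero vector \<open>y\<close>, the function
  \<open>max b (v(z + y, \<zeta>) - M |y|\<^sup>\<beta>)\<close>, continued by \<open>b\<close> where \<open>z + y\<close> is outside \<open>\<Omega>\<close>, is again a competitor,
  because near the places of transition the barrier is the larger of the two (\<open>psh_glued\<close>). Hence the
  envelope changes by at most \<open>M |y|\<^sup>\<beta>\<close> under translation by \<open>y\<close>, uniformly in \<open>t\<close> (\<open>geodesic_holder\<close>).

  For part (i), strict plurisubharmonicity of the defining function gives an \<open>\<epsilon>\<close> such that all
  \<open>\<rho> - \<epsilon> |z - w|\<^sup>2\<close> are plurisubharmonic. The barrier is the supremum over \<open>w\<close> of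
  \<open>h_t(w) - k (\<epsilon> |z - w|\<^sup>2 - \<rho>)\<^sup>\<beta>\<close> with \<open>\<beta> = \<alpha> / 2\<close> (\<open>holder_barrier\<close>). For part (ii), the barrier is
  \<open>u0 - c' t + A \<rho>\<close>, where \<open>c'\<close> is the constant value of \<open>u0 - u1\<close> on the frontier; it lies below the chord
  for large \<open>A\<close> because Lipschitz functions vanishing on the frontier are bounded by multiples of \<open>- \<rho>\<close>
  (\<open>lipschitz_barrier\<close>). The data are Lipschitz on the closure since their derivatives are bounded and
  nearby points of \<open>\<Omega>\<close> are joined inside \<open>\<Omega>\<close> by paths of comparable length.

  Gluing requires that plurisubharmonicity, defined by sub-mean value inequalities on all discs, is a
  local property (\<open>psh_wrt_local\<close>). This is obtained from a viscosity characterisation: an upper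
  semicontinuous function satisfies the sub-mean value inequality as soon as no strictly superharmonic
  function of the special form \<open>Re P - \<delta> |\<tau> - a|\<^sup>2\<close> touches it from above
  (\<open>sub_mean_value_if_viscosity_subharmonic\<close>). The comparison on the disc is made with harmonic
  polynomials, which are dense among the continuous functions on the circle. The same characterisation
  yields the plurisubharmonicity of the barriers: by a second derivative test for smooth functions, and
  by touching from below for powers and suprema.
\<close>

section \<open>Upper semicontinuous functions\<close>

lemma usc_on_iff_eventually:
  "usc_on G f \<longleftrightarrow> (\<forall>x\<in>G. \<forall>c. f x < c \<longrightarrow> (\<forall>\<^sub>F y in at x within G. f y < c))"
  (is "_ \<longleftrightarrow> ?R")
proof
  assume L: "usc_on G f"
  show ?R
  proof clarify
    fix x c
    assume x: "x \<in> G" "f x < c"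
    obtain T where T: "open T" "{x \<in> G. f x < c} = G \<inter> T"
      using L unfolding usc_on_def openin_open by blast
    then have "x \<in> T" using x by blast
    then show "\<forall>\<^sub>F y in at x within G. f y < c"
      unfolding eventually_at_topological using T by blast
  qed
next
  assume R: ?R
  show "usc_on G f"
    unfolding usc_on_def
  proof
    fix c
    show "openin (top_of_set G) {x \<in> G. f x < c}"
    proof (subst openin_subopen, intro ballI)
      fix x
      assume "x \<in> {x \<in> G. f x < c}"
      then have x: "x \<in> G" "f x < c" by auto
      then obtain S where S: "open S" "x \<in> S" "\<forall>y\<in>S. y \<noteq> x \<longrightarrow> y \<in> G \<longrightarrow> f y < c"
        using R unfolding eventually_at_topological by meson
      have "openin (top_of_set G) (G \<inter> S)"
        using S by blast
      moreover have "x \<in> G \<inter> S" "G \<inter> S \<subseteq> {x \<in> G. f x < c}"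
        using x S by auto
      ultimately show "\<exists>T. openin (top_of_set G) T \<and> x \<in> T \<and> T \<subseteq> {x \<in> G. f x < c}"
        by blast
    qed
  qed
qed

lemma usc_on_subset: "usc_on G f \<Longrightarrow> H \<subseteq> G \<Longrightarrow> usc_on H f"
  unfolding usc_on_iff_eventually by (blast intro: filter_leD[OF at_le])

lemma usc_on_attains_sup:
  assumes "compact K" "K \<noteq> {}" "usc_on K f"
  obtains x where "x \<in> K" "\<And>y. y \<in> K \<Longrightarrow> f y \<le> f x"
proof (rule ccontr)
  assume "\<not> thesis"
  then have less: "\<forall>x\<in>K. \<exists>y\<in>K. f x < f y"
    using that by (meson not_le)
  have "\<forall>y. \<exists>U. open U \<and> {x \<in> K. f x < f y} = K \<inter> U"
    using assms(3) unfolding usc_on_def openin_open by blast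
  then obtain U where U: "\<And>y. open (U y)" "\<And>y. {x \<in> K. f x < f y} = K \<inter> U y"
    by metis
  have "K \<subseteq> (\<Union>y\<in>K. U y)"
    using less U(2) by blast
  then obtain F where F: "F \<subseteq> K" "finite F" "K \<subseteq> (\<Union>y\<in>F. U y)"
    using compactE_image[OF assms(1), of K U] U(1) by metis
  then have "F \<noteq> {}"
    using assms(2) by auto
  obtain m where m: "m \<in> F" "\<forall>y\<in>F. f y \<le> f m"
    using Max_in[of "f ` F"] Max_ge[of "f ` F"] F(2) \<open>F \<noteq> {}\<close> by (metis (no_types, opaque_lifting) finite_imageI imageE imageI image_is_empty)
  then obtain y where "y \<in> F" "m \<in> U y"
    using F by auto
  then have "f m < f y"
    using U(2)[of y] m(1) F(1) by auto
  then show False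
    using m \<open>y \<in> F\<close> by (meson not_le)
qed

lemma usc_on_continuous_compose:
  assumes "usc_on G f" "continuous_on H h" "h ` H \<subseteq> G"
  shows "usc_on H (\<lambda>x. f (h x))"
  unfolding usc_on_def
proof
  fix c
  have "openin (top_of_set H) (H \<inter> h -` {x\<in>G. f x < c})"
    using continuous_on_open_gen[of h H G] assms unfolding usc_on_def by (auto simp: image_subset_iff)
  moreover have "H \<inter> h -` {x\<in>G. f x < c} = {x \<in> H. f (h x) < c}"
    using assms(3) by auto
  ultimately show "openin (top_of_set H) {x \<in> H. f (h x) < c}"
    by simp
qed

lemma usc_on_continuous:
  assumes "continuous_on G f"
  shows "usc_on G (\<lambda>x. ereal (f x))"
  unfolding usc_on_iff_eventually
proof clarify
  fix x c
  assume "x \<in> G" "ereal (f x) < c"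
  moreover have "((\<lambda>y. ereal (f y)) \<longlongrightarrow> ereal (f x)) (at x within G)"
    using assms \<open>x \<in> G\<close> by (intro tendsto_ereal) (simp add: continuous_on_def)
  ultimately show "\<forall>\<^sub>F y in at x within G. ereal (f y) < c"
    using order_tendstoD(2) by blast
qed

lemma usc_on_add_continuous:
  assumes "usc_on G f" "continuous_on G h"
  shows "usc_on G (\<lambda>x. f x + ereal (h x))"
  unfolding usc_on_iff_eventually
proof clarify
  fix x c
  assume x: "x \<in> G" "f x + ereal (h x) < c"
  then have "f x < c - ereal (h x)"
    by (simp add: ereal_less_minus_iff)
  then obtain r where r: "f x < ereal r" "ereal r < c - ereal (h x)"
    using ereal_dense2 by blast
  then have "ereal (r + h x) < c"
    by (simp add: ereal_less_minus)
  moreover have "((\<lambda>y. ereal (r + h y)) \<longlongrightarrow> ereal (r + h x)) (at x within G)"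
    using assms(2) x(1) by (intro tendsto_intros) (auto simp: continuous_on_def)
  ultimately have "\<forall>\<^sub>F y in at x within G. ereal (r + h y) < c"
    by (rule order_tendstoD(2)[rotated])
  moreover have "\<forall>\<^sub>F y in at x within G. f y < ereal r"
    using assms(1) x(1) r unfolding usc_on_iff_eventually by blast
  ultimately show "\<forall>\<^sub>F y in at x within G. f y + ereal (h y) < c"
  proof eventually_elim
    case (elim y)
    have "f y + ereal (h y) \<le> ereal r + ereal (h y)"
      using elim(2) by (intro add_mono) auto
    then show ?case using elim(1) by (metis le_less_trans plus_ereal.simps(1))
  qed
qed

lemma usc_on_max:
  assumes "usc_on G f" "usc_on G g"
  shows "usc_on G (\<lambda>x. max (f x) (g x))"
  using assms unfolding usc_on_iff_eventually by (auto intro: eventually_conj)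

section \<open>Means over circles\<close>

lemma circle_mean_mono:
  assumes "\<And>\<theta>. \<theta> \<in> {0..2*pi} \<Longrightarrow> f \<theta> \<le> g \<theta>"
  shows "circle_mean f \<le> circle_mean g"
  unfolding circle_mean_def
  using assms
  by (intro ereal_divide_right_mono ereal_minus_mono)
     (auto simp: less_eq_ennreal.rep_eq[symmetric] intro!: nn_integral_mono e2ennreal_mono split: split_indicator)

text \<open>
  For an upper bound \<open>M\<close> the integral of \<open>M - f\<close> is a single integral of a nonnegative function.
  It carries the same information as the difference of two integrals in the definition, and
  monotone convergence applies to it.
\<close>

lemma circle_mean_eq_upper:
  fixes M :: real
  assumes meas: "f \<in> borel_measurable borel" and le: "\<And>\<theta>. \<theta> \<in> {0..2*pi} \<Longrightarrow> f \<theta> \<le> ereal M"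
    and "M \<ge> 0"
  shows "circle_mean f =
    (ereal (2 * pi * M) - enn2ereal (\<integral>\<^sup>+\<theta>\<in>{0..2*pi}. e2ennreal (ereal M - f \<theta>) \<partial>lborel)) / ereal (2 * pi)"
proof -
  define A where "A = (\<integral>\<^sup>+\<theta>\<in>{0..2*pi}. e2ennreal (f \<theta>) \<partial>lborel)"
  define B where "B = (\<integral>\<^sup>+\<theta>\<in>{0..2*pi}. e2ennreal (- f \<theta>) \<partial>lborel)"
  define I where "I = (\<integral>\<^sup>+\<theta>\<in>{0..2*pi}. e2ennreal (ereal M - f \<theta>) \<partial>lborel)"
  have Mint: "(\<integral>\<^sup>+\<theta>\<in>{0..2*pi}. ennreal M \<partial>lborel) = ennreal (2 * pi * M)"
    using \<open>M \<ge> 0\<close> by (simp add: nn_integral_cmult_indicator ennreal_mult[symmetric] mult_ac)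
  have [measurable]: "(\<lambda>\<theta>. e2ennreal (f \<theta>)) \<in> borel_measurable borel"
     "(\<lambda>\<theta>. e2ennreal (- f \<theta>)) \<in> borel_measurable borel"
     "(\<lambda>\<theta>. e2ennreal (ereal M - f \<theta>)) \<in> borel_measurable borel"
    using meas by measurable
  have pt: "e2ennreal (f \<theta>) + e2ennreal (ereal M - f \<theta>) = ennreal M + e2ennreal (- f \<theta>)"
    if "\<theta> \<in> {0..2*pi}" for \<theta>
  proof (cases "f \<theta>")
    case (real r)
    have "r \<le> M" using le[OF that] real by simp
    then show ?thesis
      using \<open>M \<ge> 0\<close> real by (cases "r \<ge> 0") (auto simp: ennreal_neg ennreal_plus[symmetric] simp del: ennreal_plus)
  next
    case PInf
    then show ?thesis using le[OF that] by simp
  next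
    case MInf
    then show ?thesis by (simp add: e2ennreal_neg)
  qed
  have "A + I = (\<integral>\<^sup>+\<theta>\<in>{0..2*pi}. (e2ennreal (f \<theta>) + e2ennreal (ereal M - f \<theta>)) \<partial>lborel)"
    unfolding A_def I_def by (subst nn_integral_add[symmetric]) (auto intro!: nn_integral_cong simp: distrib_right)
  also have "\<dots> = (\<integral>\<^sup>+\<theta>\<in>{0..2*pi}. (ennreal M + e2ennreal (- f \<theta>)) \<partial>lborel)"
    by (intro nn_integral_cong) (auto simp: pt split: split_indicator)
  also have "\<dots> = ennreal (2 * pi * M) + B"
    unfolding B_def Mint[symmetric] by (subst nn_integral_add[symmetric]) (auto intro!: nn_integral_cong simp: distrib_right)
  finally have sum: "A + I = ennreal (2 * pi * M) + B" .
  have "A \<le> (\<integral>\<^sup>+\<theta>\<in>{0..2*pi}. ennreal M \<partial>lborel)"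
    unfolding A_def using le
    by (intro nn_integral_mono) (auto split: split_indicator simp: e2ennreal_ereal[symmetric] simp del: e2ennreal_ereal intro!: e2ennreal_mono)
  then have "A \<le> ennreal (2 * pi * M)" by (simp only: Mint)
  then obtain a where a: "A = ennreal a" "a \<ge> 0"
    using neq_top_trans[OF ennreal_neq_top] by (metis ennreal_cases)
  have "enn2ereal A - enn2ereal B = ereal (2 * pi * M) - enn2ereal I"
  proof -
    have "enn2ereal A + enn2ereal I = ereal (2 * pi * M) + enn2ereal B"
      using arg_cong[OF sum, of enn2ereal] \<open>M \<ge> 0\<close>
      by (simp add: plus_ennreal.rep_eq enn2ereal_ennreal)
    moreover have "enn2ereal A = ereal a"
      using a by (simp add: enn2ereal_ennreal)
    moreover have "enn2ereal I \<ge> 0" "enn2ereal B \<ge> 0"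
      by simp_all
    ultimately show ?thesis
      by (cases "enn2ereal I"; cases "enn2ereal B") simp_all
  qed
  then show ?thesis
    unfolding circle_mean_def A_def[symmetric] B_def[symmetric] I_def[symmetric] by simp
qed

lemma circle_mean_real:
  assumes "continuous_on {0..2*pi} k"
  shows "circle_mean (\<lambda>\<theta>. ereal (k \<theta>)) = ereal (integral {0..2*pi} k / (2 * pi))"
proof -
  let ?I = "{0..2*pi}"
  have ci: "set_integrable lborel ?I k"
    using borel_integrable_atLeastAtMost'[OF assms] .
  have e: "(\<integral>\<^sup>+\<theta>\<in>?I. ennreal (f \<theta>) \<partial>lborel) = (\<integral>\<^sup>+\<theta>. ennreal (indicator ?I \<theta> *\<^sub>R f \<theta>) \<partial>lborel)" for f
    by (intro nn_integral_cong) (simp split: split_indicator)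
  have "integral ?I k = integral\<^sup>L lborel (\<lambda>\<theta>. indicator ?I \<theta> *\<^sub>R k \<theta>)"
    using set_borel_integral_eq_integral(2)[OF ci] by (simp add: set_lebesgue_integral_def)
  also have "\<dots> = enn2real (\<integral>\<^sup>+\<theta>\<in>?I. ennreal (k \<theta>) \<partial>lborel) - enn2real (\<integral>\<^sup>+\<theta>\<in>?I. ennreal (- k \<theta>) \<partial>lborel)"
    using real_lebesgue_integral_def[OF ci[unfolded set_integrable_def]] unfolding e by simp
  finally have 1: "integral ?I k = \<dots>" .
  have fin: "(\<integral>\<^sup>+\<theta>\<in>?I. ennreal (k \<theta>) \<partial>lborel) \<noteq> \<infinity>" "(\<integral>\<^sup>+\<theta>\<in>?I. ennreal (- k \<theta>) \<partial>lborel) \<noteq> \<infinity>"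
    using ci unfolding e set_integrable_def real_integrable_def by auto
  then have "enn2ereal (\<integral>\<^sup>+\<theta>\<in>?I. ennreal (k \<theta>) \<partial>lborel) = ereal (enn2real (\<integral>\<^sup>+\<theta>\<in>?I. ennreal (k \<theta>) \<partial>lborel))"
    "enn2ereal (\<integral>\<^sup>+\<theta>\<in>?I. ennreal (- k \<theta>) \<partial>lborel) = ereal (enn2real (\<integral>\<^sup>+\<theta>\<in>?I. ennreal (- k \<theta>) \<partial>lborel))"
    by (metis ennreal_enn2real enn2ereal_ennreal enn2real_nonneg infinity_ennreal_def top.not_eq_extremum)+
  with 1 show ?thesis
    unfolding circle_mean_def by simp
qed

text \<open>
  Cauchy's formula on the circle of radius \<open>r\<close>, with the contour integral written out in the angle.
\<close>

lemma mean_value_holomorphic: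
  assumes "P holomorphic_on ball c R" "0 < r" "r < R"
  shows "integral {0..2*pi} (\<lambda>\<theta>. Re (P (c + of_real r * cis \<theta>))) = 2 * pi * Re (P c)"
    and "continuous_on {0..2*pi} (\<lambda>\<theta>. Re (P (c + of_real r * cis \<theta>)))"
proof -
  have "P holomorphic_on cball c r"
    using assms by (auto intro: holomorphic_on_subset)
  then have "((\<lambda>u. P u / (u - c)) has_contour_integral (2 * of_real pi * \<i> * P c)) (circlepath c r)"
    using assms(2) by (intro Cauchy_integral_circlepath_simple) auto
  then have "((\<lambda>t. P (c + of_real r * cis t) / (of_real r * cis t) * of_real r * \<i> * cis t) has_integral
      (2 * of_real pi * \<i> * P c)) {0..2*pi}"
    unfolding circlepath_def by (subst (asm) has_contour_integral_part_circlepath_iff) auto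
  moreover have "(\<lambda>t. P (c + of_real r * cis t) / (of_real r * cis t) * of_real r * \<i> * cis t) =
     (\<lambda>t. \<i> * P (c + of_real r * cis t))"
    using assms(2) by (auto simp: field_simps)
  ultimately have "((\<lambda>t. \<i> * P (c + of_real r * cis t)) has_integral (2 * of_real pi * \<i> * P c)) {0..2*pi}"
    by simp
  from has_integral_linear[OF this bounded_linear_Im]
  have "((\<lambda>t. Re (P (c + of_real r * cis t))) has_integral (2 * pi * Re (P c))) {0..2*pi}"
    by (simp add: o_def)
  then show "integral {0..2*pi} (\<lambda>\<theta>. Re (P (c + of_real r * cis \<theta>))) = 2 * pi * Re (P c)"
    by (rule integral_unique)
  have "continuous_on (ball c R) P"
    using assms(1) holomorphic_on_imp_continuous_on by blast
  then have "continuous_on {0..2*pi} (\<lambda>\<theta>. P (c + of_real r * cis \<theta>))"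
    by (rule continuous_on_compose2) (use assms in \<open>auto simp: dist_norm norm_mult intro!: continuous_intros\<close>)
  then show "continuous_on {0..2*pi} (\<lambda>\<theta>. Re (P (c + of_real r * cis \<theta>)))"
    by (intro continuous_intros)
qed

section \<open>Boundary values of harmonic polynomials\<close>

text \<open>
  Functions on the unit circle whose harmonic extension to the disc is the real part of a
  polynomial; restricted to the circle these are the trigonometric polynomials.
\<close>

definition circle_harmonics :: "(complex \<Rightarrow> real) set" where
  "circle_harmonics = {f. \<exists>p. \<forall>z\<in>sphere 0 1. f z = Re (poly p z)}"

lemma circle_harmonics_add:
  assumes "f \<in> circle_harmonics" "g \<in> circle_harmonics"
  shows "(\<lambda>z. f z + g z) \<in> circle_harmonics"
proof -
  obtain p q where "\<forall>z\<in>sphere 0 1. f z = Re (poly p z)" "\<forall>z\<in>sphere 0 1. g z = Re (poly q z)"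
    using assms unfolding circle_harmonics_def by blast
  then have "\<forall>z\<in>sphere 0 1. f z + g z = Re (poly (p + q) z)" by simp
  then show ?thesis unfolding circle_harmonics_def by blast
qed

lemma circle_harmonics_sum:
  assumes "finite A" "\<And>a. a \<in> A \<Longrightarrow> f a \<in> circle_harmonics"
  shows "(\<lambda>z. \<Sum>a\<in>A. f a z) \<in> circle_harmonics"
  using assms
proof (induction A rule: finite_induct)
  case empty
  have "\<forall>z\<in>sphere 0 1. 0 = Re (poly 0 z)" by simp
  then show ?case unfolding circle_harmonics_def by (auto intro!: exI[of _ 0])
next
  case (insert a A)
  then show ?case using circle_harmonics_add[of "f a" "\<lambda>z. \<Sum>a\<in>A. f a z"] by simp
qed

text \<open>
  On the unit circle \<open>cnj z\<close> is the inverse of \<open>z\<close>, so powers cancel; if a negative power remains,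
  conjugation inside the real part turns it into a positive one.
\<close>

lemma circle_harmonics_monom_cnj: "(\<lambda>z. Re (c * z ^ i * cnj z ^ j)) \<in> circle_harmonics"
proof -
  have one: "z * cnj z = 1" if "z \<in> sphere 0 1" for z
    using that by (simp add: complex_norm_square[symmetric])
  have red: "z ^ (k + n) * cnj z ^ k = z ^ n" if "z \<in> sphere 0 1" for z k n
    using one[OF that] by (simp add: power_add power_mult_distrib[symmetric] mult_ac)
  show ?thesis
  proof (cases "j \<le> i")
    case True
    then have "Re (c * z ^ i * cnj z ^ j) = Re (poly (monom c (i - j)) z)" if "z \<in> sphere 0 1" for z
      using red[OF that, of j "i - j"] by (simp add: poly_monom mult.assoc)
    then show ?thesis unfolding circle_harmonics_def by blast
  next
    case False
    have "Re (c * z ^ i * cnj z ^ j) = Re (poly (monom (cnj c) (j - i)) z)" if "z \<in> sphere 0 1" for z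
    proof -
      have "Re (c * z ^ i * cnj z ^ j) = Re (cnj (c * z ^ i * cnj z ^ j))" by (rule cnj.sel(1)[symmetric])
      also have "cnj (c * z ^ i * cnj z ^ j) = cnj c * (z ^ (i + (j - i)) * cnj z ^ i)"
        using False by simp
      finally show ?thesis
        by (simp only: red[OF that] poly_monom)
    qed
    then show ?thesis unfolding circle_harmonics_def by blast
  qed
qed

text \<open>
  From \<open>Re a * Re b = Re (a * b) / 2 + Re (a * cnj b) / 2\<close>. The mixed term expands into monomials
  in \<open>z\<close> and \<open>cnj z\<close>.
\<close>

lemma circle_harmonics_mult:
  assumes "f \<in> circle_harmonics" "g \<in> circle_harmonics"
  shows "(\<lambda>z. f z * g z) \<in> circle_harmonics"
proof -
  obtain p q where pq: "\<forall>z\<in>sphere 0 1. f z = Re (poly p z)" "\<forall>z\<in>sphere 0 1. g z = Re (poly q z)"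
    using assms unfolding circle_harmonics_def by blast
  define h where "h z = (\<Sum>i\<le>degree p. \<Sum>j\<le>degree q. Re (coeff p i * cnj (coeff q j) / 2 * z ^ i * cnj z ^ j))" for z
  have h: "h \<in> circle_harmonics"
    unfolding h_def by (intro circle_harmonics_sum circle_harmonics_monom_cnj) auto
  have "poly p z * cnj (poly q z) / 2 = (\<Sum>i\<le>degree p. \<Sum>j\<le>degree q. coeff p i * cnj (coeff q j) / 2 * z ^ i * cnj z ^ j)" for z
    unfolding poly_altdef cnj_sum sum_product sum_divide_distrib by (intro sum.cong) auto
  then have hz: "h z = Re (poly p z * cnj (poly q z) / 2)" for z
    unfolding h_def Re_sum[symmetric] by presburger
  have "Re a * Re b = Re (a * b / 2) + Re (a * cnj b / 2)" for a b
    by (simp add: field_simps)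
  then have "f z * g z = Re (poly (smult (1/2) (p * q)) z) + h z" if "z \<in> sphere 0 1" for z
    using pq that unfolding hz by simp
  moreover have "(\<lambda>z. Re (poly (smult (1/2) (p * q)) z)) \<in> circle_harmonics"
    unfolding circle_harmonics_def by blast
  from circle_harmonics_add[OF this h] obtain r
    where "\<forall>z\<in>sphere 0 1. Re (poly (smult (1/2) (p * q)) z) + h z = Re (poly r z)"
    unfolding circle_harmonics_def by blast
  ultimately show ?thesis unfolding circle_harmonics_def by force
qed

text \<open>
  Stone--Weierstrass. This replaces the Poisson integral: the Dirichlet problem on the disc is
  solved up to an arbitrarily small error on the boundary.
\<close>

lemma circle_harmonics_dense:
  assumes "continuous_on (sphere 0 1) \<phi>" "e > 0"
  obtains p where "\<And>z. z \<in> sphere 0 1 \<Longrightarrow> \<bar>\<phi> z - Re (poly p z)\<bar> < e"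
proof -
  have "function_ring_on circle_harmonics (sphere (0::complex) 1)"
  proof
    fix f assume "f \<in> circle_harmonics"
    then obtain p where p: "\<forall>z\<in>sphere 0 1. f z = Re (poly p z)"
      unfolding circle_harmonics_def by blast
    have "continuous_on (sphere 0 1) (\<lambda>z. Re (poly p z))"
      by (intro continuous_intros)
    then show "continuous_on (sphere 0 1) f"
      by (rule continuous_on_eq) (use p in auto)
  next
    fix c :: real
    have "c = Re (poly [:of_real c:] z)" for z by simp
    then show "(\<lambda>_. c) \<in> circle_harmonics" unfolding circle_harmonics_def by blast
  next
    fix x y :: complex assume "x \<noteq> y"
    have "Re \<in> circle_harmonics" "Im \<in> circle_harmonics"
    proof -
      have "Re z = Re (poly [:0, 1:] z)" "Im z = Re (poly [:0, -\<i>:] z)" for z by auto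
      then show "Re \<in> circle_harmonics" "Im \<in> circle_harmonics"
        unfolding circle_harmonics_def by blast+
    qed
    then show "\<exists>f\<in>circle_harmonics. f x \<noteq> f y"
      using \<open>x \<noteq> y\<close> complex_eqI by blast
  qed (auto intro: circle_harmonics_add circle_harmonics_mult)
  then interpret function_ring_on circle_harmonics "sphere (0::complex) 1" .
  obtain g where "g \<in> circle_harmonics" "\<forall>z\<in>sphere 0 1. \<bar>\<phi> z - g z\<bar> < e"
    using Stone_Weierstrass_basic[OF assms] by blast
  then obtain p where "\<forall>z\<in>sphere 0 1. g z = Re (poly p z)"
    unfolding circle_harmonics_def by blast
  then show ?thesis
    using that[of p] \<open>\<forall>z\<in>sphere 0 1. \<bar>\<phi> z - g z\<bar> < e\<close> by auto
qed

section \<open>Approximating the circle mean from above\<close>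

text \<open>
  The approximations are sup-convolutions: the supremum over \<open>y\<close> of \<open>f y - n * dist x y\<close>, with \<open>f\<close>
  truncated below at \<open>- n\<close> to stay finite, is \<open>n\<close>-Lipschitz in \<open>x\<close> and lies above \<open>f\<close>. As \<open>n\<close> grows,
  points at a fixed distance from \<open>x\<close> stop contributing, so the values come down to \<open>f x\<close>.
\<close>

lemma usc_on_decreasing_approximation:
  fixes f :: "'a::metric_space \<Rightarrow> ereal"
  assumes "usc_on S f" "compact S" and finite: "\<And>x. x \<in> S \<Longrightarrow> f x < \<infinity>"
  obtains \<phi> M where "\<And>n. continuous_on S (\<phi> n)" "M \<ge> 0"
    "\<And>n x. x \<in> S \<Longrightarrow> f x \<le> ereal (\<phi> n x)" "\<And>n x. x \<in> S \<Longrightarrow> \<phi> n x \<le> M"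
    "\<And>n x. x \<in> S \<Longrightarrow> \<phi> (Suc n) x \<le> \<phi> n x"
    "\<And>x c. x \<in> S \<Longrightarrow> f x < ereal c \<Longrightarrow> \<exists>n. \<phi> n x \<le> c"
proof (cases "S = {}")
  case True
  then show ?thesis using that[of "\<lambda>_ _. 0" 0] by auto
next
  case False
  obtain m where "m \<in> S" "\<And>y. y \<in> S \<Longrightarrow> f y \<le> f m"
    using usc_on_attains_sup[OF assms(2) False assms(1)] by metis
  moreover have "f m < \<infinity>" using finite \<open>m \<in> S\<close> by simp
  then have "f m \<le> ereal (real_of_ereal (f m))" by (cases "f m") auto
  ultimately obtain M0 where M0: "\<And>y. y \<in> S \<Longrightarrow> f y \<le> ereal M0"
    using order_trans by blast
  define M where "M = max M0 0"
  have M: "M \<ge> 0" "\<And>y. y \<in> S \<Longrightarrow> f y \<le> ereal M"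
    unfolding M_def by (simp, meson M0 ereal_less_eq(3) max.cobounded1 order_trans)
  define g where "g n y = real_of_ereal (max (f y) (ereal (- real n)))" for n y
  have g: "ereal (g n y) = max (f y) (ereal (- real n))" "g n y \<le> M" if "y \<in> S" for n y
  proof -
    show 1: "ereal (g n y) = max (f y) (ereal (- real n))"
      unfolding g_def using finite[OF that] by (cases "f y") (auto simp: max_def)
    have "ereal (- real n) \<le> ereal M" using M(1) by simp
    then have "ereal (g n y) \<le> ereal M"
      unfolding 1 using M(2)[OF that] by (simp only: max.bounded_iff)
    then show "g n y \<le> M" by simp
  qed
  define \<phi> where "\<phi> n x = (SUP y\<in>S. g n y - real n * dist x y)" for n x
  have bdd: "bdd_above ((\<lambda>y. g n y - real n * dist x y) ` S)" for n x
  proof (rule bdd_aboveI2)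
    fix y assume "y \<in> S"
    have "0 \<le> real n * dist x y" by simp
    then show "g n y - real n * dist x y \<le> M" using g(2)[OF \<open>y \<in> S\<close>, of n] by linarith
  qed
  have upper: "g n y - real n * dist x y \<le> \<phi> n x" if "y \<in> S" for n x y
    unfolding \<phi>_def by (rule cSUP_upper[OF that bdd])
  have least: "\<phi> n x \<le> c" if "\<And>y. y \<in> S \<Longrightarrow> g n y - real n * dist x y \<le> c" for n x c
    unfolding \<phi>_def by (rule cSUP_least[OF False that])
  have lip: "\<phi> n x \<le> \<phi> n x' + real n * dist x x'" for n x x'
  proof (rule least)
    fix y assume "y \<in> S"
    have "real n * dist x' y \<le> real n * (dist x x' + dist x y)"
      by (intro mult_left_mono) (metis dist_commute dist_triangle, simp)
    then show "g n y - real n * dist x y \<le> \<phi> n x' + real n * dist x x'"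
      using upper[OF \<open>y \<in> S\<close>, of n x'] by (simp add: distrib_left)
  qed
  show ?thesis
  proof
    fix n
    have "(real n)-lipschitz_on S (\<phi> n)"
    proof (rule lipschitz_onI)
      fix x y
      show "dist (\<phi> n x) (\<phi> n y) \<le> real n * dist x y"
        using lip[of n x y] lip[of n y x] by (simp add: dist_real_def dist_commute abs_le_iff)
    qed simp
    then show "continuous_on S (\<phi> n)" by (rule lipschitz_on_continuous_on)
  next
    show "M \<ge> 0" by (rule M)
  next
    fix n x assume x: "x \<in> S"
    have "f x \<le> ereal (g n x)" by (simp add: g(1)[OF x])
    also have "g n x \<le> \<phi> n x" using upper[OF x, of n x] by simp
    finally show "f x \<le> ereal (\<phi> n x)" by simp
  next
    fix n x assume x: "x \<in> S"
    show "\<phi> n x \<le> M"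
    proof (rule least)
      fix y assume "y \<in> S"
      have "0 \<le> real n * dist x y" by simp
      then show "g n y - real n * dist x y \<le> M" using g(2)[OF \<open>y \<in> S\<close>, of n] by linarith
    qed
  next
    fix n x assume x: "x \<in> S"
    show "\<phi> (Suc n) x \<le> \<phi> n x"
    proof (rule least)
      fix y assume y: "y \<in> S"
      have "ereal (g (Suc n) y) \<le> ereal (g n y)"
        unfolding g(1)[OF y] by (intro max.mono) auto
      then have "g (Suc n) y \<le> g n y" by simp
      moreover have "real n * dist x y \<le> real (Suc n) * dist x y"
        by (intro mult_right_mono) auto
      ultimately show "g (Suc n) y - real (Suc n) * dist x y \<le> \<phi> n x"
        using upper[OF y, of n x] by linarith
    qed
  next
    fix x c assume x: "x \<in> S" "f x < ereal c"
    then have "\<forall>\<^sub>F y in at x within S. f y < ereal c"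
      using assms(1) unfolding usc_on_iff_eventually by blast
    then obtain r where r: "r > 0" "\<And>y. y \<in> S \<Longrightarrow> y \<noteq> x \<Longrightarrow> dist y x < r \<Longrightarrow> f y < ereal c"
      unfolding eventually_at by blast
    obtain n :: nat where n: "real n > max (- c) ((M - c) / r)"
      using reals_Archimedean2 by blast
    have "\<phi> n x \<le> c"
    proof (rule least)
      fix y assume y: "y \<in> S"
      show "g n y - real n * dist x y \<le> c"
      proof (cases "dist y x < r")
        case True
        then have "f y < ereal c" using r(2)[OF y] x by (cases "y = x") auto
        moreover have "ereal (- real n) \<le> ereal c" using n by simp
        ultimately have "ereal (g n y) \<le> ereal c"
          unfolding g(1)[OF y] by (simp only: max.bounded_iff less_imp_le)
        moreover have "0 \<le> real n * dist x y" by simp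
        ultimately show ?thesis unfolding ereal_less_eq by linarith
      next
        case False
        have "M - c < real n * r" using n r(1) by (simp add: field_simps)
        also have "\<dots> \<le> real n * dist x y"
          using False by (intro mult_left_mono) (auto simp: dist_commute)
        finally show ?thesis using g(2)[OF y, of n] by linarith
      qed
    qed
    then show "\<exists>n. \<phi> n x \<le> c" ..
  qed
qed

text \<open>
  The circle mean of an upper semicontinuous function is the infimum of the means of its continuous
  majorants, by monotone convergence along a decreasing sequence of such majorants.
\<close>

lemma le_circle_mean_if_le_majorant_means:
  fixes f :: "complex \<Rightarrow> ereal" and x :: ereal
  assumes usc: "usc_on (sphere 0 1) f" and fin: "\<And>z. z \<in> sphere 0 1 \<Longrightarrow> f z < \<infinity>"
    and maj: "\<And>\<phi>. continuous_on (sphere 0 1) \<phi> \<Longrightarrow> (\<And>z. z \<in> sphere 0 1 \<Longrightarrow> f z \<le> ereal (\<phi> z)) \<Longrightarrow>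
       x \<le> circle_mean (\<lambda>\<theta>. ereal (\<phi> (cis \<theta>)))"
  shows "x \<le> circle_mean (\<lambda>\<theta>. f (cis \<theta>))"
proof -
  obtain \<phi> M where \<phi>: "\<And>n. continuous_on (sphere 0 1) (\<phi> n)" "M \<ge> 0"
    "\<And>n z. z \<in> sphere 0 1 \<Longrightarrow> f z \<le> ereal (\<phi> n z)" "\<And>n z. z \<in> sphere 0 1 \<Longrightarrow> \<phi> n z \<le> M"
    "\<And>n z. z \<in> sphere 0 1 \<Longrightarrow> \<phi> (Suc n) z \<le> \<phi> n z"
    "\<And>z c. z \<in> sphere 0 1 \<Longrightarrow> f z < ereal c \<Longrightarrow> \<exists>n. \<phi> n z \<le> c"
    using usc_on_decreasing_approximation[OF usc compact_sphere fin] by blast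
  have s: "cis \<theta> \<in> sphere 0 1" for \<theta> by simp
  have cphi: "continuous_on UNIV (\<lambda>\<theta>. \<phi> n (cis \<theta>))" for n
    by (rule continuous_on_compose2[OF \<phi>(1)]) (auto intro!: continuous_intros)
  have m\<phi>: "(\<lambda>\<theta>. ereal (\<phi> n (cis \<theta>))) \<in> borel_measurable borel" for n
    using borel_measurable_continuous_onI[OF cphi] by measurable
  have mf: "(\<lambda>\<theta>. f (cis \<theta>)) \<in> borel_measurable borel"
  proof (rule borel_measurableI_less)
    fix c
    have "usc_on UNIV (\<lambda>\<theta>. f (cis \<theta>))"
      by (rule usc_on_continuous_compose[OF usc]) (auto intro!: continuous_intros)
    then have "open {\<theta>. f (cis \<theta>) < c}" unfolding usc_on_def by simp
    then show "{\<theta> \<in> space borel. f (cis \<theta>) < c} \<in> sets borel" by simp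
  qed
  define J where "J n = (\<integral>\<^sup>+\<theta>\<in>{0..2*pi}. e2ennreal (ereal M - ereal (\<phi> n (cis \<theta>))) \<partial>lborel)" for n
  define I where "I = (\<integral>\<^sup>+\<theta>\<in>{0..2*pi}. e2ennreal (ereal M - f (cis \<theta>)) \<partial>lborel)"
  have fM: "f z \<le> ereal M" if "z \<in> sphere 0 1" for z
    using \<phi>(3,4)[OF that, of 0] by (meson ereal_less_eq(3) order_trans)
  have cf: "circle_mean (\<lambda>\<theta>. f (cis \<theta>)) = (ereal (2 * pi * M) - enn2ereal I) / ereal (2 * pi)"
    unfolding I_def by (intro circle_mean_eq_upper mf fM s \<phi>(2))
  have c\<phi>: "circle_mean (\<lambda>\<theta>. ereal (\<phi> n (cis \<theta>))) = (ereal (2 * pi * M) - enn2ereal (J n)) / ereal (2 * pi)" for n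
    unfolding J_def by (intro circle_mean_eq_upper m\<phi> \<phi>(2)) (simp add: \<phi>(4))
  have pt: "e2ennreal (ereal M - f z) = (SUP n. e2ennreal (ereal M - ereal (\<phi> n z)))" if z: "z \<in> sphere 0 1" for z
  proof (rule antisym)
    show "(SUP n. e2ennreal (ereal M - ereal (\<phi> n z))) \<le> e2ennreal (ereal M - f z)"
      by (intro SUP_least e2ennreal_mono ereal_minus_mono \<phi>(3) z) simp
    show "e2ennreal (ereal M - f z) \<le> (SUP n. e2ennreal (ereal M - ereal (\<phi> n z)))"
    proof (rule dense_le)
      fix y assume y: "y < e2ennreal (ereal M - f z)"
      then have "y \<noteq> top" by auto
      then obtain r where r: "y = ennreal r" "r \<ge> 0" by (cases y) auto
      have "ereal r < ereal M - f z"
        using y r fM[OF z] by (metis e2ennreal_ereal e2ennreal_mono not_less)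
      then have "f z < ereal (M - r)"
        by (cases "f z") auto
      then obtain n where "\<phi> n z \<le> M - r" using \<phi>(6)[OF z] by blast
      then have "y \<le> e2ennreal (ereal M - ereal (\<phi> n z))"
        unfolding r using r(2) by (simp add: ennreal_leI)
      also have "\<dots> \<le> (SUP n. e2ennreal (ereal M - ereal (\<phi> n z)))"
        by (rule SUP_upper) simp
      finally show "y \<le> (SUP n. e2ennreal (ereal M - ereal (\<phi> n z)))" .
    qed
  qed
  have "I = (\<integral>\<^sup>+\<theta>. (SUP n. e2ennreal (ereal M - ereal (\<phi> n (cis \<theta>))) * indicator {0..2*pi} \<theta>) \<partial>lborel)"
    unfolding I_def by (intro nn_integral_cong) (auto simp: pt split: split_indicator)
  also have "\<dots> = (SUP n. J n)"
    unfolding J_def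
  proof (rule nn_integral_monotone_convergence_SUP)
    show "incseq (\<lambda>n \<theta>. e2ennreal (ereal M - ereal (\<phi> n (cis \<theta>))) * indicator {0..2*pi} \<theta>)"
      by (intro incseq_SucI le_funI mult_right_mono e2ennreal_mono ereal_minus_mono) (auto simp: \<phi>(5))
    show "(\<lambda>\<theta>. e2ennreal (ereal M - ereal (\<phi> n (cis \<theta>))) * indicator {0..2*pi} \<theta>) \<in> borel_measurable lborel" for n
      using m\<phi>[of n] by measurable
  qed
  finally have I: "I = (SUP n. J n)" .
  have le: "x \<le> (ereal (2 * pi * M) - enn2ereal (J n)) / ereal (2 * pi)" for n
    unfolding c\<phi>[symmetric] by (intro maj \<phi>)
  show ?thesis
  proof (cases x)
    case (real r)
    have "J n \<le> ennreal (2 * pi * M - 2 * pi * r)" for n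
      using le[of n] unfolding real
      by (cases "J n") (auto simp: enn2ereal_ennreal field_simps intro!: ennreal_leI)
    then have "I \<le> ennreal (2 * pi * M - 2 * pi * r)" unfolding I by (rule SUP_least)
    moreover from this have "I \<noteq> top" by (rule neq_top_trans[OF ennreal_neq_top])
    then obtain i where "I = ennreal i" "i \<ge> 0" by (cases I) auto
    moreover have "2 * pi * M - 2 * pi * r \<ge> 0"
    proof (cases "J 0")
      case (real a)
      then have "r \<le> (2 * pi * M - a) / (2 * pi)"
        using le[of 0] \<open>x = ereal r\<close> by (simp add: enn2ereal_ennreal)
      then have "r * (2 * pi) \<le> 2 * pi * M - a"
        by (subst (asm) pos_le_divide_eq) auto
      moreover have "r * (2 * pi) = 2 * pi * r" by simp
      ultimately show ?thesis using real(1) by linarith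
    next
      case top
      then show ?thesis using le[of 0] \<open>x = ereal r\<close> by simp
    qed
    ultimately show ?thesis
      unfolding cf real by (auto simp: enn2ereal_ennreal field_simps)
  next
    case PInf
    then show ?thesis using le[of 0] by (cases "J 0") (auto simp: enn2ereal_ennreal)
  qed simp
qed

section \<open>Viscosity subharmonicity\<close>

text \<open>
  No strictly superharmonic function \<open>Re P - \<delta> |\<tau> - a|\<^sup>2\<close> touches \<open>g\<close> from above at \<open>a\<close>. These few
  test functions suffice to characterise subharmonicity, and the condition is visibly local. It
  holds vacuously where \<open>g a = -\<infinity>\<close>.
\<close>

definition viscosity_subharmonic_at :: "(complex \<Rightarrow> ereal) \<Rightarrow> complex \<Rightarrow> bool" where
  "viscosity_subharmonic_at g a \<longleftrightarrow>
     (\<forall>P r \<delta>. 0 < r \<and> 0 < \<delta> \<and> P holomorphic_on ball a r \<and> g a = ereal (Re (P a)) \<longrightarrow>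
        (\<exists>\<tau>\<in>ball a r. ereal (Re (P \<tau>) - \<delta> * (norm (\<tau> - a))\<^sup>2) < g \<tau>))"

text \<open>
  A test function touching \<open>h\<close> from above also touches every \<open>g\<close> with \<open>g \<le> h\<close> and \<open>g a = h a\<close>. For
  this reason maxima, attained suprema and increasing convex functions of subharmonic functions are
  easy to handle.
\<close>

lemma viscosity_subharmonic_at_touching:
  assumes "viscosity_subharmonic_at g a" "g a = h a" "\<forall>\<^sub>F \<tau> in nhds a. g \<tau> \<le> h \<tau>"
  shows "viscosity_subharmonic_at h a"
  unfolding viscosity_subharmonic_at_def
proof clarify
  fix P r \<delta>
  assume *: "0 < r" "0 < (\<delta>::real)" "P holomorphic_on ball a r" "h a = ereal (Re (P a))"
  obtain s where s: "s > 0" "\<And>\<tau>. dist \<tau> a < s \<Longrightarrow> g \<tau> \<le> h \<tau>"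
    using assms(3) unfolding eventually_nhds_metric by blast
  have "P holomorphic_on ball a (min r s)"
    using *(3) by (rule holomorphic_on_subset) auto
  then obtain \<tau> where "\<tau> \<in> ball a (min r s)" "ereal (Re (P \<tau>) - \<delta> * (norm (\<tau> - a))\<^sup>2) < g \<tau>"
    using assms(1)[unfolded viscosity_subharmonic_at_def, rule_format, of "min r s" \<delta> P] assms(2) * s(1) by auto
  then show "\<exists>\<tau>\<in>ball a r. ereal (Re (P \<tau>) - \<delta> * (norm (\<tau> - a))\<^sup>2) < h \<tau>"
    using s(2)[of \<tau>] by (intro bexI[of _ \<tau>]) (auto simp: dist_commute)
qed

lemma viscosity_subharmonic_at_shift:
  assumes "viscosity_subharmonic_at (\<lambda>\<sigma>. g (a + \<sigma>)) 0"
  shows "viscosity_subharmonic_at g a"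
  unfolding viscosity_subharmonic_at_def
proof clarify
  fix P r \<delta>
  assume *: "0 < r" "0 < (\<delta>::real)" "P holomorphic_on ball a r" "g a = ereal (Re (P a))"
  have "(P \<circ> (\<lambda>\<sigma>. a + \<sigma>)) holomorphic_on ball 0 r"
    by (rule holomorphic_on_compose_gen[OF _ *(3)]) (auto intro!: holomorphic_intros simp: dist_norm)
  then obtain \<sigma> where "\<sigma> \<in> ball 0 r" "ereal (Re (P (a + \<sigma>)) - \<delta> * (norm \<sigma>)\<^sup>2) < g (a + \<sigma>)"
    using assms[unfolded viscosity_subharmonic_at_def, rule_format, of r \<delta> "P \<circ> (\<lambda>\<sigma>. a + \<sigma>)"] * by auto
  then show "\<exists>\<tau>\<in>ball a r. ereal (Re (P \<tau>) - \<delta> * (norm (\<tau> - a))\<^sup>2) < g \<tau>"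
    by (intro bexI[of _ "a + \<sigma>"]) (auto simp: dist_norm)
qed

lemma viscosity_subharmonic_at_add_harmonic:
  assumes "viscosity_subharmonic_at g a" "Q holomorphic_on ball a s" "s > 0"
  shows "viscosity_subharmonic_at (\<lambda>\<tau>. g \<tau> + ereal (Re (Q \<tau>))) a"
  unfolding viscosity_subharmonic_at_def
proof clarify
  fix P r \<delta>
  assume *: "0 < r" "0 < (\<delta>::real)" "P holomorphic_on ball a r" "g a + ereal (Re (Q a)) = ereal (Re (P a))"
  have "P holomorphic_on ball a (min r s)" "Q holomorphic_on ball a (min r s)"
    by (rule holomorphic_on_subset[OF *(3)] holomorphic_on_subset[OF assms(2)], simp add: subset_ball)+
  then have "(\<lambda>\<tau>. P \<tau> - Q \<tau>) holomorphic_on ball a (min r s)"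
    by (rule holomorphic_on_diff)
  moreover have "g a = ereal (Re (P a - Q a))"
    using *(4) by (cases "g a") auto
  ultimately obtain \<tau> where "\<tau> \<in> ball a (min r s)"
    "ereal (Re (P \<tau> - Q \<tau>) - \<delta> * (norm (\<tau> - a))\<^sup>2) < g \<tau>"
    using assms(1)[unfolded viscosity_subharmonic_at_def, rule_format, of "min r s" \<delta> "\<lambda>\<tau>. P \<tau> - Q \<tau>"] assms(3) * by auto
  then show "\<exists>\<tau>\<in>ball a r. ereal (Re (P \<tau>) - \<delta> * (norm (\<tau> - a))\<^sup>2) < g \<tau> + ereal (Re (Q \<tau>))"
    by (intro bexI[of _ \<tau>]) (cases "g \<tau>", auto)
qed

text \<open>
  If a test function touched \<open>g\<close> at \<open>a\<close>, then the mean of \<open>g\<close> over a circle of radius \<open>s\<close> would be at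
  most \<open>g a - \<delta> s\<^sup>2\<close>.
\<close>

lemma viscosity_subharmonic_at_if_small_means:
  assumes "R > 0" and mean: "\<And>r. 0 < r \<Longrightarrow> r < R \<Longrightarrow> g a \<le> circle_mean (\<lambda>\<theta>. g (a + of_real r * cis \<theta>))"
  shows "viscosity_subharmonic_at g a"
  unfolding viscosity_subharmonic_at_def
proof (clarify, rule ccontr)
  fix P r \<delta>
  assume *: "0 < r" "0 < (\<delta>::real)" "P holomorphic_on ball a r" "g a = ereal (Re (P a))"
    and "\<not> (\<exists>\<tau>\<in>ball a r. ereal (Re (P \<tau>) - \<delta> * (norm (\<tau> - a))\<^sup>2) < g \<tau>)"
  then have le: "g \<tau> \<le> ereal (Re (P \<tau>) - \<delta> * (norm (\<tau> - a))\<^sup>2)" if "\<tau> \<in> ball a r" for \<tau>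
    using that by (meson not_le)
  define s where "s = min R r / 2"
  have s: "0 < s" "s < R" "s < r" using \<open>R > 0\<close> *(1) by (auto simp: s_def)
  note mv = mean_value_holomorphic[OF *(3) s(1,3)]
  have "g a \<le> circle_mean (\<lambda>\<theta>. g (a + of_real s * cis \<theta>))"
    by (rule mean[OF s(1,2)])
  also have "\<dots> \<le> circle_mean (\<lambda>\<theta>. ereal (Re (P (a + of_real s * cis \<theta>)) - \<delta> * s\<^sup>2))"
  proof (rule circle_mean_mono)
    fix \<theta>
    have "a + of_real s * cis \<theta> \<in> ball a r" using s by (simp add: dist_norm norm_mult)
    from le[OF this] show "g (a + of_real s * cis \<theta>) \<le> ereal (Re (P (a + of_real s * cis \<theta>)) - \<delta> * s\<^sup>2)"
      using s by (simp add: norm_mult)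
  qed
  also have "\<dots> = ereal (integral {0..2*pi} (\<lambda>\<theta>. Re (P (a + of_real s * cis \<theta>)) - \<delta> * s\<^sup>2) / (2 * pi))"
    by (intro circle_mean_real continuous_intros mv(2))
  also have "integral {0..2*pi} (\<lambda>\<theta>. Re (P (a + of_real s * cis \<theta>)) - \<delta> * s\<^sup>2) = 2 * pi * (Re (P a) - \<delta> * s\<^sup>2)"
    using integrable_continuous_real[OF mv(2)] mv(1)
    by (subst integral_diff) (auto simp: algebra_simps)
  finally have "\<delta> * s\<^sup>2 \<le> 0"
    using *(4) by simp
  moreover have "\<delta> * s\<^sup>2 > 0" using *(2) s(1) by simp
  ultimately show False by simp
qed

lemma second_derivative_nonpos_at_maximum:
  fixes \<phi> d :: "real \<Rightarrow> real"
  assumes "r > 0" and der: "\<And>s. \<bar>s\<bar> < r \<Longrightarrow> (\<phi> has_real_derivative d s) (at s)"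
    and der2: "(d has_real_derivative D) (at 0)"
    and max: "\<And>s. \<bar>s\<bar> < r \<Longrightarrow> \<phi> s \<le> \<phi> 0"
  shows "D \<le> 0"
proof (rule ccontr)
  assume "\<not> D \<le> 0"
  then have "D > 0" by simp
  have d0: "d 0 = 0"
    using DERIV_local_max[OF der[of 0] \<open>r > 0\<close>] \<open>r > 0\<close> max by simp
  obtain e where e: "e > 0" "\<forall>h>0. h < e \<longrightarrow> d 0 < d (0 + h)"
    using DERIV_pos_inc_right[OF der2 \<open>D > 0\<close>] by blast
  define s where "s = min e r / 2"
  have s: "0 < s" "s < e" "s < r" using e(1) \<open>r > 0\<close> by (auto simp: s_def)
  obtain z where z: "0 < z" "z < s" "\<phi> s - \<phi> 0 = (s - 0) * d z"
    using MVT2[of 0 s \<phi> d] s der by force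
  have "d z > 0" using e(2) z(1,2) s(2) d0 by auto
  then have "(s - 0) * d z > 0" using s(1) by simp
  then have "\<phi> s > \<phi> 0" using z(3) by linarith
  then show False using max[of s] s by simp
qed

lemma has_real_derivative_Re_along_line:
  assumes "(f has_field_derivative D) (at (a + c * of_real s))"
  shows "((\<lambda>s. Re (f (a + c * of_real s))) has_real_derivative Re (c * D)) (at s)"
proof -
  have "((\<lambda>s. a + c * of_real s) has_vector_derivative c) (at s)"
    by (auto intro!: derivative_eq_intros simp: has_vector_derivative_def scaleR_conv_of_real)
  from field_vector_diff_chain_at[OF this assms]
  have "((\<lambda>s. f (a + c * of_real s)) has_vector_derivative c * D) (at s)"
    by (simp add: o_def)
  from bounded_linear.has_vector_derivative[OF bounded_linear_Re this]
  show ?thesis by (simp add: has_real_derivative_iff_has_vector_derivative)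
qed

text \<open>
  The hypothesis says that the second derivatives along the directions \<open>1\<close> and \<open>\<i>\<close> add up to
  \<open>D \<ge> 0\<close>. For a function touched by \<open>Re P - \<delta> |\<tau> - a|\<^sup>2\<close> the second derivative test at the maximum
  of the difference gives \<open>D + 4 \<delta> \<le> 0\<close>, because the contributions of the harmonic function
  \<open>Re P\<close> cancel.
\<close>

lemma viscosity_subharmonic_at_if_laplacian_nonneg:
  fixes q :: "complex \<Rightarrow> real"
  assumes "R > 0"
    and der: "\<And>s. \<bar>s\<bar> < R \<Longrightarrow> ((\<lambda>s. q (a + of_real s) + q (a + \<i> * of_real s)) has_real_derivative d s) (at s)"
    and der2: "(d has_real_derivative D) (at 0)" and "D \<ge> 0"
  shows "viscosity_subharmonic_at (\<lambda>\<tau>. ereal (q \<tau>)) a"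
  unfolding viscosity_subharmonic_at_def
proof (intro allI impI, elim conjE, rule ccontr)
  fix P r \<delta>
  assume *: "0 < r" "0 < (\<delta>::real)" "P holomorphic_on ball a r" "ereal (q a) = ereal (Re (P a))"
    and "\<not> (\<exists>\<tau>\<in>ball a r. ereal (Re (P \<tau>) - \<delta> * (norm (\<tau> - a))\<^sup>2) < ereal (q \<tau>))"
  then have le: "q \<tau> \<le> Re (P \<tau>) - \<delta> * (norm (\<tau> - a))\<^sup>2" if "\<tau> \<in> ball a r" for \<tau>
    using that by (auto simp: not_less)
  \<comment> \<open>Both directions are added before the second derivative test, so that one test in a single real variable suffices.\<close>
  define \<phi> where "\<phi> s = q (a + of_real s) + q (a + \<i> * of_real s)
     - Re (P (a + 1 * of_real s)) - Re (P (a + \<i> * of_real s)) + 2 * \<delta> * s\<^sup>2" for s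
  define e where "e s = d s - Re (1 * deriv P (a + 1 * of_real s)) - Re (\<i> * deriv P (a + \<i> * of_real s)) + 4 * \<delta> * s" for s
  have P1: "(P has_field_derivative deriv P x) (at x)" if "x \<in> ball a r" for x
    using *(3) that by (metis holomorphic_derivI open_ball)
  have P2: "(deriv P has_field_derivative deriv (deriv P) x) (at x)" if "x \<in> ball a r" for x
    using holomorphic_deriv[OF *(3)] that by (metis holomorphic_derivI open_ball)
  have in_ball: "a + 1 * of_real s \<in> ball a r" "a + \<i> * of_real s \<in> ball a r" if "\<bar>s\<bar> < r" for s
    using that by (auto simp: dist_norm norm_mult)
  have d\<phi>: "(\<phi> has_real_derivative e s) (at s)" if s: "\<bar>s\<bar> < min r R" for s
  proof -
    have s': "\<bar>s\<bar> < r" "\<bar>s\<bar> < R" using s by auto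
    show ?thesis
      unfolding \<phi>_def e_def
    proof (intro DERIV_add DERIV_diff)
      show "((\<lambda>s. 2 * \<delta> * s\<^sup>2) has_real_derivative 4 * \<delta> * s) (at s)"
        using DERIV_cmult[OF DERIV_power[OF DERIV_ident, of 2], of "2 * \<delta>" s UNIV] by (simp add: mult_ac)
    qed (rule der[OF s'(2)] has_real_derivative_Re_along_line[OF P1[OF in_ball(1)[OF s'(1)]]]
        has_real_derivative_Re_along_line[OF P1[OF in_ball(2)[OF s'(1)]]])+
  qed
  have max\<phi>: "\<phi> s \<le> \<phi> 0" if s: "\<bar>s\<bar> < min r R" for s
    using le[OF in_ball(1), of s] le[OF in_ball(2), of s] s *(4) unfolding \<phi>_def by (simp add: norm_mult)
  have i2: "((\<lambda>s. Re (\<i> * deriv P (a + \<i> * of_real s))) has_real_derivative Re (\<i> * (\<i> * deriv (deriv P) a))) (at 0)"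
    by (rule has_real_derivative_Re_along_line[where f = "\<lambda>x. \<i> * deriv P x" and c = \<i>])
       (use P2[of a] *(1) in \<open>auto intro!: derivative_eq_intros\<close>)
  have i1: "((\<lambda>s. Re (1 * deriv P (a + 1 * of_real s))) has_real_derivative Re (1 * (1 * deriv (deriv P) a))) (at 0)"
    by (rule has_real_derivative_Re_along_line[where f = "\<lambda>x. 1 * deriv P x" and c = 1])
       (use P2[of a] *(1) in \<open>auto intro!: derivative_eq_intros\<close>)
  have de: "(e has_real_derivative (D + 4 * \<delta>)) (at 0)"
    using DERIV_add[OF DERIV_diff[OF DERIV_diff[OF der2 i1] i2] DERIV_cmult_Id[of "4 * \<delta>"]]
    unfolding e_def by simp
  have "D + 4 * \<delta> \<le> 0"
    by (rule second_derivative_nonpos_at_maximum[where r = "min r R", OF _ d\<phi> de max\<phi>]) (use *(1) \<open>R > 0\<close> in auto)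
  then show False using *(2) \<open>D \<ge> 0\<close> by simp
qed

text \<open>
  If \<open>g\<close> exceeded the harmonic function \<open>h\<close> somewhere, then so would \<open>g + \<delta> |\<tau>|\<^sup>2\<close> for small \<open>\<delta>\<close>, by more
  than its boundary values allow. At an interior maximum of \<open>g + \<delta> |\<tau>|\<^sup>2 - h\<close> a test function touches
  \<open>g\<close>.
\<close>

lemma viscosity_maximum_principle:
  assumes "compact K" and usc: "usc_on K g" and cont: "continuous_on K h"
    and sub: "\<And>a. a \<in> U \<Longrightarrow> viscosity_subharmonic_at g a" and fin: "\<And>a. a \<in> U \<Longrightarrow> g a < \<infinity>"
    and harm: "\<And>a. a \<in> U \<Longrightarrow> \<exists>r>0. \<exists>Q. Q holomorphic_on ball a r \<and> ball a r \<subseteq> K \<and> (\<forall>\<tau>\<in>ball a r. h \<tau> = Re (Q \<tau>))"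
    and bdry: "\<And>a. a \<in> K - U \<Longrightarrow> g a \<le> ereal (h a)"
    and "b \<in> K"
  shows "g b \<le> ereal (h b)"
proof (rule ccontr)
  assume "\<not> g b \<le> ereal (h b)"
  then obtain y where y: "ereal (h b) < ereal y" "ereal y < g b"
    using ereal_dense2 by (meson not_le)
  obtain B where B: "B > 0" "\<And>\<tau>. \<tau> \<in> K \<Longrightarrow> norm \<tau> \<le> B"
    using compact_imp_bounded[OF \<open>compact K\<close>] unfolding bounded_pos by blast
  define \<delta> where "\<delta> = (y - h b) / B\<^sup>2"
  have \<delta>: "\<delta> > 0" "\<delta> * B\<^sup>2 = y - h b" using y B(1) by (auto simp: \<delta>_def)
  define G where "G \<tau> = g \<tau> + ereal (\<delta> * (norm \<tau>)\<^sup>2 - h \<tau>)" for \<tau>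
  have "usc_on K G"
    unfolding G_def by (intro usc_on_add_continuous usc continuous_intros cont)
  then obtain a where a: "a \<in> K" "\<And>\<tau>. \<tau> \<in> K \<Longrightarrow> G \<tau> \<le> G a"
    using usc_on_attains_sup[OF \<open>compact K\<close>] \<open>b \<in> K\<close> by blast
  have "ereal (\<delta> * B\<^sup>2) < g b + ereal (- h b)"
    using y unfolding \<delta>(2) by (cases "g b") auto
  also have "\<dots> \<le> G b"
    unfolding G_def using \<delta>(1) by (intro add_left_mono) auto
  also have "\<dots> \<le> G a" by (rule a(2)[OF \<open>b \<in> K\<close>])
  finally have Ga: "ereal (\<delta> * B\<^sup>2) < G a" .
  have "a \<in> U"
  proof (rule ccontr)
    assume "a \<notin> U"
    then have "G a \<le> ereal (h a) + ereal (\<delta> * (norm a)\<^sup>2 - h a)"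
      unfolding G_def using bdry[of a] a(1) by (intro add_right_mono) auto
    also have "\<dots> \<le> ereal (\<delta> * B\<^sup>2)"
      using \<delta>(1) B(2)[OF a(1)] by (simp add: power_mono)
    finally show False using Ga by simp
  qed
  then obtain \<gamma> where \<gamma>: "g a = ereal \<gamma>"
    using fin[of a] Ga unfolding G_def by (cases "g a") auto
  obtain r Q where r: "r > 0" "Q holomorphic_on ball a r" "ball a r \<subseteq> K" "\<forall>\<tau>\<in>ball a r. h \<tau> = Re (Q \<tau>)"
    using harm[OF \<open>a \<in> U\<close>] by blast
  \<comment> \<open>Up to a constant and a real part of a linear function, \<open>|\<tau>|\<^sup>2\<close> equals \<open>|\<tau> - a|\<^sup>2\<close>.\<close>
  define P where "P \<tau> = Q \<tau> - of_real (2 * \<delta>) * (\<tau> * cnj a) + of_real (\<gamma> - h a + 2 * \<delta> * (norm a)\<^sup>2)" for \<tau>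
  have "P holomorphic_on ball a r"
    unfolding P_def by (intro holomorphic_intros r(2))
  moreover have aa: "Re (a * cnj a) = (norm a)\<^sup>2"
    by (metis Re_complex_of_real complex_norm_square of_real_power)
  then have "g a = ereal (Re (P a))"
    unfolding P_def \<gamma> using r(1,4) by simp
  ultimately obtain \<tau> where \<tau>: "\<tau> \<in> ball a r" "ereal (Re (P \<tau>) - \<delta> * (norm (\<tau> - a))\<^sup>2) < g \<tau>"
    using sub[OF \<open>a \<in> U\<close>] r(1) \<delta>(1) unfolding viscosity_subharmonic_at_def by blast
  have "(norm (\<tau> - a))\<^sup>2 = (norm \<tau>)\<^sup>2 - 2 * Re (\<tau> * cnj a) + (norm a)\<^sup>2"
    unfolding cmod_power2 by (simp add: power2_eq_square algebra_simps)
  moreover have "Re (P \<tau>) = h \<tau> - 2 * \<delta> * Re (\<tau> * cnj a) + (\<gamma> - h a + 2 * \<delta> * (norm a)\<^sup>2)"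
    unfolding P_def using r(4) \<tau>(1) by (simp add: algebra_simps)
  ultimately have "Re (P \<tau>) - \<delta> * (norm (\<tau> - a))\<^sup>2 = h \<tau> + \<gamma> - h a + \<delta> * (norm a)\<^sup>2 - \<delta> * (norm \<tau>)\<^sup>2"
    by (simp only: right_diff_distrib distrib_left)
  moreover have "G \<tau> \<le> G a" using a(2) r(3) \<tau>(1) by blast
  ultimately show False
    using \<tau>(2) unfolding G_def \<gamma> by (cases "g \<tau>") auto
qed

text \<open>
  Every continuous majorant \<open>\<phi>\<close> on the circle is within \<open>e\<close> of a harmonic polynomial above it. By the
  maximum principle the polynomial bounds \<open>g\<close> inside, in particular at the centre, where its value is
  its own circle mean.
\<close>

lemma sub_mean_value_if_viscosity_subharmonic:
  assumes usc: "usc_on (cball 0 1) g" and fin: "\<And>\<tau>. \<tau> \<in> cball 0 1 \<Longrightarrow> g \<tau> < \<infinity>"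
    and sub: "\<And>a. a \<in> ball 0 1 \<Longrightarrow> viscosity_subharmonic_at g a"
  shows "g 0 \<le> circle_mean (\<lambda>\<theta>. g (cis \<theta>))"
proof (rule le_circle_mean_if_le_majorant_means)
  show "usc_on (sphere 0 1) g" by (rule usc_on_subset[OF usc]) auto
  show "g z < \<infinity>" if "z \<in> sphere 0 1" for z using fin that by simp
  fix \<phi> :: "complex \<Rightarrow> real"
  assume \<phi>: "continuous_on (sphere 0 1) \<phi>" and le: "\<And>z. z \<in> sphere 0 1 \<Longrightarrow> g z \<le> ereal (\<phi> z)"
  have c\<phi>: "continuous_on {0..2*pi} (\<lambda>\<theta>. \<phi> (cis \<theta>))"
    by (rule continuous_on_compose2[OF \<phi>]) (auto intro!: continuous_intros)
  show "g 0 \<le> circle_mean (\<lambda>\<theta>. ereal (\<phi> (cis \<theta>)))"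
  proof (rule ereal_le_epsilon2)
    fix e :: real assume "e > 0"
    obtain p where p: "\<And>z. z \<in> sphere 0 1 \<Longrightarrow> \<bar>\<phi> z - Re (poly p z)\<bar> < e / 2"
      using circle_harmonics_dense[OF \<phi>, of "e / 2"] \<open>e > 0\<close> by auto
    define P where "P z = poly p z + of_real (e / 2)" for z
    have holP: "P holomorphic_on A" for A
      unfolding P_def by (intro holomorphic_intros)
    have P: "\<phi> z \<le> Re (P z)" "Re (P z) \<le> \<phi> z + e" if "z \<in> sphere 0 1" for z
      using p[OF that] unfolding P_def by (auto simp: abs_if split: if_splits)
    have "g 0 \<le> ereal (Re (P 0))"
    proof (rule viscosity_maximum_principle[where K = "cball 0 1" and U = "ball 0 1" and h = "\<lambda>\<tau>. Re (P \<tau>)"])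
      show "usc_on (cball 0 1) g" by (rule usc)
      show "continuous_on (cball 0 1) (\<lambda>\<tau>. Re (P \<tau>))"
        unfolding P_def by (intro continuous_intros)
      show "g a \<le> ereal (Re (P a))" if "a \<in> cball 0 1 - ball 0 1" for a
      proof -
        have "a \<in> sphere 0 1" using that by auto
        then show ?thesis using le[of a] P(1)[of a] by (meson ereal_less_eq(3) order_trans)
      qed
      fix a :: complex assume a: "a \<in> ball 0 1"
      show "\<exists>r>0. \<exists>Q. Q holomorphic_on ball a r \<and> ball a r \<subseteq> cball 0 1 \<and> (\<forall>\<tau>\<in>ball a r. Re (P \<tau>) = Re (Q \<tau>))"
      proof (intro exI conjI)
        show "1 - norm a > 0" using a by simp
        show "P holomorphic_on ball a (1 - norm a)" by (rule holP)
        show "ball a (1 - norm a) \<subseteq> cball 0 1"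
          by (rule ball_subset_cball[THEN subset_trans[rotated], OF _ ]) (auto simp: ball_subset_ball_iff)
      qed simp
    qed (use sub fin in auto)
    also have "\<dots> \<le> circle_mean (\<lambda>\<theta>. ereal (\<phi> (cis \<theta>))) + ereal e"
    proof -
      have "P holomorphic_on ball 0 2" by (rule holP)
      from mean_value_holomorphic[OF this, of 1]
      have mv: "2 * pi * Re (P 0) = integral {0..2*pi} (\<lambda>\<theta>. Re (P (cis \<theta>)))"
        "continuous_on {0..2*pi} (\<lambda>\<theta>. Re (P (cis \<theta>)))" by auto
      have "integral {0..2*pi} (\<lambda>\<theta>. Re (P (cis \<theta>))) \<le> integral {0..2*pi} (\<lambda>\<theta>. \<phi> (cis \<theta>) + e)"
        by (intro integral_le integrable_continuous_real mv(2) continuous_intros c\<phi>) (simp add: P(2))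
      also have "\<dots> = integral {0..2*pi} (\<lambda>\<theta>. \<phi> (cis \<theta>)) + 2 * pi * e"
        using integrable_continuous_real[OF c\<phi>] by (subst integral_add) auto
      finally have "Re (P 0) \<le> integral {0..2*pi} (\<lambda>\<theta>. \<phi> (cis \<theta>)) / (2 * pi) + e"
        unfolding mv(1)[symmetric] by (simp add: field_simps)
      then show ?thesis unfolding circle_mean_real[OF c\<phi>] by simp
    qed
    finally show "g 0 \<le> circle_mean (\<lambda>\<theta>. ereal (\<phi> (cis \<theta>))) + ereal e" .
  qed
qed

section \<open>Plurisubharmonicity as a local property\<close>

text \<open>
  What is used of the complex structure when a function is restricted to complex lines.
\<close>

locale complex_scaling =
  fixes sc :: "complex \<Rightarrow> 'a::real_normed_vector \<Rightarrow> 'a"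
  assumes sc_add: "sc (\<sigma> + \<tau>) b = sc \<sigma> b + sc \<tau> b"
    and sc_sc: "sc \<sigma> (sc \<tau> b) = sc (\<sigma> * \<tau>) b"
    and continuous_sc: "continuous_on UNIV (\<lambda>\<tau>. sc \<tau> b)"
begin

lemma sc_zero: "sc 0 b = 0"
  using sc_add[of 0 0 b] by simp

lemma continuous_on_slice: "continuous_on A (\<lambda>\<tau>. x + sc \<tau> b)"
  by (intro continuous_intros continuous_on_subset[OF continuous_sc]) simp

lemma eventually_slice:
  assumes "\<forall>\<^sub>F y in nhds x. P y"
  shows "\<forall>\<^sub>F \<tau> in nhds 0. P (x + sc \<tau> b)"
proof -
  have "((\<lambda>\<tau>. x + sc \<tau> b) \<longlongrightarrow> x + sc 0 b) (nhds 0)"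
    using continuous_on_slice[of UNIV x b] tendsto_at_iff_tendsto_nhds[of "\<lambda>\<tau>. x + sc \<tau> b" 0]
    by (simp add: continuous_on_eq_continuous_at isCont_def)
  then show ?thesis
    using assms unfolding sc_zero filterlim_iff by simp
qed

lemma psh_wrt_imp_usc_on: "psh_wrt sc G f \<Longrightarrow> usc_on G f"
  unfolding psh_wrt_def by simp

lemma psh_wrt_less_top: "psh_wrt sc G f \<Longrightarrow> x \<in> G \<Longrightarrow> f x < \<infinity>"
  unfolding psh_wrt_def by simp

lemma psh_wrt_sub_mean_value:
  "psh_wrt sc G f \<Longrightarrow> (\<And>\<tau>. \<tau> \<in> cball 0 1 \<Longrightarrow> a + sc \<tau> b \<in> G) \<Longrightarrow>
   f a \<le> circle_mean (\<lambda>\<theta>. f (a + sc (cis \<theta>) b))"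
  unfolding psh_wrt_def by blast

text \<open>
  The sub-mean value inequality is required on all closed discs in \<open>G\<close>, large ones included, whereas
  the right-hand side only concerns arbitrarily small neighbourhoods of each point.
\<close>

lemma psh_wrt_iff_viscosity_subharmonic:
  assumes "open G"
  shows "psh_wrt sc G f \<longleftrightarrow> usc_on G f \<and> (\<forall>x\<in>G. f x < \<infinity>) \<and>
     (\<forall>x\<in>G. \<forall>b. viscosity_subharmonic_at (\<lambda>\<tau>. f (x + sc \<tau> b)) 0)"
proof (intro iffI conjI ballI allI)
  assume L: "psh_wrt sc G f"
  show "usc_on G f" "\<And>x. x \<in> G \<Longrightarrow> f x < \<infinity>"
    using psh_wrt_imp_usc_on[OF L] psh_wrt_less_top[OF L] by blast+
  fix x b assume "x \<in> G"
  then have "\<forall>\<^sub>F y in nhds x. y \<in> G"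
    using \<open>open G\<close> by (rule eventually_nhds_in_open[rotated])
  then obtain R where R: "R > 0" "\<And>\<tau>. dist \<tau> 0 < R \<Longrightarrow> x + sc \<tau> b \<in> G"
    using eventually_slice[of "\<lambda>y. y \<in> G" x b] unfolding eventually_nhds_metric by blast
  show "viscosity_subharmonic_at (\<lambda>\<tau>. f (x + sc \<tau> b)) 0"
  proof (rule viscosity_subharmonic_at_if_small_means[OF R(1)])
    fix r assume r: "0 < r" "r < R"
    have "x + sc \<tau> (sc (of_real r) b) \<in> G" if "\<tau> \<in> cball 0 1" for \<tau>
    proof -
      have "norm \<tau> * r \<le> 1 * r" using that r by (intro mult_right_mono) auto
      then have "norm \<tau> * r < R" using r by linarith
      then have "dist (\<tau> * of_real r) 0 < R" using r by (simp add: norm_mult)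
      then show ?thesis
        unfolding sc_sc by (rule R(2))
    qed
    then have "f x \<le> circle_mean (\<lambda>\<theta>. f (x + sc (cis \<theta>) (sc (of_real r) b)))"
      by (intro psh_wrt_sub_mean_value[OF L]) blast
    then show "f (x + sc 0 b) \<le> circle_mean (\<lambda>\<theta>. f (x + sc (0 + of_real r * cis \<theta>) b))"
      by (simp add: sc_sc sc_zero mult.commute)
  qed
next
  assume R: "usc_on G f \<and> (\<forall>x\<in>G. f x < \<infinity>) \<and>
     (\<forall>x\<in>G. \<forall>b. viscosity_subharmonic_at (\<lambda>\<tau>. f (x + sc \<tau> b)) 0)"
  show "psh_wrt sc G f"
    unfolding psh_wrt_def
  proof (intro conjI allI impI)
    show "usc_on G f" "\<forall>x\<in>G. f x < \<infinity>" using R by blast+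
    fix a b assume ab: "\<forall>\<tau>\<in>cball 0 1. a + sc \<tau> b \<in> G"
    define g where "g \<tau> = f (a + sc \<tau> b)" for \<tau>
    have "g 0 \<le> circle_mean (\<lambda>\<theta>. g (cis \<theta>))"
    proof (rule sub_mean_value_if_viscosity_subharmonic)
      show "usc_on (cball 0 1) g"
        unfolding g_def
      proof (rule usc_on_continuous_compose[where h = "\<lambda>\<tau>. a + sc \<tau> b"])
        show "usc_on G f" using R by blast
        show "(\<lambda>\<tau>. a + sc \<tau> b) ` cball 0 1 \<subseteq> G" using ab by blast
      qed (rule continuous_on_slice)
      show "g \<tau> < \<infinity>" if "\<tau> \<in> cball 0 1" for \<tau>
        using R ab that unfolding g_def by blast
      fix \<tau> :: complex assume "\<tau> \<in> ball 0 1"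
      then have "a + sc \<tau> b \<in> G" using ab by simp
      then have "viscosity_subharmonic_at (\<lambda>\<sigma>. g (\<tau> + \<sigma>)) 0"
        using R unfolding g_def sc_add add.assoc[symmetric] by blast
      then show "viscosity_subharmonic_at g \<tau>"
        by (rule viscosity_subharmonic_at_shift)
    qed
    then show "f a \<le> circle_mean (\<lambda>\<theta>. f (a + sc (cis \<theta>) b))"
      by (simp add: g_def sc_zero)
  qed
qed

text \<open>
  This is what permits gluing: a function may be given by different plurisubharmonic functions on
  different open pieces, although a disc may run through several pieces.
\<close>

lemma psh_wrt_local:
  assumes "open G"
    and loc: "\<And>x. x \<in> G \<Longrightarrow> \<exists>V h. open V \<and> x \<in> V \<and> psh_wrt sc V h \<and> (\<forall>y\<in>V. f y = h y)"
  shows "psh_wrt sc G f"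
  unfolding psh_wrt_iff_viscosity_subharmonic[OF \<open>open G\<close>]
proof (intro conjI ballI allI)
  show "usc_on G f"
    unfolding usc_on_iff_eventually
  proof (intro ballI allI impI)
    fix x c assume x: "x \<in> G" "f x < c"
    obtain V h where V: "open V" "x \<in> V" "psh_wrt sc V h" "\<forall>y\<in>V. f y = h y"
      using loc[OF x(1)] by blast
    have "usc_on V h" using V(3) by (rule psh_wrt_imp_usc_on)
    moreover have "h x < c" using x(2) V(2,4) by simp
    ultimately have "\<forall>\<^sub>F y in at x within V. h y < c"
      using V(2) unfolding usc_on_iff_eventually by blast
    then have "\<forall>\<^sub>F y in at x. h y < c"
      unfolding at_within_open[OF V(2,1)] .
    moreover have "\<forall>\<^sub>F y in at x. y \<in> V"
      using V(1,2) by (rule eventually_at_in_open')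
    ultimately have "\<forall>\<^sub>F y in at x. f y < c"
      by eventually_elim (use V(4) in auto)
    then show "\<forall>\<^sub>F y in at x within G. f y < c"
      using filter_leD[OF at_le[OF subset_UNIV]] by blast
  qed
next
  fix x b assume x: "x \<in> G"
  obtain V h where V: "open V" "x \<in> V" "psh_wrt sc V h" "\<forall>y\<in>V. f y = h y"
    using loc[OF x(1)] by blast
  note h = V(3)[unfolded psh_wrt_iff_viscosity_subharmonic[OF V(1)]]
  show "f x < \<infinity>" using h V(2,4) by auto
  show "viscosity_subharmonic_at (\<lambda>\<tau>. f (x + sc \<tau> b)) 0"
  proof (rule viscosity_subharmonic_at_touching)
    show "viscosity_subharmonic_at (\<lambda>\<tau>. h (x + sc \<tau> b)) 0" using h V(2) by blast
    show "h (x + sc 0 b) = f (x + sc 0 b)" using V(2,4) by (simp add: sc_zero)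
    have "\<forall>\<^sub>F y in nhds x. h y \<le> f y"
      using eventually_nhds_in_open[OF V(1,2)] by eventually_elim (use V(4) in simp)
    then show "\<forall>\<^sub>F \<tau> in nhds 0. h (x + sc \<tau> b) \<le> f (x + sc \<tau> b)"
      by (rule eventually_slice)
  qed
qed

lemma psh_wrt_subset: "psh_wrt sc G f \<Longrightarrow> H \<subseteq> G \<Longrightarrow> psh_wrt sc H f"
  unfolding psh_wrt_def using usc_on_subset by blast

lemma psh_wrt_max:
  assumes f: "psh_wrt sc G f" and g: "psh_wrt sc G g"
  shows "psh_wrt sc G (\<lambda>x. max (f x) (g x))"
  unfolding psh_wrt_def
proof (intro conjI allI impI)
  show "usc_on G (\<lambda>x. max (f x) (g x))"
    by (intro usc_on_max psh_wrt_imp_usc_on assms)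
  show "\<forall>x\<in>G. max (f x) (g x) < \<infinity>"
    using psh_wrt_less_top[OF f] psh_wrt_less_top[OF g] by (simp add: max_def)
  fix a b assume ab: "\<forall>\<tau>\<in>cball 0 1. a + sc \<tau> b \<in> G"
  have "f a \<le> circle_mean (\<lambda>\<theta>. f (a + sc (cis \<theta>) b))" "g a \<le> circle_mean (\<lambda>\<theta>. g (a + sc (cis \<theta>) b))"
    using ab by (auto intro!: psh_wrt_sub_mean_value[OF f] psh_wrt_sub_mean_value[OF g])
  moreover have "circle_mean (\<lambda>\<theta>. f (a + sc (cis \<theta>) b)) \<le> circle_mean (\<lambda>\<theta>. max (f (a + sc (cis \<theta>) b)) (g (a + sc (cis \<theta>) b)))"
    "circle_mean (\<lambda>\<theta>. g (a + sc (cis \<theta>) b)) \<le> circle_mean (\<lambda>\<theta>. max (f (a + sc (cis \<theta>) b)) (g (a + sc (cis \<theta>) b)))"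
    by (auto intro!: circle_mean_mono)
  ultimately show "max (f a) (g a) \<le> circle_mean (\<lambda>\<theta>. max (f (a + sc (cis \<theta>) b)) (g (a + sc (cis \<theta>) b)))"
    unfolding max.bounded_iff by (meson order_trans)
qed

lemma psh_wrt_add_const:
  assumes "open G" "psh_wrt sc G f"
  shows "psh_wrt sc G (\<lambda>x. f x + ereal c)"
  unfolding psh_wrt_iff_viscosity_subharmonic[OF \<open>open G\<close>]
proof (intro conjI ballI allI)
  note f = assms(2)[unfolded psh_wrt_iff_viscosity_subharmonic[OF \<open>open G\<close>]]
  show "usc_on G (\<lambda>x. f x + ereal c)"
    using f by (intro usc_on_add_continuous) auto
  show "f x + ereal c < \<infinity>" if "x \<in> G" for x using f that by (simp add: less_top[symmetric])
  fix x b assume "x \<in> G"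
  then have "viscosity_subharmonic_at (\<lambda>\<tau>. f (x + sc \<tau> b)) 0" using f by blast
  from viscosity_subharmonic_at_add_harmonic[OF this, of "\<lambda>_. of_real c" 1]
  show "viscosity_subharmonic_at (\<lambda>\<tau>. f (x + sc \<tau> b) + ereal c) 0" by simp
qed

lemma psh_wrt_translate:
  assumes "psh_wrt sc G f"
  shows "psh_wrt sc ((\<lambda>x. x + h) -` G) (\<lambda>x. f (x + h))"
  unfolding psh_wrt_def
proof (intro conjI allI impI)
  show "usc_on ((\<lambda>x. x + h) -` G) (\<lambda>x. f (x + h))"
    by (intro usc_on_continuous_compose[OF psh_wrt_imp_usc_on[OF assms]] continuous_intros) auto
  show "\<forall>x\<in>(\<lambda>x. x + h) -` G. f (x + h) < \<infinity>" using psh_wrt_less_top[OF assms] by simp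
  fix a b assume "\<forall>\<tau>\<in>cball 0 1. a + sc \<tau> b \<in> (\<lambda>x. x + h) -` G"
  then have "\<forall>\<tau>\<in>cball 0 1. (a + h) + sc \<tau> b \<in> G" by (simp add: add.assoc add.commute[of h])
  then have "f (a + h) \<le> circle_mean (\<lambda>\<theta>. f ((a + h) + sc (cis \<theta>) b))"
    by (intro psh_wrt_sub_mean_value[OF assms]) blast
  then show "f (a + h) \<le> circle_mean (\<lambda>\<theta>. f (a + sc (cis \<theta>) b + h))" by (simp add: add.assoc add.commute[of h])
qed

lemma psh_wrt_add_continuous:
  assumes f: "psh_wrt sc G (\<lambda>x. ereal (f x))" "continuous_on G f"
    and g: "psh_wrt sc G (\<lambda>x. ereal (g x))" "continuous_on G g"
  shows "psh_wrt sc G (\<lambda>x. ereal (f x + g x))"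
  unfolding psh_wrt_def
proof (intro conjI allI impI)
  show "usc_on G (\<lambda>x. ereal (f x + g x))"
    by (intro usc_on_continuous continuous_intros assms)
  show "\<forall>x\<in>G. ereal (f x + g x) < \<infinity>" by simp
  fix a b assume ab: "\<forall>\<tau>\<in>cball 0 1. a + sc \<tau> b \<in> G"
  have cont: "continuous_on {0..2*pi} (\<lambda>\<theta>. h (a + sc (cis \<theta>) b))" if "continuous_on G h" for h :: "'a \<Rightarrow> real"
  proof (rule continuous_on_compose2[OF that])
    show "continuous_on {0..2*pi} (\<lambda>\<theta>. a + sc (cis \<theta>) b)"
      by (rule continuous_on_compose2[OF continuous_on_slice[of UNIV]]) (auto intro!: continuous_intros)
  qed (use ab in auto)
  have "ereal (f a) \<le> ereal (integral {0..2*pi} (\<lambda>\<theta>. f (a + sc (cis \<theta>) b)) / (2 * pi))"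
    unfolding circle_mean_real[OF cont[OF f(2)], symmetric] using ab by (intro psh_wrt_sub_mean_value[OF f(1)]) blast
  moreover have "ereal (g a) \<le> ereal (integral {0..2*pi} (\<lambda>\<theta>. g (a + sc (cis \<theta>) b)) / (2 * pi))"
    unfolding circle_mean_real[OF cont[OF g(2)], symmetric] using ab by (intro psh_wrt_sub_mean_value[OF g(1)]) blast
  moreover have "integral {0..2*pi} (\<lambda>\<theta>. f (a + sc (cis \<theta>) b) + g (a + sc (cis \<theta>) b))
      = integral {0..2*pi} (\<lambda>\<theta>. f (a + sc (cis \<theta>) b)) + integral {0..2*pi} (\<lambda>\<theta>. g (a + sc (cis \<theta>) b))"
    by (intro integral_add integrable_continuous_real cont f g)
  ultimately show "ereal (f a + g a) \<le> circle_mean (\<lambda>\<theta>. ereal (f (a + sc (cis \<theta>) b) + g (a + sc (cis \<theta>) b)))"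
    unfolding circle_mean_real[OF continuous_on_add[OF cont[OF f(2)] cont[OF g(2)]]]
    by (simp add: add_divide_distrib)
qed

end

interpretation vec_prod: complex_scaling "\<lambda>c (z, \<zeta>). (c *s z, c * \<zeta>)"
proof
  fix \<sigma> \<tau> :: complex and b :: "(complex ^ 'n) \<times> complex"
  show "(case b of (z, \<zeta>) \<Rightarrow> ((\<sigma> + \<tau>) *s z, (\<sigma> + \<tau>) * \<zeta>)) =
        (case b of (z, \<zeta>) \<Rightarrow> (\<sigma> *s z, \<sigma> * \<zeta>)) + (case b of (z, \<zeta>) \<Rightarrow> (\<tau> *s z, \<tau> * \<zeta>))"
    by (cases b) (simp add: vec_eq_iff distrib_right)
  show "(case (case b of (z, \<zeta>) \<Rightarrow> (\<tau> *s z, \<tau> * \<zeta>)) of (z, \<zeta>) \<Rightarrow> (\<sigma> *s z, \<sigma> * \<zeta>)) =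
        (case b of (z, \<zeta>) \<Rightarrow> ((\<sigma> * \<tau>) *s z, \<sigma> * \<tau> * \<zeta>))"
    by (cases b) (simp add: vec_eq_iff)
  have "continuous_on UNIV (\<lambda>\<tau>. (\<tau> *s fst b, \<tau> * snd b))"
    unfolding vector_scalar_mult_def by (intro continuous_intros)
  then show "continuous_on UNIV (\<lambda>\<tau>. case b of (z, \<zeta>) \<Rightarrow> (\<tau> *s z, \<tau> * \<zeta>))"
    by (simp add: case_prod_beta)
qed

section \<open>Competitors of the envelope\<close>

text \<open>
  As a function of \<open>ln |\<zeta>|\<close> in place of \<open>t\<close>, this is the harmonic function on the annulus with
  boundary values \<open>u0 z\<close> and \<open>u1 z\<close>.
\<close>

definition chord :: "('a \<Rightarrow> real) \<Rightarrow> ('a \<Rightarrow> real) \<Rightarrow> real \<Rightarrow> 'a \<Rightarrow> real" where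
  "chord u0 u1 t z = (1 - t) * u0 z + t * u1 z"

lemma annulus_eq: "annulus = ball 0 (exp 1) - cball 0 1"
proof (rule set_eqI)
  fix \<zeta> :: complex
  show "\<zeta> \<in> annulus \<longleftrightarrow> \<zeta> \<in> ball 0 (exp 1) - cball 0 1"
    using exp_less_cancel_iff[of "ln (norm \<zeta>)" 1]
    by (cases "\<zeta> = 0") (auto simp: annulus_def)
qed

lemma open_annulus: "open annulus"
  unfolding annulus_eq by (intro open_Diff open_ball closed_cball)

lemma annulus_bdry_eq: "annulus_bdry s = sphere 0 (exp s)"
proof -
  have "ln (norm \<zeta>) = s \<longleftrightarrow> norm \<zeta> = exp s" if "\<zeta> \<noteq> 0" for \<zeta> :: complex
    using that by (metis exp_ln ln_exp zero_less_norm_iff)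
  then show ?thesis unfolding annulus_bdry_def by (auto simp: exp_not_eq_zero)
qed

lemma annulusD: "\<zeta> \<in> annulus \<Longrightarrow> \<zeta> \<noteq> 0" "\<zeta> \<in> annulus \<Longrightarrow> 0 < ln (norm \<zeta>)" "\<zeta> \<in> annulus \<Longrightarrow> ln (norm \<zeta>) < 1"
  by (auto simp: annulus_def)

text \<open>
  On the disc about \<open>a\<close> of radius \<open>norm a\<close>, the quotient \<open>\<zeta> / a\<close> has positive real part, so a branch of the
  logarithm is available.
\<close>

lemma harmonic_ln_norm:
  fixes a :: complex
  assumes "a \<noteq> 0"
  obtains Q where "Q holomorphic_on ball a (norm a)"
    "\<And>\<zeta>. \<zeta> \<in> ball a (norm a) \<Longrightarrow> ln (norm \<zeta>) = Re (Q \<zeta>)"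
proof
  define Q where "Q \<zeta> = Ln (\<zeta> / a) + of_real (ln (norm a))" for \<zeta>
  have pos: "Re (\<zeta> / a) > 0" if "\<zeta> \<in> ball a (norm a)" for \<zeta>
  proof -
    have "norm (1 - \<zeta> / a) = norm (a - \<zeta>) / norm a"
      using \<open>a \<noteq> 0\<close> by (simp add: diff_divide_distrib norm_divide[symmetric])
    also have "\<dots> < 1" using that \<open>a \<noteq> 0\<close> by (simp add: dist_norm)
    finally have "\<bar>Re (1 - \<zeta> / a)\<bar> < 1" using abs_Re_le_cmod le_less_trans by blast
    then show ?thesis by simp
  qed
  show "Q holomorphic_on ball a (norm a)"
    unfolding Q_def using pos \<open>a \<noteq> 0\<close> by (intro holomorphic_intros) (force simp: complex_nonpos_Reals_iff)+
  fix \<zeta> assume \<zeta>: "\<zeta> \<in> ball a (norm a)"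
  then have "\<zeta> / a \<noteq> 0" using pos[OF \<zeta>] by auto
  then show "ln (norm \<zeta>) = Re (Q \<zeta>)"
    unfolding Q_def using \<open>a \<noteq> 0\<close> by (simp add: norm_divide ln_div)
qed

text \<open>
  The maximum principle on the slice \<open>{z} \<times> annulus\<close>. To have an upper semicontinuous function on a
  compact set, \<open>v\<close> is extended to the two boundary circles by the values of the chord; the limits
  superior in the definition of the class are exactly what makes this extension upper semicontinuous.
\<close>

lemma envelope_class_le_chord:
  fixes v :: "(complex ^ 'n) \<times> complex \<Rightarrow> ereal"
  assumes "open \<Omega>" and v: "v \<in> envelope_class \<Omega> u0 u1" and z: "z \<in> \<Omega>" and \<zeta>: "\<zeta> \<in> annulus"
  shows "v (z, \<zeta>) \<le> ereal (chord u0 u1 (ln (norm \<zeta>)) z)"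
proof -
  define h where "h \<zeta> = chord u0 u1 (ln (norm \<zeta>)) z" for \<zeta> :: complex
  define K where "K = cball 0 (exp 1) - ball (0::complex) 1"
  define g where "g \<zeta> = (if \<zeta> \<in> annulus then v (z, \<zeta>) else ereal (h \<zeta>))" for \<zeta>
  have opG: "open (\<Omega> \<times> annulus)" using \<open>open \<Omega>\<close> open_annulus by (rule open_Times)
  have psh: "psh_prod_on (\<Omega> \<times> annulus) v" using v unfolding envelope_class_def by simp
  note psh' = psh[unfolded vec_prod.psh_wrt_iff_viscosity_subharmonic[OF opG]]
  have K_eq: "K = annulus \<union> annulus_bdry 0 \<union> annulus_bdry 1"
    unfolding K_def annulus_eq annulus_bdry_eq using one_le_exp_iff[of 1] by auto
  have h_cont: "continuous_on K h"
    unfolding h_def chord_def K_def by (intro continuous_intros) (auto simp: not_less)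
  have bd: "\<forall>\<^sub>F \<zeta> in at a within annulus. v (z, \<zeta>) < c" if a: "a \<in> annulus_bdry 0 \<union> annulus_bdry 1" and c: "ereal (h a) < c" for a c
  proof -
    obtain j where j: "a \<in> annulus_bdry j" "j = 0 \<or> j = 1"
      using a by blast
    then have "h a = (if j = 0 then u0 z else u1 z)"
      by (auto simp: annulus_bdry_def h_def chord_def)
    then have "Limsup (SUP a\<in>annulus_bdry j. at a within annulus) (\<lambda>\<zeta>. v (z, \<zeta>)) \<le> ereal (h a)"
      using v z j(2) unfolding envelope_class_def by auto
    then have "Limsup (SUP a\<in>annulus_bdry j. at a within annulus) (\<lambda>\<zeta>. v (z, \<zeta>)) < c"
      using c by (rule le_less_trans)
    then have "\<forall>\<^sub>F \<zeta> in (SUP a\<in>annulus_bdry j. at a within annulus). v (z, \<zeta>) < c"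
      by (intro Limsup_lessD)
    then show ?thesis
      using j(1) unfolding eventually_Sup by simp
  qed
  have "g \<zeta> \<le> ereal (h \<zeta>)"
  proof (rule viscosity_maximum_principle[where K = K and U = annulus])
    show "compact K" unfolding K_def by (intro compact_diff) auto
    show "continuous_on K h" by (rule h_cont)
    show "\<zeta> \<in> K" using \<zeta> K_eq by simp
    show "g a \<le> ereal (h a)" if "a \<in> K - annulus" for a using that by (simp add: g_def)
    show "usc_on K g"
      unfolding usc_on_iff_eventually
    proof (intro ballI allI impI)
      fix a c assume a: "a \<in> K" "g a < c"
      have ann: "\<forall>\<^sub>F \<zeta> in at a within annulus. v (z, \<zeta>) < c"
      proof (cases "a \<in> annulus")
        case True
        have "usc_on annulus (\<lambda>\<zeta>. v (z, \<zeta>))"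
          using z by (intro usc_on_continuous_compose[OF vec_prod.psh_wrt_imp_usc_on[OF psh]] continuous_intros) auto
        then show ?thesis using a(2) True unfolding g_def usc_on_iff_eventually by auto
      next
        case False
        then show ?thesis using a bd[of a c] by (auto simp: g_def K_eq)
      qed
      show "\<forall>\<^sub>F \<zeta> in at a within K. g \<zeta> < c"
      proof (cases "a \<in> annulus")
        case True
        have "\<forall>\<^sub>F \<zeta> in at a. v (z, \<zeta>) < c"
          using ann unfolding at_within_open[OF True open_annulus] .
        moreover have "\<forall>\<^sub>F \<zeta> in at a. \<zeta> \<in> annulus"
          using open_annulus True by (rule eventually_at_in_open')
        ultimately have "\<forall>\<^sub>F \<zeta> in at a. g \<zeta> < c"
          by eventually_elim (simp add: g_def)
        then show ?thesis using filter_leD[OF at_le[OF subset_UNIV]] by blast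
      next
        case False
        then have "ereal (h a) < c" using a(2) by (simp add: g_def)
        moreover have "((\<lambda>\<zeta>. ereal (h \<zeta>)) \<longlongrightarrow> ereal (h a)) (at a within K)"
          using h_cont a(1) by (intro tendsto_ereal) (simp add: continuous_on_def)
        ultimately have "\<forall>\<^sub>F \<zeta> in at a within K. ereal (h \<zeta>) < c"
          using order_tendstoD(2) by blast
        moreover have "\<forall>\<^sub>F \<zeta> in at a within K. \<zeta> \<in> annulus \<longrightarrow> v (z, \<zeta>) < c"
          using ann unfolding eventually_at_filter by eventually_elim simp
        ultimately show ?thesis
          by eventually_elim (simp add: g_def)
      qed
    qed
  next
    fix a assume a: "a \<in> annulus"
    have "v (z, a) < \<infinity>" using psh' z a by blast
    then show "g a < \<infinity>" using a by (simp add: g_def)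
    have "viscosity_subharmonic_at (\<lambda>\<tau>. v ((z, a) + (case (0, 1) of (z, \<zeta>) \<Rightarrow> (\<tau> *s z, \<tau> * \<zeta>)))) 0"
      using psh' z a by blast
    then have "viscosity_subharmonic_at (\<lambda>\<tau>. v (z, a + \<tau>)) 0" by simp
    then have "viscosity_subharmonic_at (\<lambda>\<zeta>. v (z, \<zeta>)) a"
      by (rule viscosity_subharmonic_at_shift)
    then show "viscosity_subharmonic_at g a"
    proof (rule viscosity_subharmonic_at_touching)
      show "v (z, a) = g a" using a by (simp add: g_def)
      show "\<forall>\<^sub>F \<tau> in nhds a. v (z, \<tau>) \<le> g \<tau>"
        using eventually_nhds_in_open[OF open_annulus a] by eventually_elim (simp add: g_def)
    qed
    obtain Q where Q: "Q holomorphic_on ball a (norm a)" "\<And>\<zeta>. \<zeta> \<in> ball a (norm a) \<Longrightarrow> ln (norm \<zeta>) = Re (Q \<zeta>)"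
      using harmonic_ln_norm[OF annulusD(1)[OF a]] by blast
    obtain s where s: "s > 0" "ball a s \<subseteq> annulus"
      using open_annulus a open_contains_ball by blast
    define r where "r = min s (norm a)"
    have r: "r > 0" "ball a r \<subseteq> ball a (norm a)" "ball a r \<subseteq> K"
      using s annulusD(1)[OF a] unfolding r_def K_eq by auto
    have "(\<lambda>\<zeta>. of_real (u0 z) + of_real (u1 z - u0 z) * Q \<zeta>) holomorphic_on ball a r"
      using holomorphic_on_subset[OF Q(1) r(2)] by (intro holomorphic_intros)
    moreover have "h \<tau> = Re (of_real (u0 z) + of_real (u1 z - u0 z) * Q \<tau>)" if "\<tau> \<in> ball a r" for \<tau>
    proof -
      have "ln (norm \<tau>) = Re (Q \<tau>)" using Q(2) r(2) that by blast
      then show ?thesis unfolding h_def chord_def by (simp add: algebra_simps)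
    qed
    ultimately show "\<exists>r>0. \<exists>Q. Q holomorphic_on ball a r \<and> ball a r \<subseteq> K \<and> (\<forall>\<tau>\<in>ball a r. h \<tau> = Re (Q \<tau>))"
      using r(1,3) by blast
  qed
  then show ?thesis using \<zeta> by (simp add: g_def h_def)
qed

text \<open>
  Together with the previous lemma: the competitors are precisely the plurisubharmonic functions
  below the chord.
\<close>

lemma envelope_classI:
  fixes v :: "(complex ^ 'n) \<times> complex \<Rightarrow> ereal"
  assumes psh: "psh_prod_on (\<Omega> \<times> annulus) v"
    and le: "\<And>z \<zeta>. z \<in> \<Omega> \<Longrightarrow> \<zeta> \<in> annulus \<Longrightarrow> v (z, \<zeta>) \<le> ereal (chord u0 u1 (ln (norm \<zeta>)) z)"
  shows "v \<in> envelope_class \<Omega> u0 u1"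
proof -
  have "Limsup (SUP a\<in>annulus_bdry s. at a within annulus) (\<lambda>\<zeta>. v (z, \<zeta>)) \<le> ereal (chord u0 u1 s z)"
    if z: "z \<in> \<Omega>" for s z
    unfolding Limsup_le_iff
  proof (intro allI impI)
    fix c assume c: "ereal (chord u0 u1 s z) < c"
    have "\<forall>\<^sub>F \<zeta> in at a within annulus. v (z, \<zeta>) < c" if a: "a \<in> annulus_bdry s" for a
    proof -
      have a: "a \<noteq> 0" "ln (norm a) = s" using a unfolding annulus_bdry_def by auto
      then have "((\<lambda>\<zeta>. ereal (chord u0 u1 (ln (norm \<zeta>)) z)) \<longlongrightarrow> ereal (chord u0 u1 s z)) (at a within annulus)"
        unfolding chord_def by (auto intro!: tendsto_eq_intros)
      then have "\<forall>\<^sub>F \<zeta> in at a within annulus. ereal (chord u0 u1 (ln (norm \<zeta>)) z) < c"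
        using c order_tendstoD(2) by blast
      moreover have "\<forall>\<^sub>F \<zeta> in at a within annulus. \<zeta> \<in> annulus"
        by (simp add: eventually_at_filter)
      ultimately show ?thesis
        by eventually_elim (use le[OF z] le_less_trans in blast)
    qed
    then show "\<forall>\<^sub>F \<zeta> in (SUP a\<in>annulus_bdry s. at a within annulus). v (z, \<zeta>) < c"
      unfolding eventually_Sup by simp
  qed
  from this[of _ 0] this[of _ 1] psh show ?thesis
    unfolding envelope_class_def by (simp add: chord_def)
qed

section \<open>From a barrier to a modulus of continuity\<close>

lemma chord_diff_le:
  assumes "\<bar>u0 z - u0 w\<bar> \<le> d" "\<bar>u1 z - u1 w\<bar> \<le> d" "0 \<le> t" "t \<le> 1"
  shows "\<bar>chord u0 u1 t z - chord u0 u1 t w\<bar> \<le> d"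
proof -
  have eq: "chord u0 u1 t z - chord u0 u1 t w = (1 - t) * (u0 z - u0 w) + t * (u1 z - u1 w)"
    by (simp add: chord_def algebra_simps)
  have "\<bar>(1 - t) * (u0 z - u0 w) + t * (u1 z - u1 w)\<bar> \<le> (1 - t) * \<bar>u0 z - u0 w\<bar> + t * \<bar>u1 z - u1 w\<bar>"
    using assms abs_triangle_ineq[of "(1 - t) * (u0 z - u0 w)" "t * (u1 z - u1 w)"] by (simp add: abs_mult)
  also have "\<dots> \<le> (1 - t) * d + t * d"
    using assms by (intro add_mono mult_left_mono) auto
  finally show ?thesis unfolding eq by (simp add: algebra_simps)
qed

text \<open>
  The competitors are unconstrained on \<open>frontier \<Omega> \<times> annulus\<close>. The function \<open>b\<close> is a competitor which
  forces the envelope up to the chord there, at the Hoelder rate \<open>\<beta>\<close>.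
\<close>

locale geodesic_barrier =
  fixes \<Omega> :: "(complex ^ 'n) set" and u0 u1 :: "complex ^ 'n \<Rightarrow> real"
    and b :: "(complex ^ 'n) \<times> complex \<Rightarrow> real" and \<beta> K C :: real
  assumes open_\<Omega>: "open \<Omega>" and \<beta>_pos: "0 < \<beta>"
    and u0_holder: "\<And>z w. z \<in> closure \<Omega> \<Longrightarrow> w \<in> closure \<Omega> \<Longrightarrow> \<bar>u0 z - u0 w\<bar> \<le> K * dist z w powr \<beta>"
    and u1_holder: "\<And>z w. z \<in> closure \<Omega> \<Longrightarrow> w \<in> closure \<Omega> \<Longrightarrow> \<bar>u1 z - u1 w\<bar> \<le> K * dist z w powr \<beta>"
    and psh_b: "psh_prod_on (\<Omega> \<times> annulus) (\<lambda>p. ereal (b p))"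
    and continuous_b: "continuous_on (\<Omega> \<times> annulus) b"
    and b_le_chord: "\<And>z \<zeta>. z \<in> \<Omega> \<Longrightarrow> \<zeta> \<in> annulus \<Longrightarrow> b (z, \<zeta>) \<le> chord u0 u1 (ln (norm \<zeta>)) z"
    and b_ge: "\<And>z w \<zeta>. z \<in> \<Omega> \<Longrightarrow> w \<in> frontier \<Omega> \<Longrightarrow> \<zeta> \<in> annulus \<Longrightarrow>
      chord u0 u1 (ln (norm \<zeta>)) w - C * dist z w powr \<beta> \<le> b (z, \<zeta>)"
begin

text \<open>
  The Hoelder constant of the geodesic. It is strictly larger than \<open>C\<close>, so that the barrier is strictly
  above the translated competitor at the places where the two are glued.
\<close>

definition "M = max (C + 1) K"

lemma M: "C < M" "C \<le> M" "K \<le> M" by (auto simp: M_def)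

lemma open_prod: "open (\<Omega> \<times> annulus)"
  using open_\<Omega> open_annulus by (rule open_Times)

lemma chord_holder:
  assumes "z \<in> closure \<Omega>" "w \<in> closure \<Omega>" "0 \<le> t" "t \<le> 1"
  shows "\<bar>chord u0 u1 t z - chord u0 u1 t w\<bar> \<le> K * dist z w powr \<beta>"
  using assms by (intro chord_diff_le u0_holder u1_holder)

text \<open>
  The lowered translate of a competitor; the barrier takes over where \<open>z + h\<close> leaves \<open>\<Omega>\<close>.
\<close>

definition glued :: "((complex ^ 'n) \<times> complex \<Rightarrow> ereal) \<Rightarrow> complex ^ 'n \<Rightarrow> (complex ^ 'n) \<times> complex \<Rightarrow> ereal" where
  "glued v h p = (if fst p + h \<in> \<Omega>
     then max (ereal (b p)) (v (p + (h, 0)) + ereal (- (M * norm h powr \<beta>))) else ereal (b p))"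

text \<open>
  Only the points \<open>z0\<close> with \<open>z0 + h\<close> on the frontier need care. There the lowered translate is at most the
  chord at \<open>z0 + h\<close> minus \<open>M |h|\<^sup>\<beta>\<close>, which is less than the barrier at \<open>z0\<close>. By continuity
  the maximum equals the barrier in a whole neighbourhood.
\<close>

lemma psh_glued:
  assumes v: "v \<in> envelope_class \<Omega> u0 u1" and "h \<noteq> 0"
  shows "psh_prod_on (\<Omega> \<times> annulus) (glued v h)"
proof (rule vec_prod.psh_wrt_local[OF open_prod])
  fix p assume "p \<in> \<Omega> \<times> annulus"
  then obtain z0 \<zeta>0 where p: "p = (z0, \<zeta>0)" "z0 \<in> \<Omega>" "\<zeta>0 \<in> annulus" by auto
  have psh_v: "psh_prod_on (\<Omega> \<times> annulus) v" using v by (simp add: envelope_class_def)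
  have cont_shift: "continuous_on UNIV (\<lambda>z. z + h)" by (intro continuous_intros)
  consider "z0 + h \<in> \<Omega>" | "z0 + h \<in> frontier \<Omega>" | "z0 + h \<in> - closure \<Omega>"
    using open_\<Omega> by (auto simp: frontier_def interior_open)
  then show "\<exists>V f. open V \<and> p \<in> V \<and> psh_prod_on V f \<and> (\<forall>y\<in>V. glued v h y = f y)"
  proof cases
    case 1
    define V where "V = (\<Omega> \<inter> (\<lambda>z. z + h) -` \<Omega>) \<times> annulus"
    have "open V"
      unfolding V_def
      by (intro open_Times open_Int open_\<Omega> open_annulus open_vimage cont_shift)
    have "psh_prod_on ((\<lambda>x. x + (h, 0)) -` (\<Omega> \<times> annulus)) (\<lambda>x. v (x + (h, 0)))"
      by (rule vec_prod.psh_wrt_translate[OF psh_v])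
    then have "psh_prod_on V (\<lambda>x. v (x + (h, 0)))"
      by (rule vec_prod.psh_wrt_subset) (auto simp: V_def)
    then have "psh_prod_on V (\<lambda>x. v (x + (h, 0)) + ereal (- (M * norm h powr \<beta>)))"
      by (rule vec_prod.psh_wrt_add_const[OF \<open>open V\<close>])
    moreover have "psh_prod_on V (\<lambda>p. ereal (b p))"
      using psh_b by (rule vec_prod.psh_wrt_subset) (auto simp: V_def)
    ultimately have "psh_prod_on V (\<lambda>x. max (ereal (b x)) (v (x + (h, 0)) + ereal (- (M * norm h powr \<beta>))))"
      by (intro vec_prod.psh_wrt_max)
    moreover have "p \<in> V" using 1 p by (simp add: V_def)
    moreover have "\<forall>y\<in>V. glued v h y = max (ereal (b y)) (v (y + (h, 0)) + ereal (- (M * norm h powr \<beta>)))"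
      by (auto simp: V_def glued_def)
    ultimately show ?thesis using \<open>open V\<close> by blast
  next
    case 2
    \<comment> \<open>The data are continuous on \<open>closure \<Omega>\<close> only, so the chord at \<open>z + h\<close> is replaced by its Hoelder bound around \<open>z0 + h\<close>, which is continuous in \<open>z\<close>.\<close>
    define \<Phi> where "\<Phi> q = b q - chord u0 u1 (ln (norm (snd q))) (z0 + h)
       - K * dist (fst q) z0 powr \<beta> + M * norm h powr \<beta>" for q
    have cont\<Phi>: "continuous_on (\<Omega> \<times> annulus) \<Phi>"
      unfolding \<Phi>_def chord_def
      by (intro continuous_intros continuous_b continuous_on_powr') (use \<beta>_pos annulusD(1) in auto)
    define V where "V = (\<Omega> \<times> annulus) \<inter> \<Phi> -` {0<..}"
    have "open V"
      unfolding V_def by (rule continuous_open_preimage[OF cont\<Phi> open_prod]) simp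
    moreover have "p \<in> V"
    proof -
      have "chord u0 u1 (ln (norm \<zeta>0)) (z0 + h) - C * norm h powr \<beta> \<le> b p"
        using b_ge[OF p(2) 2 p(3)] p(1) by (simp add: dist_norm)
      moreover have "C * norm h powr \<beta> < M * norm h powr \<beta>"
        using M(1) \<open>h \<noteq> 0\<close> by (intro mult_strict_right_mono) auto
      ultimately show ?thesis using p by (simp add: V_def \<Phi>_def)
    qed
    moreover have "psh_prod_on V (\<lambda>p. ereal (b p))"
      using psh_b by (rule vec_prod.psh_wrt_subset) (auto simp: V_def)
    moreover have "glued v h q = ereal (b q)" if "q \<in> V" for q
    proof (cases "fst q + h \<in> \<Omega>")
      case True
      obtain z \<zeta> where q: "q = (z, \<zeta>)" by (cases q)
      have z: "z \<in> \<Omega>" "\<zeta> \<in> annulus" "\<Phi> (z, \<zeta>) > 0" using that unfolding q V_def by auto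
      note t = annulusD(2,3)[OF z(2)]
      have "v (z + h, \<zeta>) \<le> ereal (chord u0 u1 (ln (norm \<zeta>)) (z + h))"
        using envelope_class_le_chord[OF open_\<Omega> v _ z(2)] True q by simp
      moreover have "chord u0 u1 (ln (norm \<zeta>)) (z + h) - M * norm h powr \<beta> \<le> b (z, \<zeta>)"
      proof -
        have "z + h \<in> closure \<Omega>" "z0 + h \<in> closure \<Omega>"
          using True q 2 closure_subset[of \<Omega>] by (auto simp: frontier_def)
        from chord_holder[OF this, of "ln (norm \<zeta>)"] t
        have "\<bar>chord u0 u1 (ln (norm \<zeta>)) (z + h) - chord u0 u1 (ln (norm \<zeta>)) (z0 + h)\<bar> \<le> K * dist z z0 powr \<beta>"
          by (simp add: dist_norm)
        then show ?thesis using z(3) unfolding \<Phi>_def by simp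
      qed
      ultimately have "v (z + h, \<zeta>) + ereal (- (M * norm h powr \<beta>)) \<le> ereal (b (z, \<zeta>))"
        by (cases "v (z + h, \<zeta>)") auto
      then show ?thesis unfolding glued_def q by (simp add: max_absorb1)
    qed (simp add: glued_def)
    ultimately show ?thesis by blast
  next
    case 3
    define V where "V = (\<Omega> \<inter> (\<lambda>z. z + h) -` (- closure \<Omega>)) \<times> annulus"
    have "open V"
      unfolding V_def
      by (intro open_Times open_Int open_\<Omega> open_annulus open_vimage cont_shift open_Compl closed_closure)
    moreover have "psh_prod_on V (\<lambda>p. ereal (b p))"
      using psh_b by (rule vec_prod.psh_wrt_subset) (auto simp: V_def)
    moreover have "p \<in> V" using 3 p by (simp add: V_def)
    moreover have "\<forall>y\<in>V. glued v h y = ereal (b y)"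
      using closure_subset[of \<Omega>] by (auto simp: V_def glued_def)
    ultimately show ?thesis by blast
  qed
qed

text \<open>
  Subtracting at least \<open>K |h|\<^sup>\<beta>\<close> compensates the change of the data under translation.
\<close>

lemma glued_in_envelope_class:
  assumes v: "v \<in> envelope_class \<Omega> u0 u1" and "h \<noteq> 0"
  shows "glued v h \<in> envelope_class \<Omega> u0 u1"
proof (rule envelope_classI[OF psh_glued[OF assms]])
  fix z \<zeta> assume z: "z \<in> \<Omega>" "\<zeta> \<in> annulus"
  note t = annulusD(2,3)[OF z(2)]
  show "glued v h (z, \<zeta>) \<le> ereal (chord u0 u1 (ln (norm \<zeta>)) z)"
  proof (cases "z + h \<in> \<Omega>")
    case True
    have "v (z + h, \<zeta>) \<le> ereal (chord u0 u1 (ln (norm \<zeta>)) (z + h))"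
      by (rule envelope_class_le_chord[OF open_\<Omega> v True z(2)])
    moreover have "chord u0 u1 (ln (norm \<zeta>)) (z + h) - M * norm h powr \<beta> \<le> chord u0 u1 (ln (norm \<zeta>)) z"
    proof -
      have "z + h \<in> closure \<Omega>" "z \<in> closure \<Omega>"
        using True z closure_subset[of \<Omega>] by auto
      from chord_holder[OF this, of "ln (norm \<zeta>)"] t
      have "\<bar>chord u0 u1 (ln (norm \<zeta>)) (z + h) - chord u0 u1 (ln (norm \<zeta>)) z\<bar> \<le> K * norm h powr \<beta>"
        by (simp add: dist_norm)
      moreover have "K * norm h powr \<beta> \<le> M * norm h powr \<beta>"
        using M(3) by (intro mult_right_mono) auto
      ultimately show ?thesis by linarith
    qed
    ultimately have "v (z + h, \<zeta>) + ereal (- (M * norm h powr \<beta>)) \<le> ereal (chord u0 u1 (ln (norm \<zeta>)) z)"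
      by (cases "v (z + h, \<zeta>)") auto
    then show ?thesis using b_le_chord[OF z] True unfolding glued_def by simp
  qed (use b_le_chord[OF z] in \<open>simp add: glued_def\<close>)
qed

lemma envelope_bounds:
  assumes "z \<in> \<Omega>" "\<zeta> \<in> annulus"
  shows "ereal (b (z, \<zeta>)) \<le> envelope \<Omega> u0 u1 (z, \<zeta>)"
    and "envelope \<Omega> u0 u1 (z, \<zeta>) \<le> ereal (chord u0 u1 (ln (norm \<zeta>)) z)"
proof -
  have "(\<lambda>p. ereal (b p)) \<in> envelope_class \<Omega> u0 u1"
    using psh_b b_le_chord by (intro envelope_classI) auto
  then show "ereal (b (z, \<zeta>)) \<le> envelope \<Omega> u0 u1 (z, \<zeta>)"
    unfolding envelope_def by (rule SUP_upper)
  show "envelope \<Omega> u0 u1 (z, \<zeta>) \<le> ereal (chord u0 u1 (ln (norm \<zeta>)) z)"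
    unfolding envelope_def by (intro SUP_least envelope_class_le_chord[OF open_\<Omega> _ assms])
qed

text \<open>
  The envelope at \<open>z\<close> dominates the glued competitor, hence the lowered value of \<open>v\<close> at \<open>w = z + h\<close>.
\<close>

lemma envelope_holder:
  assumes z: "z \<in> \<Omega>" and w: "w \<in> \<Omega>" and \<zeta>: "\<zeta> \<in> annulus"
  shows "envelope \<Omega> u0 u1 (w, \<zeta>) \<le> envelope \<Omega> u0 u1 (z, \<zeta>) + ereal (M * dist z w powr \<beta>)"
proof (cases "z = w")
  case False
  define h where "h = w - z"
  have h: "h \<noteq> 0" "z + h = w" using False by (auto simp: h_def)
  show ?thesis
    unfolding envelope_def[of _ _ _ "(w, \<zeta>)"]
  proof (rule SUP_least)
    fix v assume "v \<in> envelope_class \<Omega> u0 u1"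
    then have "glued v h \<in> envelope_class \<Omega> u0 u1"
      using h(1) by (rule glued_in_envelope_class)
    then have "glued v h (z, \<zeta>) \<le> envelope \<Omega> u0 u1 (z, \<zeta>)"
      unfolding envelope_def by (rule SUP_upper)
    then have "v (w, \<zeta>) + ereal (- (M * norm h powr \<beta>)) \<le> envelope \<Omega> u0 u1 (z, \<zeta>)"
      using w unfolding glued_def by (simp add: h(2))
    moreover have "norm h = dist z w" by (simp add: h_def dist_norm norm_minus_commute)
    ultimately show "v (w, \<zeta>) \<le> envelope \<Omega> u0 u1 (z, \<zeta>) + ereal (M * dist z w powr \<beta>)"
      by (cases "v (w, \<zeta>)"; cases "envelope \<Omega> u0 u1 (z, \<zeta>)") auto
  qed
qed simp

text \<open>
  The barrier from below and the chord from above squeeze the envelope.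
\<close>

lemma envelope_tendsto_at_frontier:
  assumes z: "z \<in> frontier \<Omega>" and \<zeta>: "\<zeta> \<in> annulus"
  shows "(envelope \<Omega> u0 u1 \<longlongrightarrow> ereal (chord u0 u1 (ln (norm \<zeta>)) z)) (at (z, \<zeta>) within \<Omega> \<times> annulus)"
  (is "(_ \<longlongrightarrow> _) ?F")
proof (rule tendsto_sandwich)
  have inside: "\<forall>\<^sub>F p in ?F. p \<in> \<Omega> \<times> annulus"
    by (simp add: eventually_at_filter)
  show "\<forall>\<^sub>F p in ?F.
     ereal (chord u0 u1 (ln (norm (snd p))) z - C * dist (fst p) z powr \<beta>) \<le> envelope \<Omega> u0 u1 p"
    using inside
  proof eventually_elim
    case (elim p)
    then have p: "fst p \<in> \<Omega>" "snd p \<in> annulus" by auto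
    have "ereal (chord u0 u1 (ln (norm (snd p))) z - C * dist (fst p) z powr \<beta>) \<le> ereal (b (fst p, snd p))"
      using b_ge[OF p(1) z p(2)] by simp
    also have "\<dots> \<le> envelope \<Omega> u0 u1 (fst p, snd p)"
      by (rule envelope_bounds(1)[OF p])
    finally show ?case by simp
  qed
  show "\<forall>\<^sub>F p in ?F.
     envelope \<Omega> u0 u1 p \<le> ereal (chord u0 u1 (ln (norm (snd p))) z + K * dist (fst p) z powr \<beta>)"
    using inside
  proof eventually_elim
    case (elim p)
    then have p: "fst p \<in> \<Omega>" "snd p \<in> annulus" by auto
    have "envelope \<Omega> u0 u1 (fst p, snd p) \<le> ereal (chord u0 u1 (ln (norm (snd p))) (fst p))"
      by (rule envelope_bounds(2)[OF p])
    also have "\<dots> \<le> ereal (chord u0 u1 (ln (norm (snd p))) z + K * dist (fst p) z powr \<beta>)"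
      using chord_holder[of "fst p" z "ln (norm (snd p))"] annulusD(2,3)[OF p(2)] p(1) z closure_subset[of \<Omega>]
      by (auto simp: frontier_def)
    finally show ?case by simp
  qed
  have fs: "((\<lambda>p. fst p) \<longlongrightarrow> z) ?F"
    "((\<lambda>p. snd p) \<longlongrightarrow> \<zeta>) ?F"
    using tendsto_fst[OF tendsto_ident_at, of "(z, \<zeta>)" "\<Omega> \<times> annulus"]
      tendsto_snd[OF tendsto_ident_at, of "(z, \<zeta>)" "\<Omega> \<times> annulus"] by simp_all
  have c: "((\<lambda>p. chord u0 u1 (ln (norm (snd p))) z) \<longlongrightarrow> chord u0 u1 (ln (norm \<zeta>)) z) ?F"
    unfolding chord_def by (intro tendsto_intros fs) (use annulusD(1)[OF \<zeta>] in auto)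
  have "((\<lambda>p. dist (fst p) z) \<longlongrightarrow> 0) ?F"
    using tendsto_dist[OF fs(1) tendsto_const, of z] by simp
  then have d: "((\<lambda>p. dist (fst p) z powr \<beta>) \<longlongrightarrow> 0) ?F"
    using \<beta>_pos by (intro tendsto_zero_powrI[OF _ tendsto_const]) auto
  show "((\<lambda>p. ereal (chord u0 u1 (ln (norm (snd p))) z - C * dist (fst p) z powr \<beta>)) \<longlongrightarrow>
     ereal (chord u0 u1 (ln (norm \<zeta>)) z)) ?F"
    using tendsto_diff[OF c tendsto_mult[OF tendsto_const[of C] d]] by (intro tendsto_ereal) simp
  show "((\<lambda>p. ereal (chord u0 u1 (ln (norm (snd p))) z + K * dist (fst p) z powr \<beta>)) \<longlongrightarrow>
     ereal (chord u0 u1 (ln (norm \<zeta>)) z)) ?F"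
    using tendsto_add[OF c tendsto_mult[OF tendsto_const[of K] d]] by (intro tendsto_ereal) simp
qed

lemma exp_in_annulus:
  assumes "0 < t" "t < 1"
  shows "complex_of_real (exp t) \<in> annulus" "ln (norm (complex_of_real (exp t))) = t"
proof -
  show "ln (norm (complex_of_real (exp t))) = t" by (simp only: norm_of_real abs_exp_cancel ln_exp)
  then show "complex_of_real (exp t) \<in> annulus" using assms by (simp add: annulus_def)
qed

lemma geodesic_at_frontier:
  assumes z: "z \<in> frontier \<Omega>" and t: "0 < t" "t < 1"
  shows "geodesic \<Omega> u0 u1 t z = ereal (chord u0 u1 t z)"
proof -
  let ?\<zeta> = "complex_of_real (exp t)"
  have "z \<notin> \<Omega>" "z \<in> closure \<Omega>" using z open_\<Omega> by (auto simp: frontier_def interior_open)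
  moreover have "(z, ?\<zeta>) \<in> closure (\<Omega> \<times> annulus)"
    using \<open>z \<in> closure \<Omega>\<close> exp_in_annulus(1)[OF t] closure_subset[of annulus] unfolding closure_Times by blast
  ultimately have "(z, ?\<zeta>) islimpt (\<Omega> \<times> annulus)"
    unfolding closure_def by auto
  then have "\<not> trivial_limit (at (z, ?\<zeta>) within \<Omega> \<times> annulus)"
    unfolding trivial_limit_within by simp
  from tendsto_Lim[OF this envelope_tendsto_at_frontier[OF z exp_in_annulus(1)[OF t]]]
  show ?thesis
    unfolding geodesic_def exp_in_annulus(2)[OF t] using t \<open>z \<notin> \<Omega>\<close> by simp
qed

lemma geodesic_holder:
  assumes t: "t \<in> {0..1}" and z: "z \<in> closure \<Omega>" and w: "w \<in> closure \<Omega>"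
  shows "\<bar>geodesic \<Omega> u0 u1 t z - geodesic \<Omega> u0 u1 t w\<bar> \<le> ereal (M * dist z w powr \<beta>)"
proof -
  have KM: "K * dist z w powr \<beta> \<le> M * dist z w powr \<beta>" and CM: "C * dist z w powr \<beta> \<le> M * dist z w powr \<beta>"
    using M by (auto intro!: mult_right_mono)
  show ?thesis
  proof (cases "t = 0 \<or> t = 1")
    case True
    then show ?thesis
      using u0_holder[OF z w] u1_holder[OF z w] KM unfolding geodesic_def by auto
  next
    case False
    then have t: "0 < t" "t < 1" using t by auto
    let ?\<zeta> = "complex_of_real (exp t)"
    note \<zeta> = exp_in_annulus[OF t]
    have inner: "geodesic \<Omega> u0 u1 t x = envelope \<Omega> u0 u1 (x, ?\<zeta>)" if "x \<in> \<Omega>" for x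
      using that t unfolding geodesic_def by simp
    have mixed: "\<bar>geodesic \<Omega> u0 u1 t x - geodesic \<Omega> u0 u1 t y\<bar> \<le> ereal (M * dist x y powr \<beta>)"
      if x: "x \<in> \<Omega>" and y: "y \<in> frontier \<Omega>" for x y
    proof -
      have "ereal (chord u0 u1 t y - C * dist x y powr \<beta>) \<le> envelope \<Omega> u0 u1 (x, ?\<zeta>)"
        using envelope_bounds(1)[OF x \<zeta>(1)] b_ge[OF x y \<zeta>(1)] unfolding \<zeta>(2)
        by (meson ereal_less_eq(3) order_trans)
      moreover have "envelope \<Omega> u0 u1 (x, ?\<zeta>) \<le> ereal (chord u0 u1 t x)"
        using envelope_bounds(2)[OF x \<zeta>(1)] unfolding \<zeta>(2) .
      moreover have "\<bar>chord u0 u1 t x - chord u0 u1 t y\<bar> \<le> K * dist x y powr \<beta>"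
        using x y t closure_subset[of \<Omega>] by (intro chord_holder) (auto simp: frontier_def)
      moreover have "K * dist x y powr \<beta> \<le> M * dist x y powr \<beta>" "C * dist x y powr \<beta> \<le> M * dist x y powr \<beta>"
        using M by (auto intro!: mult_right_mono)
      ultimately show ?thesis
        unfolding inner[OF x] geodesic_at_frontier[OF y t]
        by (cases "envelope \<Omega> u0 u1 (x, ?\<zeta>)") auto
    qed
    have cases: "x \<in> \<Omega> \<or> x \<in> frontier \<Omega>" if "x \<in> closure \<Omega>" for x
      using that open_\<Omega> by (auto simp: frontier_def interior_open)
    consider "z \<in> \<Omega>" "w \<in> \<Omega>" | "z \<in> \<Omega>" "w \<in> frontier \<Omega>" | "z \<in> frontier \<Omega>" "w \<in> \<Omega>" | "z \<in> frontier \<Omega>" "w \<in> frontier \<Omega>"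
      using cases[OF z] cases[OF w] by blast
    then show ?thesis
    proof cases
      case 1
      obtain x y where xy: "envelope \<Omega> u0 u1 (z, ?\<zeta>) = ereal x" "envelope \<Omega> u0 u1 (w, ?\<zeta>) = ereal y"
        using envelope_bounds[OF 1(1) \<zeta>(1)] envelope_bounds[OF 1(2) \<zeta>(1)]
        by (cases "envelope \<Omega> u0 u1 (z, ?\<zeta>)"; cases "envelope \<Omega> u0 u1 (w, ?\<zeta>)") auto
      show ?thesis
        using envelope_holder[OF 1 \<zeta>(1)] envelope_holder[OF 1(2,1) \<zeta>(1)]
        unfolding inner[OF 1(1)] inner[OF 1(2)] xy by (simp add: dist_commute abs_le_iff)
    next
      case 2
      then show ?thesis by (rule mixed)
    next
      case 3
      obtain x where "envelope \<Omega> u0 u1 (w, ?\<zeta>) = ereal x"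
        using envelope_bounds[OF 3(2) \<zeta>(1)] by (cases "envelope \<Omega> u0 u1 (w, ?\<zeta>)") auto
      then show ?thesis
        using mixed[OF 3(2,1)] unfolding inner[OF 3(2)] geodesic_at_frontier[OF 3(1) t]
        by (simp add: dist_commute abs_minus_commute)
    next
      case 4
      then show ?thesis
        using chord_holder[OF z w, of t] t KM by (simp add: geodesic_at_frontier[OF _ t])
    qed
  qed
qed

end

section \<open>Bounded domains with a smooth defining function\<close>

text \<open>
  Nearby points lie in one of finitely many balls by the Lebesgue number of the cover; for points
  farther apart than this number the boundedness of \<open>f\<close> gives the estimate.
\<close>

lemma lipschitz_on_if_locally_lipschitz_near_compact:
  fixes f :: "'a::metric_space \<Rightarrow> real"
  assumes "compact K" "S \<subseteq> K" and bdd: "\<And>z. z \<in> S \<Longrightarrow> \<bar>f z\<bar> \<le> F"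
    and loc: "\<And>p. p \<in> K \<Longrightarrow> \<exists>r>0. \<exists>L. \<forall>z\<in>S \<inter> ball p r. \<forall>w\<in>S \<inter> ball p r. \<bar>f z - f w\<bar> \<le> L * dist z w"
  shows "\<exists>L. L-lipschitz_on S f"
proof (cases "S = {}")
  case True
  then have "0-lipschitz_on S f" by simp
  then show ?thesis ..
next
  case False
  then have "F \<ge> 0" using bdd by force
  obtain R \<Lambda> where R: "\<And>p. p \<in> K \<Longrightarrow> R p > 0"
    "\<And>p z w. p \<in> K \<Longrightarrow> z \<in> S \<inter> ball p (R p) \<Longrightarrow> w \<in> S \<inter> ball p (R p) \<Longrightarrow> \<bar>f z - f w\<bar> \<le> \<Lambda> p * dist z w"
    using loc by metis
  have cover: "K \<subseteq> (\<Union>p\<in>K. ball p (R p))"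
  proof
    fix p assume "p \<in> K"
    then show "p \<in> (\<Union>p\<in>K. ball p (R p))" using R(1) by force
  qed
  obtain C where C: "C \<subseteq> K" "finite C" "K \<subseteq> (\<Union>p\<in>C. ball p (R p))"
    by (rule compactE_image[OF \<open>compact K\<close> _ cover]) auto
  obtain e where e: "e > 0" "\<And>x. x \<in> K \<Longrightarrow> \<exists>G\<in>(\<lambda>p. ball p (R p)) ` C. ball x e \<subseteq> G"
    using Heine_Borel_lemma[OF \<open>compact K\<close>, of "(\<lambda>p. ball p (R p)) ` C"] C(3) by auto
  define L where "L = (\<Sum>p\<in>C. \<bar>\<Lambda> p\<bar>) + 2 * F / e"
  have sum_nonneg: "0 \<le> (\<Sum>p\<in>C. \<bar>\<Lambda> p\<bar>)" by (intro sum_nonneg) auto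
  have "L-lipschitz_on S f"
  proof (rule lipschitz_onI)
    show "0 \<le> L" unfolding L_def using sum_nonneg e(1) \<open>F \<ge> 0\<close> by simp
    fix z w assume zw: "z \<in> S" "w \<in> S"
    show "dist (f z) (f w) \<le> L * dist z w"
    proof (cases "dist z w < e")
      case True
      obtain p where p: "p \<in> C" "ball z e \<subseteq> ball p (R p)"
        using e(2)[of z] zw \<open>S \<subseteq> K\<close> by blast
      have "z \<in> ball z e" "w \<in> ball z e" using True \<open>e > 0\<close> by auto
      then have "z \<in> ball p (R p)" "w \<in> ball p (R p)" using p(2) by blast+
      then have "\<bar>f z - f w\<bar> \<le> \<Lambda> p * dist z w"
        using R(2)[of p z w] C(1) p(1) zw by blast
      also have "\<dots> \<le> L * dist z w"
      proof (rule mult_right_mono)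
        have "\<bar>\<Lambda> p\<bar> \<le> (\<Sum>p\<in>C. \<bar>\<Lambda> p\<bar>)" using C(2) p(1) by (intro member_le_sum) auto
        moreover have "0 \<le> 2 * F / e" using e(1) \<open>F \<ge> 0\<close> by simp
        ultimately show "\<Lambda> p \<le> L" unfolding L_def by linarith
      qed simp
      finally show ?thesis by (simp add: dist_real_def)
    next
      case False
      have "\<bar>f z - f w\<bar> \<le> 2 * F" using bdd[OF zw(1)] bdd[OF zw(2)] by linarith
      also have "\<dots> = 2 * F / e * e" using e(1) by simp
      also have "\<dots> \<le> 2 * F / e * dist z w"
        using False e(1) \<open>F \<ge> 0\<close> by (intro mult_left_mono) auto
      also have "\<dots> \<le> L * dist z w"
        unfolding L_def using sum_nonneg by (intro mult_right_mono) auto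
      finally show ?thesis by (simp add: dist_real_def)
    qed
  qed
  then show ?thesis ..
qed

lemma continuous_on_compact_norm_bound:
  fixes f :: "'a::topological_space \<Rightarrow> 'b::real_normed_vector"
  assumes "continuous_on K f" "compact K"
  shows "\<exists>F. \<forall>z\<in>K. norm (f z) \<le> F"
proof -
  have "bounded (f ` K)"
    using compact_continuous_image[OF assms] by (rule compact_imp_bounded)
  then show ?thesis by (simp add: bounded_iff)
qed

lemma blinfun_differentiable_bound:
  fixes f :: "'a::real_normed_vector \<Rightarrow> real"
  assumes "convex S" and "\<And>x. x \<in> S \<Longrightarrow> (f has_derivative blinfun_apply (D x)) (at x)"
    and "\<And>x. x \<in> S \<Longrightarrow> norm (D x) \<le> B" "x \<in> S" "y \<in> S"
  shows "\<bar>f x - f y\<bar> \<le> B * dist x y"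
  using differentiable_bound[OF assms(1), of f "\<lambda>x. blinfun_apply (D x)" B x y] assms
  by (simp add: has_derivative_at_withinI norm_blinfun.rep_eq[symmetric] dist_norm)

locale C1_sublevel_domain =
  fixes \<Omega> N :: "'a::euclidean_space set" and \<rho> :: "'a \<Rightarrow> real" and D :: "'a \<Rightarrow> 'a \<Rightarrow>\<^sub>L real"
  assumes bounded_\<Omega>: "bounded \<Omega>" and open_N: "open N" and closure_\<Omega>: "closure \<Omega> \<subseteq> N"
    and \<Omega>_eq: "\<Omega> = {z \<in> N. \<rho> z < 0}"
    and der: "\<And>z. z \<in> N \<Longrightarrow> (\<rho> has_derivative blinfun_apply (D z)) (at z)"
    and continuous_D: "continuous_on N D"
    and nondegenerate: "\<And>z. z \<in> frontier \<Omega> \<Longrightarrow> D z \<noteq> 0"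
begin

lemma continuous_\<rho>: "continuous_on N \<rho>"
  using der by (meson has_derivative_continuous continuous_at_imp_continuous_on)

lemma open_\<Omega>: "open \<Omega>"
proof -
  have "open (N \<inter> \<rho> -` {..<0})"
    by (rule continuous_open_preimage[OF continuous_\<rho> open_N]) simp
  moreover have "N \<inter> \<rho> -` {..<0} = \<Omega>" unfolding \<Omega>_eq by auto
  ultimately show ?thesis by simp
qed

lemma compact_closure_\<Omega>: "compact (closure \<Omega>)"
  using bounded_\<Omega> by simp

lemma \<rho>_frontier: "z \<in> frontier \<Omega> \<Longrightarrow> \<rho> z = 0"
proof -
  assume z: "z \<in> frontier \<Omega>"
  then have zN: "z \<in> N" "z \<in> closure \<Omega>" and "z \<notin> \<Omega>"
    using closure_\<Omega> open_\<Omega> by (auto simp: frontier_def interior_open)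
  have "open (N \<inter> \<rho> -` {0<..})"
    by (rule continuous_open_preimage[OF continuous_\<rho> open_N]) simp
  moreover have "N \<inter> \<rho> -` {0<..} \<inter> \<Omega> = {}" unfolding \<Omega>_eq by auto
  ultimately have "z \<notin> N \<inter> \<rho> -` {0<..}"
    using zN(2) open_Int_closure_eq_empty by blast
  then show "\<rho> z = 0" using zN(1) \<open>z \<notin> \<Omega>\<close> unfolding \<Omega>_eq by auto
qed

text \<open>
  A direction along which \<open>\<rho>\<close> increases at a fixed rate in a neighbourhood of a frontier point; moving
  against it leads into \<open>\<Omega>\<close>, moving along it leads out of \<open>\<Omega>\<close>.
\<close>

lemma transversal_direction:
  assumes p: "p \<in> frontier \<Omega>"
  shows "\<exists>r>0. \<exists>c>0. \<exists>B\<ge>0. \<exists>n. ball p r \<subseteq> N \<and>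
    (\<forall>x\<in>ball p r. \<forall>s\<ge>0. x + s *\<^sub>R n \<in> ball p r \<longrightarrow> \<rho> x + c * s \<le> \<rho> (x + s *\<^sub>R n)) \<and>
    (\<forall>x\<in>ball p r. \<forall>y\<in>ball p r. \<bar>\<rho> x - \<rho> y\<bar> \<le> B * dist x y)"
proof -
  have pN: "p \<in> N" using p closure_\<Omega> by (auto simp: frontier_def)
  obtain v where "blinfun_apply (D p) v \<noteq> 0"
    using nondegenerate[OF p] by (metis blinfun_eqI zero_blinfun.rep_eq)
  then have "blinfun_apply (D p) v > 0 \<or> blinfun_apply (D p) (- v) > 0"
    by (auto simp: blinfun.minus_right)
  then obtain n where n: "blinfun_apply (D p) n > 0" by blast
  define c where "c = blinfun_apply (D p) n / 2"
  define B where "B = norm (D p) + 1"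
  have cont: "(D \<longlongrightarrow> D p) (nhds p)"
    using continuous_D open_N pN by (simp add: continuous_on_eq_continuous_at isCont_def tendsto_at_iff_tendsto_nhds)
  have "((\<lambda>x. blinfun_apply (D x) n) \<longlongrightarrow> blinfun_apply (D p) n) (nhds p)"
    by (intro tendsto_intros cont)
  moreover have "c < blinfun_apply (D p) n" using n by (simp add: c_def)
  ultimately have "\<forall>\<^sub>F x in nhds p. c < blinfun_apply (D x) n"
    by (rule order_tendstoD(1))
  moreover have "((\<lambda>x. norm (D x)) \<longlongrightarrow> norm (D p)) (nhds p)"
    by (intro tendsto_intros cont)
  then have "\<forall>\<^sub>F x in nhds p. norm (D x) < B"
    by (rule order_tendstoD(2)) (simp add: B_def)
  moreover have "\<forall>\<^sub>F x in nhds p. x \<in> N"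
    using open_N pN by (rule eventually_nhds_in_open)
  ultimately have "\<forall>\<^sub>F x in nhds p. c < blinfun_apply (D x) n \<and> norm (D x) < B \<and> x \<in> N"
    by eventually_elim simp
  then obtain r where r: "r > 0" "\<And>x. dist x p < r \<Longrightarrow> c < blinfun_apply (D x) n \<and> norm (D x) < B \<and> x \<in> N"
    unfolding eventually_nhds_metric by blast
  then have r': "c < blinfun_apply (D x) n" "norm (D x) \<le> B" "x \<in> N" if "x \<in> ball p r" for x
    using that by (auto simp: dist_commute less_imp_le)
    have lip: "\<bar>\<rho> x - \<rho> y\<bar> \<le> B * dist x y" if "x \<in> ball p r" "y \<in> ball p r" for x y
      by (rule blinfun_differentiable_bound[OF convex_ball der r'(2) that]) (use r' in auto)
    have incr: "\<rho> x + c * s \<le> \<rho> (x + s *\<^sub>R n)" if x: "x \<in> ball p r" "0 \<le> s" "x + s *\<^sub>R n \<in> ball p r" for x s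
    proof (cases "s = 0")
      case False
      then have "0 < s" using x by simp
      have inb: "x + t *\<^sub>R n \<in> ball p r" if "0 \<le> t" "t \<le> s" for t
      proof -
        have "x + t *\<^sub>R n = (1 - t / s) *\<^sub>R x + (t / s) *\<^sub>R (x + s *\<^sub>R n)"
          using \<open>0 < s\<close> by (simp add: algebra_simps)
        also have "\<dots> \<in> ball p r"
          using that \<open>0 < s\<close> x by (intro convexD[OF convex_ball]) auto
        finally show ?thesis .
      qed
      have "((\<lambda>t. \<rho> (x + t *\<^sub>R n)) has_real_derivative blinfun_apply (D (x + t *\<^sub>R n)) n) (at t)"
        if "0 \<le> t" "t \<le> s" for t
      proof -
        have "((\<lambda>t. x + t *\<^sub>R n) has_derivative (\<lambda>t. t *\<^sub>R n)) (at t)"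
          by (auto intro!: derivative_eq_intros)
        from has_derivative_compose[OF this der[OF r'(3)[OF inb[OF that]]]]
        show ?thesis
          unfolding has_field_derivative_def by (simp add: blinfun.scaleR_right mult.commute[of _ "blinfun_apply (D (x + t *\<^sub>R n)) n"] mult_commute_abs)
      qed
      from MVT2[OF \<open>0 < s\<close> this]
      obtain t where t: "0 < t" "t < s" "\<rho> (x + s *\<^sub>R n) - \<rho> (x + 0 *\<^sub>R n) = (s - 0) * blinfun_apply (D (x + t *\<^sub>R n)) n"
        by blast
      have "c * s \<le> blinfun_apply (D (x + t *\<^sub>R n)) n * s"
        using r'(1)[OF inb[of t]] t \<open>0 < s\<close> by (intro mult_right_mono) auto
      then show ?thesis using t(3) by (simp add: mult.commute)
    qed simp
  have sub: "ball p r \<subseteq> N" using r'(3) by blast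
  have cB: "c > 0" "B \<ge> 0" using n by (auto simp: c_def B_def)
  have incr': "\<forall>x\<in>ball p r. \<forall>s\<ge>0. x + s *\<^sub>R n \<in> ball p r \<longrightarrow> \<rho> x + c * s \<le> \<rho> (x + s *\<^sub>R n)"
    by (intro ballI allI impI incr)
  have lip': "\<forall>x\<in>ball p r. \<forall>y\<in>ball p r. \<bar>\<rho> x - \<rho> y\<bar> \<le> B * dist x y"
    by (intro ballI lip)
  show ?thesis
    by (rule exI[of _ r], rule conjI, rule r(1), rule exI[of _ c], rule conjI, rule cB(1),
        rule exI[of _ B], rule conjI, rule cB(2), rule exI[of _ n], intro conjI sub incr' lip')
qed

text \<open>
  The segment between two points \<open>z\<close>, \<open>w\<close> of \<open>\<Omega>\<close> may leave \<open>\<Omega>\<close>. Pushing both points inward by a multiple of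
  their distance along the transversal direction makes the connecting segment stay inside, and
  the resulting path of three segments has length comparable to \<open>dist z w\<close>.
\<close>

lemma lipschitz_near_frontier_if_bounded_derivative:
  fixes f :: "'a \<Rightarrow> real"
  assumes p: "p \<in> frontier \<Omega>"
    and derf: "\<And>z. z \<in> \<Omega> \<Longrightarrow> (f has_derivative blinfun_apply (Df z)) (at z)"
    and Bf: "\<And>z. z \<in> \<Omega> \<Longrightarrow> norm (Df z) \<le> Bf"
  shows "\<exists>r>0. \<exists>L. \<forall>z\<in>\<Omega> \<inter> ball p r. \<forall>w\<in>\<Omega> \<inter> ball p r. \<bar>f z - f w\<bar> \<le> L * dist z w"
proof -
  obtain r0 c B n where r0: "r0 > 0" "c > 0" and B: "B \<ge> 0" and r0N: "ball p r0 \<subseteq> N"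
    and incr': "\<forall>x\<in>ball p r0. \<forall>s\<ge>0. x + s *\<^sub>R n \<in> ball p r0 \<longrightarrow> \<rho> x + c * s \<le> \<rho> (x + s *\<^sub>R n)"
    and lip': "\<forall>x\<in>ball p r0. \<forall>y\<in>ball p r0. \<bar>\<rho> x - \<rho> y\<bar> \<le> B * dist x y"
    using transversal_direction[OF p] by (elim exE conjE) (rule that)
  note incr = incr'[rule_format] and lip = lip'[rule_format]
  define \<kappa> where "\<kappa> = B / c * norm n"
  define r where "r = r0 / (1 + 2 * \<kappa>)"
  have \<kappa>: "\<kappa> \<ge> 0" using r0 B by (simp add: \<kappa>_def)
  have "r * (1 + 2 * \<kappa>) = r0" using \<kappa> by (simp add: r_def)
  moreover have "r > 0" using r0(1) \<kappa> unfolding r_def by (intro divide_pos_pos) auto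
  moreover then have "0 \<le> r * (2 * \<kappa>)" using \<kappa> by simp
  ultimately have r: "r > 0" "r + 2 * r * \<kappa> = r0" "r \<le> r0"
    by (auto simp: algebra_simps)
  have seg: "\<bar>f x - f y\<bar> \<le> Bf * dist x y" if "closed_segment x y \<subseteq> \<Omega>" for x y
    by (rule blinfun_differentiable_bound[of "closed_segment x y" f Df]) (use that derf Bf in auto)
  have Bf0: "Bf \<ge> 0" if "z \<in> \<Omega>" for z using Bf[OF that] norm_ge_zero order_trans by blast
  have "\<bar>f z - f w\<bar> \<le> (Bf * (2 * \<kappa> + 1)) * dist z w" if zw: "z \<in> \<Omega> \<inter> ball p r" "w \<in> \<Omega> \<inter> ball p r" for z w
  proof -
    \<comment> \<open>Pushing by \<open>s\<close> lowers \<open>\<rho>\<close> by \<open>B * dist z w\<close>, the most by which \<open>\<rho>\<close> can grow along the connecting segment.\<close>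
    define s where "s = B / c * dist z w"
    have s: "s \<ge> 0" "c * s = B * dist z w" "s * norm n = \<kappa> * dist z w"
      using B r0(2) by (auto simp: s_def \<kappa>_def)
    have "dist z w \<le> dist z p + dist w p" by (metis dist_triangle dist_commute)
    then have "dist z w \<le> 2 * r" using zw by (auto simp: dist_commute)
    then have "\<kappa> * dist z w \<le> \<kappa> * (2 * r)" using \<kappa> by (intro mult_left_mono)
    then have sn: "s * norm n \<le> 2 * r * \<kappa>" unfolding s(3) by (simp add: mult_ac)
    have push: "x - s *\<^sub>R n \<in> ball p r0 \<and> closed_segment x (x - s *\<^sub>R n) \<subseteq> \<Omega> \<and> \<rho> (x - s *\<^sub>R n) \<le> \<rho> x - B * dist z w"
      if x: "x \<in> \<Omega> \<inter> ball p r" for x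
    proof -
      have xb: "x \<in> ball p r0" using x r(3) by auto
      have "dist p (x - s *\<^sub>R n) \<le> dist p x + norm (s *\<^sub>R n)"
        using dist_triangle[of p "x - s *\<^sub>R n" x] by (simp add: dist_norm)
      also have "\<dots> < r0" using x sn s(1) r(2) by simp
      finally have x': "x - s *\<^sub>R n \<in> ball p r0" by simp
      have "\<rho> (x - s *\<^sub>R n) \<le> \<rho> x - B * dist z w"
        using incr[OF x' s(1)] xb s(2) by simp
      moreover have "y \<in> \<Omega>" if y_seg: "y \<in> closed_segment x (x - s *\<^sub>R n)" for y
      proof -
        obtain u where u: "0 \<le> u" "u \<le> 1" "y = (1 - u) *\<^sub>R x + u *\<^sub>R (x - s *\<^sub>R n)"
          using in_segment(1)[THEN iffD1, OF y_seg] by blast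
        then have y: "x = y + (u * s) *\<^sub>R n" by (simp add: algebra_simps)
        have "y \<in> ball p r0"
          using y_seg closed_segment_subset[OF xb x' convex_ball] by blast
        then have "\<rho> y + c * (u * s) \<le> \<rho> x"
          using incr[of y "u * s"] xb u(1) s(1) unfolding y[symmetric] by (metis mult_nonneg_nonneg)
        moreover have "0 \<le> c * (u * s)" using r0(2) u(1) s(1) by simp
        ultimately have "\<rho> y < 0" using x unfolding \<Omega>_eq by auto
        then show ?thesis using \<open>y \<in> ball p r0\<close> r0N unfolding \<Omega>_eq by blast
      qed
      ultimately show ?thesis using x' by blast
    qed
    note pz = push[OF zw(1)] and pw = push[OF zw(2)]
    have dzw: "dist (z - s *\<^sub>R n) (w - s *\<^sub>R n) = dist z w" by (simp add: dist_norm)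
    have "closed_segment (z - s *\<^sub>R n) (w - s *\<^sub>R n) \<subseteq> \<Omega>"
    proof
      fix y assume y: "y \<in> closed_segment (z - s *\<^sub>R n) (w - s *\<^sub>R n)"
      then have yb: "y \<in> ball p r0"
        using closed_segment_subset[OF _ _ convex_ball] pz pw by blast
      have "\<bar>\<rho> y - \<rho> (z - s *\<^sub>R n)\<bar> \<le> B * dist y (z - s *\<^sub>R n)"
        using lip[OF yb] pz by blast
      also have "\<dots> \<le> B * dist z w"
        using dist_in_closed_segment(1)[OF y] B unfolding dzw by (intro mult_left_mono) (auto simp: dist_commute)
      finally have "\<rho> y \<le> \<rho> z" using pz by linarith
      then show "y \<in> \<Omega>" using zw(1) yb r0N unfolding \<Omega>_eq by auto
    qed
    from seg[OF this] have 2: "\<bar>f (z - s *\<^sub>R n) - f (w - s *\<^sub>R n)\<bar> \<le> Bf * dist z w" unfolding dzw .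
    have "dist x (x - s *\<^sub>R n) = \<kappa> * dist z w" for x using s by (simp add: dist_norm)
    then have "\<bar>f z - f (z - s *\<^sub>R n)\<bar> \<le> Bf * (\<kappa> * dist z w)" "\<bar>f w - f (w - s *\<^sub>R n)\<bar> \<le> Bf * (\<kappa> * dist z w)"
      using seg[of z "z - s *\<^sub>R n"] seg[of w "w - s *\<^sub>R n"] pz pw by auto
    with 2 have "\<bar>f z - f w\<bar> \<le> Bf * (\<kappa> * dist z w) + Bf * dist z w + Bf * (\<kappa> * dist z w)" by linarith
    then show ?thesis by (simp add: algebra_simps)
  qed
  then show ?thesis using r(1) by blast
qed

lemma lipschitz_on_closure_if_bounded_derivative:
  fixes f :: "'a \<Rightarrow> real"
  assumes cont: "continuous_on (closure \<Omega>) f"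
    and derf: "\<And>z. z \<in> \<Omega> \<Longrightarrow> (f has_derivative blinfun_apply (Df z)) (at z)"
    and Bf: "\<And>z. z \<in> \<Omega> \<Longrightarrow> norm (Df z) \<le> Bf"
  shows "\<exists>L. L-lipschitz_on (closure \<Omega>) f"
proof -
  obtain F where F: "\<forall>z\<in>closure \<Omega>. norm (f z) \<le> F"
    using continuous_on_compact_norm_bound[OF cont compact_closure_\<Omega>] ..
  have "\<exists>r>0. \<exists>L. \<forall>z\<in>\<Omega> \<inter> ball p r. \<forall>w\<in>\<Omega> \<inter> ball p r. \<bar>f z - f w\<bar> \<le> L * dist z w" if "p \<in> closure \<Omega>" for p
  proof (cases "p \<in> \<Omega>")
    case True
    then obtain r where r: "r > 0" "ball p r \<subseteq> \<Omega>" using open_\<Omega> open_contains_ball by blast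
    have "\<bar>f z - f w\<bar> \<le> Bf * dist z w" if "z \<in> ball p r" "w \<in> ball p r" for z w
      using r derf Bf that by (intro blinfun_differentiable_bound[of "ball p r" f Df Bf z w]) auto
    then show ?thesis using r(1) by blast
  next
    case False
    then have "p \<in> frontier \<Omega>" using that open_\<Omega> by (simp add: frontier_def interior_open)
    then show ?thesis using derf Bf by (rule lipschitz_near_frontier_if_bounded_derivative)
  qed
  moreover have "\<bar>f z\<bar> \<le> F" if "z \<in> \<Omega>" for z
    using F closure_subset that by fastforce
  ultimately obtain L where "L-lipschitz_on \<Omega> f"
    using lipschitz_on_if_locally_lipschitz_near_compact[OF compact_closure_\<Omega> closure_subset, of f F] by blast
  from lipschitz_on_closure[OF this cont] show ?thesis ..
qed

lemma lipschitz_\<rho>: "\<exists>L. L-lipschitz_on (closure \<Omega>) \<rho>"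
proof -
  obtain B where B: "\<forall>z\<in>closure \<Omega>. norm (D z) \<le> B"
    using continuous_on_compact_norm_bound[OF continuous_on_subset[OF continuous_D closure_\<Omega>] compact_closure_\<Omega>] ..
  show ?thesis
  proof (rule lipschitz_on_closure_if_bounded_derivative)
    show "continuous_on (closure \<Omega>) \<rho>" using continuous_\<rho> closure_\<Omega> by (rule continuous_on_subset)
    fix z assume "z \<in> \<Omega>"
    then have "z \<in> closure \<Omega>" using closure_subset by blast
    then show "(\<rho> has_derivative blinfun_apply (D z)) (at z)" "norm (D z) \<le> B"
      using der closure_\<Omega> B by blast+
  qed
qed

text \<open>
  Since \<open>\<rho>\<close> increases at a fixed rate along the transversal direction, the frontier is reached from \<open>z\<close>
  within a distance of order \<open>- \<rho> z\<close>, and \<open>f\<close> changes at most proportionally on the way.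
\<close>

lemma vanishing_on_frontier_le_defining_function:
  fixes f :: "'a \<Rightarrow> real"
  assumes lip: "L-lipschitz_on (closure \<Omega>) f" and zero: "\<And>z. z \<in> frontier \<Omega> \<Longrightarrow> f z = 0"
  shows "\<exists>A\<ge>0. \<forall>z\<in>\<Omega>. f z \<le> A * (- \<rho> z)"
proof -
  have L: "L \<ge> 0" using lip by (rule lipschitz_on_nonneg)
  obtain F where F: "\<forall>z\<in>closure \<Omega>. norm (f z) \<le> F"
    using continuous_on_compact_norm_bound[OF lipschitz_on_continuous_on[OF lip] compact_closure_\<Omega>] ..
  have far: "f z \<le> \<bar>F\<bar> / \<delta> * (- \<rho> z)" if "z \<in> \<Omega>" "\<delta> > 0" "\<delta> \<le> - \<rho> z" for z \<delta>
  proof -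
    have "norm (f z) \<le> F" using F that(1) closure_subset[of \<Omega>] by blast
    then have "f z \<le> \<bar>F\<bar>" by simp
    also have "\<dots> = \<bar>F\<bar> / \<delta> * \<delta>" using that by simp
    also have "\<dots> \<le> \<bar>F\<bar> / \<delta> * (- \<rho> z)" using that by (intro mult_left_mono) auto
    finally show ?thesis .
  qed
  have loc: "\<exists>r>0. \<exists>A\<ge>0. \<forall>z\<in>\<Omega> \<inter> ball p r. f z \<le> A * (- \<rho> z)" if "p \<in> closure \<Omega>" for p
  proof (cases "p \<in> \<Omega>")
    case True
    define \<delta> where "\<delta> = - \<rho> p / 2"
    have \<delta>: "\<delta> > 0" "p \<in> N" using True unfolding \<delta>_def \<Omega>_eq by auto
    have "(\<rho> \<longlongrightarrow> \<rho> p) (nhds p)"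
      using continuous_\<rho> open_N \<delta>(2) by (simp add: continuous_on_eq_continuous_at isCont_def tendsto_at_iff_tendsto_nhds)
    then have "\<forall>\<^sub>F x in nhds p. \<rho> x < - \<delta>"
      by (rule order_tendstoD(2)) (use \<delta>(1) in \<open>simp add: \<delta>_def\<close>)
    then obtain r where "r > 0" "\<And>x. dist x p < r \<Longrightarrow> \<rho> x < - \<delta>"
      unfolding eventually_nhds_metric by blast
    then show ?thesis using far[OF _ \<delta>(1)] \<delta>(1)
      by (intro exI[of _ r] conjI exI[of _ "\<bar>F\<bar> / \<delta>"]) (force simp: dist_commute)+
  next
    case False
    then have p: "p \<in> frontier \<Omega>" using that open_\<Omega> by (simp add: frontier_def interior_open)
    obtain r0 c B n where r0: "r0 > 0" "c > 0" and "B \<ge> 0" and "ball p r0 \<subseteq> N"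
      and incr': "\<forall>x\<in>ball p r0. \<forall>s\<ge>0. x + s *\<^sub>R n \<in> ball p r0 \<longrightarrow> \<rho> x + c * s \<le> \<rho> (x + s *\<^sub>R n)"
      and "\<forall>x\<in>ball p r0. \<forall>y\<in>ball p r0. \<bar>\<rho> x - \<rho> y\<bar> \<le> B * dist x y"
      using transversal_direction[OF p] by (elim exE conjE) (rule that)
    note incr = incr'[rule_format]
    define m where "m = norm n + 1"
    have m: "m > 0" "norm n \<le> m" by (auto simp: m_def intro: add_nonneg_pos)
    define \<delta> where "\<delta> = c * (r0 / (2 * m))"
    have \<delta>: "\<delta> > 0" using r0 m by (simp add: \<delta>_def)
    define A where "A = max (L * m / c) (\<bar>F\<bar> / \<delta>)"
    have "f z \<le> A * (- \<rho> z)" if z: "z \<in> \<Omega> \<inter> ball p (r0 / 2)" for z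
    proof (cases "\<delta> \<le> - \<rho> z")
      case True
      then have "f z \<le> \<bar>F\<bar> / \<delta> * (- \<rho> z)" using far z \<delta> by blast
      also have "\<dots> \<le> A * (- \<rho> z)" using True \<delta> unfolding A_def by (intro mult_right_mono) auto
      finally show ?thesis .
    next
      case False
      \<comment> \<open>After the time \<open>s\<close> the function \<open>\<rho>\<close> has become nonnegative, so the frontier has been crossed.\<close>
      define s where "s = - \<rho> z / c"
      have s: "s > 0" "c * s = - \<rho> z" using z r0(2) unfolding s_def \<Omega>_eq by (auto intro: divide_neg_pos)
      have "s < r0 / (2 * m)"
        using False r0(2) unfolding s_def \<delta>_def by (simp add: field_simps)
      then have sm: "s * m < r0 / 2" using m by (simp add: field_simps)
      moreover have "s * norm n \<le> s * m" using s(1) m(2) by (intro mult_left_mono) auto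
      moreover have "dist p (z + s *\<^sub>R n) \<le> dist p z + s * norm n"
        using dist_triangle[of p "z + s *\<^sub>R n" z] s(1) by (simp add: dist_norm)
      moreover have "dist p z < r0 / 2" using z by simp
      ultimately have "dist p z < r0" "dist p (z + s *\<^sub>R n) < r0" using r0(1) by linarith+
      then have zb: "z \<in> ball p r0" "z + s *\<^sub>R n \<in> ball p r0" by auto
      have "z + s *\<^sub>R n \<notin> \<Omega>"
        using incr[OF zb(1) _ zb(2)] s unfolding \<Omega>_eq by auto
      then have "closed_segment z (z + s *\<^sub>R n) \<inter> frontier \<Omega> \<noteq> {}"
        using z by (intro connected_Int_frontier) auto
      then obtain y where y: "y \<in> closed_segment z (z + s *\<^sub>R n)" "y \<in> frontier \<Omega>" by blast
      have "dist z y \<le> dist z (z + s *\<^sub>R n)"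
        using dist_in_closed_segment(1)[OF y(1)] by (simp add: dist_commute)
      also have "\<dots> \<le> s * m" using s(1) m(2) by (simp add: dist_norm mult_left_mono)
      finally have d: "dist z y \<le> s * m" .
      have "f z \<le> \<bar>f z - f y\<bar>" using zero[OF y(2)] by simp
      also have "\<dots> \<le> L * dist z y"
        using lipschitz_onD[OF lip, of z y] z y(2) closure_subset unfolding dist_real_def by (auto simp: frontier_def)
      also have "\<dots> \<le> L * (s * m)" using d L by (rule mult_left_mono)
      also have "\<dots> = L * m / c * (- \<rho> z)" using r0(2) by (simp add: s_def)
      also have "\<dots> \<le> A * (- \<rho> z)"
        using z unfolding A_def \<Omega>_eq by (intro mult_right_mono) auto
      finally show ?thesis .
    qed
    moreover have "A \<ge> 0" unfolding A_def using \<delta> by (simp add: le_max_iff_disj)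
    ultimately show ?thesis using r0(1) by (intro exI[of _ "r0 / 2"]) auto
  qed
  obtain R \<Lambda> where R: "\<And>p. p \<in> closure \<Omega> \<Longrightarrow> R p > 0 \<and> \<Lambda> p \<ge> 0 \<and> (\<forall>z\<in>\<Omega> \<inter> ball p (R p). f z \<le> \<Lambda> p * (- \<rho> z))"
    using loc by metis
  have cover: "closure \<Omega> \<subseteq> (\<Union>p\<in>closure \<Omega>. ball p (R p))"
  proof
    fix p assume "p \<in> closure \<Omega>"
    then show "p \<in> (\<Union>p\<in>closure \<Omega>. ball p (R p))" using R by force
  qed
  obtain C where C: "C \<subseteq> closure \<Omega>" "finite C" "closure \<Omega> \<subseteq> (\<Union>p\<in>C. ball p (R p))"
    by (rule compactE_image[OF compact_closure_\<Omega> _ cover]) auto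
  show ?thesis
  proof (intro exI[of _ "\<Sum>p\<in>C. \<Lambda> p"] conjI ballI)
    show "0 \<le> (\<Sum>p\<in>C. \<Lambda> p)" using R C(1) by (intro sum_nonneg) auto
    fix z assume z: "z \<in> \<Omega>"
    then obtain p where p: "p \<in> C" "z \<in> ball p (R p)" using C(3) closure_subset by blast
    then have "f z \<le> \<Lambda> p * (- \<rho> z)" using R C(1) z by blast
    also have "\<dots> \<le> (\<Sum>p\<in>C. \<Lambda> p) * (- \<rho> z)"
    proof (rule mult_right_mono)
      show "\<Lambda> p \<le> (\<Sum>p\<in>C. \<Lambda> p)" using R C p(1) by (intro member_le_sum) auto
      show "0 \<le> - \<rho> z" using z unfolding \<Omega>_eq by simp
    qed
    finally show "f z \<le> (\<Sum>p\<in>C. \<Lambda> p) * (- \<rho> z)" .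
  qed
qed

end

section \<open>The Levi form\<close>

lemma has_derivative_blinfun_apply_left:
  assumes "(D has_derivative blinfun_apply D2) (at z)"
  shows "((\<lambda>w. blinfun_apply (D w) u) has_derivative (\<lambda>v. blinfun_apply (blinfun_apply D2 v) u)) (at z)"
  using bounded_linear.has_derivative[OF blinfun.bounded_linear_left assms] by simp

text \<open>
  For the second derivative \<open>B\<close> of a function at \<open>z\<close>, the Laplacian at \<open>0\<close> of its restriction to the
  complex line \<open>\<tau> \<mapsto> z + \<tau> *s b\<close>.
\<close>

abbreviation line_laplacian :: "((complex ^ 'n) \<Rightarrow>\<^sub>L (complex ^ 'n) \<Rightarrow>\<^sub>L real) \<Rightarrow> complex ^ 'n \<Rightarrow> real" where
  "line_laplacian B b \<equiv> blinfun_apply (blinfun_apply B b) b + blinfun_apply (blinfun_apply B (\<i> *s b)) (\<i> *s b)"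

text \<open>
  Both sides are expanded in the real coordinate directions. On the left the Wirtinger derivatives
  produce the real second derivatives, and the two double sums agree term by term.
\<close>

lemma Re_levi_form_eq:
  fixes \<rho> :: "complex ^ 'n::finite \<Rightarrow> real"
  assumes "open N" "z \<in> N"
    and der: "\<And>w. w \<in> N \<Longrightarrow> (\<rho> has_derivative blinfun_apply (D w)) (at w)"
    and der2: "(D has_derivative blinfun_apply D2) (at z)"
  shows "Re (levi_form \<rho> z b) =
    (line_laplacian D2 b) / 4"
proof -
  define B where "B v w = blinfun_apply (blinfun_apply D2 v) w" for v w
  define a :: "'n \<Rightarrow> complex ^ 'n" where "a j = axis j 1" for j
  define c :: "'n \<Rightarrow> complex ^ 'n" where "c j = axis j \<i>" for j
  define F where "F w = complex_of_real (\<rho> w)" for w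
  have dF: "dzbar k F w = (of_real (blinfun_apply (D w) (a k)) + \<i> * of_real (blinfun_apply (D w) (c k))) / 2"
    if "w \<in> N" for k w
  proof -
    have "(F has_derivative (\<lambda>v. of_real (blinfun_apply (D w) v))) (at w)"
      unfolding F_def by (rule has_derivative_of_real[OF der[OF that]])
    from frechet_derivative_at[OF this]
    have "frechet_derivative F (at w) = (\<lambda>v. of_real (blinfun_apply (D w) v))" by simp
    then show ?thesis unfolding dzbar_def a_def c_def by simp
  qed
  have ddF: "dz j (dzbar k F) z = (of_real (B (a j) (a k) + B (c j) (c k)) + \<i> * of_real (B (a j) (c k) - B (c j) (a k))) / 4" for j k
  proof -
    have "((\<lambda>w. (of_real (blinfun_apply (D w) (a k)) + \<i> * of_real (blinfun_apply (D w) (c k))) / 2) has_derivative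
       (\<lambda>v. (of_real (B v (a k)) + \<i> * of_real (B v (c k))) / 2)) (at z)"
      unfolding B_def
      by (intro bounded_linear.has_derivative[OF bounded_linear_divide] has_derivative_add
          has_derivative_mult_right has_derivative_of_real has_derivative_blinfun_apply_left der2)
    then have "(dzbar k F has_derivative (\<lambda>v. (of_real (B v (a k)) + \<i> * of_real (B v (c k))) / 2)) (at z)"
      by (rule has_derivative_transform_within_open[OF _ assms(1,2)]) (simp add: dF)
    from frechet_derivative_at[OF this]
    have "frechet_derivative (dzbar k F) (at z) = (\<lambda>v. (of_real (B v (a k)) + \<i> * of_real (B v (c k))) / 2)" by simp
    then show ?thesis
      unfolding dz_def a_def[symmetric] c_def[symmetric] by (simp add: field_simps)
  qed
  have expand: "v = (\<Sum>j\<in>UNIV. Re (v $ j) *\<^sub>R a j + Im (v $ j) *\<^sub>R c j)" for v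
  proof (rule vec_eq_iff[THEN iffD2], rule allI)
    fix i
    have "(\<Sum>j\<in>UNIV. Re (v $ j) *\<^sub>R a j + Im (v $ j) *\<^sub>R c j) $ i =
       (\<Sum>j\<in>UNIV. if j = i then v $ i else 0)"
      unfolding sum_component
      by (intro sum.cong) (auto simp: a_def c_def axis_def complex_eq_iff)
    then show "v $ i = (\<Sum>j\<in>UNIV. Re (v $ j) *\<^sub>R a j + Im (v $ j) *\<^sub>R c j) $ i" by simp
  qed
  have Bl: "B v w = (\<Sum>j\<in>UNIV. Re (v $ j) * B (a j) w + Im (v $ j) * B (c j) w)" for v w
    unfolding B_def by (subst expand[of v])
      (simp add: blinfun.sum_right blinfun.sum_left blinfun.add_right blinfun.add_left blinfun.scaleR_right blinfun.scaleR_left)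
  have Br: "B v w = (\<Sum>k\<in>UNIV. Re (w $ k) * B v (a k) + Im (w $ k) * B v (c k))" for v w
    unfolding B_def by (subst expand[of w])
      (simp add: blinfun.sum_right blinfun.add_right blinfun.scaleR_right)
  have Bvv: "B v v = (\<Sum>j\<in>UNIV. \<Sum>k\<in>UNIV.
      Re (v $ j) * Re (v $ k) * B (a j) (a k) + Re (v $ j) * Im (v $ k) * B (a j) (c k)
      + Im (v $ j) * Re (v $ k) * B (c j) (a k) + Im (v $ j) * Im (v $ k) * B (c j) (c k))" for v
    unfolding Bl[of v v] Br[of "a _" v] Br[of "c _" v] sum_distrib_left sum.distrib[symmetric]
    by (intro sum.cong) (auto simp: algebra_simps)
  have "Re (levi_form \<rho> z b) = (\<Sum>j\<in>UNIV. \<Sum>k\<in>UNIV. Re (dz j (dzbar k F) z * b $ j * cnj (b $ k)))"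
    unfolding levi_form_def F_def[abs_def] by simp
  also have "\<dots> = (B b b + B (\<i> *s b) (\<i> *s b)) / 4"
    unfolding Bvv sum.distrib[symmetric] sum_divide_distrib
    by (intro sum.cong) (auto simp: ddF field_simps)
  finally show ?thesis unfolding B_def .
qed

text \<open>
  The minimum over the compact set of points and unit vectors, extended by homogeneity. The factor
  \<open>4\<close> is the Laplacian of \<open>|\<tau>|\<^sup>2\<close>, so that \<open>\<rho> - \<epsilon> |z - w|\<^sup>2\<close> remains plurisubharmonic.
\<close>

lemma levi_form_uniformly_positive:
  fixes \<rho> :: "complex ^ 'n::finite \<Rightarrow> real"
  assumes "open N" "compact K" "K \<subseteq> N"
    and der: "\<And>w. w \<in> N \<Longrightarrow> (\<rho> has_derivative blinfun_apply (D w)) (at w)"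
    and der2: "\<And>w. w \<in> N \<Longrightarrow> (D has_derivative blinfun_apply (D2 w)) (at w)"
    and cont: "continuous_on N D2"
    and pos: "\<And>z b. z \<in> N \<Longrightarrow> b \<noteq> 0 \<Longrightarrow> 0 < Re (levi_form \<rho> z b)"
  obtains \<epsilon> where "\<epsilon> > 0" "\<And>z b. z \<in> K \<Longrightarrow> 4 * \<epsilon> * (norm b)\<^sup>2 \<le>
     line_laplacian (D2 z) b"
proof (cases "K = {}")
  case True
  then show ?thesis using that[of 1] by simp
next
  case False
  define g where "g z b = line_laplacian (D2 z) b" for z b
  have g: "g z b = 4 * Re (levi_form \<rho> z b)" if "z \<in> N" for z b
    using Re_levi_form_eq[OF \<open>open N\<close> that der der2[OF that], of b] unfolding g_def by simp
  have ci: "continuous_on A (\<lambda>p. \<i> *s snd p)" for A :: "((complex ^ 'n) \<times> (complex ^ 'n)) set"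
    unfolding vector_scalar_mult_def by (intro continuous_intros)
  have c2: "continuous_on (K \<times> sphere 0 1) (\<lambda>p. D2 (fst p))"
    by (rule continuous_on_compose2[OF cont]) (use assms(3) in \<open>auto intro!: continuous_intros\<close>)
  have cg: "continuous_on (K \<times> sphere 0 1) (\<lambda>p. g (fst p) (snd p))"
    unfolding g_def by (intro continuous_intros c2 ci)
  have cK: "compact (K \<times> sphere (0 :: complex ^ 'n) 1)"
    using assms(2) by (intro compact_Times) auto
  have neK: "K \<times> sphere (0 :: complex ^ 'n) 1 \<noteq> {}" using False by simp
  obtain p where p: "p \<in> K \<times> sphere 0 1" "\<forall>q\<in>K \<times> sphere 0 1. g (fst p) (snd p) \<le> g (fst q) (snd q)"
    using continuous_attains_inf[OF cK neK cg] by (elim bexE) (rule that)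
  define \<epsilon> where "\<epsilon> = g (fst p) (snd p) / 4"
  have "\<epsilon> > 0"
    unfolding \<epsilon>_def using p(1) assms(3) by (subst g) (auto intro!: pos)
  moreover have "4 * \<epsilon> * (norm b)\<^sup>2 \<le> g z b" if "z \<in> K" for z b
  proof (cases "b = 0")
    case True
    then show ?thesis by (simp add: g_def)
  next
    case False
    define u where "u = b /\<^sub>R norm b"
    have u: "u \<in> sphere 0 1" "b = norm b *\<^sub>R u" using False by (auto simp: u_def)
    have iu: "\<i> *s (r *\<^sub>R u) = r *\<^sub>R (\<i> *s u)" for r by (simp add: vec_eq_iff)
    have "g z b = (norm b)\<^sup>2 * g z u"
      unfolding g_def by (subst (1 2 3 4) u(2))
        (simp only: iu blinfun.scaleR_left blinfun.scaleR_right real_scaleR_def power2_eq_square, simp add: algebra_simps)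
    moreover have "4 * \<epsilon> \<le> g z u" using bspec[OF p(2), of "(z, u)"] that u(1) by (simp add: \<epsilon>_def)
    then have "4 * \<epsilon> * (norm b)\<^sup>2 \<le> g z u * (norm b)\<^sup>2" by (rule mult_right_mono) simp
    ultimately show ?thesis by (simp add: mult.commute)
  qed
  ultimately show ?thesis using that[of \<epsilon>] unfolding g_def by blast
qed

text \<open>
  The building block of both barriers. Along a complex line the first summand has nonnegative
  Laplacian and the second is harmonic.
\<close>

lemma viscosity_subharmonic_slice_of_levi_bound:
  fixes \<rho> :: "complex ^ 'n::finite \<Rightarrow> real" and w z0 b :: "complex ^ 'n"
  assumes "open N" "z0 \<in> N" "\<zeta>0 \<noteq> 0" "0 \<le> k"
    and der: "\<And>w. w \<in> N \<Longrightarrow> (\<rho> has_derivative blinfun_apply (D w)) (at w)"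
    and der2: "(D has_derivative blinfun_apply D2) (at z0)"
    and levi: "4 * \<epsilon> * (norm b)\<^sup>2 \<le>
        line_laplacian D2 b"
  shows "viscosity_subharmonic_at (\<lambda>\<tau>. ereal (k * (\<rho> (z0 + \<tau> *s b) - \<epsilon> * (norm (z0 + \<tau> *s b - w))\<^sup>2)
     + (c0 + c1 * ln (norm (\<zeta>0 + \<tau> * \<beta>))))) 0"
proof -
  define f where "f z = \<rho> z - \<epsilon> * (norm (z - w))\<^sup>2" for z
  define d where "d u s = blinfun_apply (D (z0 + s *\<^sub>R u)) u - \<epsilon> * (2 * ((z0 + s *\<^sub>R u - w) \<bullet> u))" for u s
  have lin: "((\<lambda>s. z0 + s *\<^sub>R u) has_derivative (\<lambda>s. s *\<^sub>R u)) (at s)" for u and s :: real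
    by (auto intro!: derivative_eq_intros)
  have df: "((\<lambda>s. f (z0 + s *\<^sub>R u)) has_real_derivative d u s) (at s)" if "z0 + s *\<^sub>R u \<in> N" for u s
  proof -
    have 1: "((\<lambda>s. \<rho> (z0 + s *\<^sub>R u)) has_derivative (\<lambda>h. blinfun_apply (D (z0 + s *\<^sub>R u)) (h *\<^sub>R u))) (at s)"
      by (rule has_derivative_compose[OF lin der[OF that]])
    have 2: "((\<lambda>s. (z0 + s *\<^sub>R u - w) \<bullet> (z0 + s *\<^sub>R u - w)) has_derivative
        (\<lambda>h. (z0 + s *\<^sub>R u - w) \<bullet> (h *\<^sub>R u) + (h *\<^sub>R u) \<bullet> (z0 + s *\<^sub>R u - w))) (at s)"
      by (intro has_derivative_inner) (auto intro!: derivative_eq_intros)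
    have "((\<lambda>s. f (z0 + s *\<^sub>R u)) has_derivative (\<lambda>h. blinfun_apply (D (z0 + s *\<^sub>R u)) (h *\<^sub>R u)
        - \<epsilon> * ((z0 + s *\<^sub>R u - w) \<bullet> (h *\<^sub>R u) + (h *\<^sub>R u) \<bullet> (z0 + s *\<^sub>R u - w)))) (at s)"
      unfolding f_def power2_norm_eq_inner by (intro has_derivative_diff 1 has_derivative_mult_right 2)
    then show ?thesis
      unfolding has_field_derivative_def d_def
      by (rule has_derivative_eq_rhs) (auto simp: fun_eq_iff blinfun.scaleR_right inner_commute algebra_simps)
  qed
  have dd: "(d u has_real_derivative blinfun_apply (blinfun_apply D2 u) u - 2 * \<epsilon> * (norm u)\<^sup>2) (at 0)" for u
  proof -
    have "(D has_derivative blinfun_apply D2) (at (z0 + 0 *\<^sub>R u))" using der2 by simp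
    from has_derivative_compose[OF lin has_derivative_blinfun_apply_left[OF this, of u]]
    have 1: "((\<lambda>s. blinfun_apply (D (z0 + s *\<^sub>R u)) u) has_derivative (\<lambda>h. blinfun_apply (blinfun_apply D2 (h *\<^sub>R u)) u)) (at 0)" .
    have 2: "((\<lambda>s. (z0 + s *\<^sub>R u - w) \<bullet> u) has_derivative (\<lambda>h. (h *\<^sub>R u) \<bullet> u)) (at 0)"
      by (auto intro!: derivative_eq_intros)
    have "(d u has_derivative (\<lambda>h. blinfun_apply (blinfun_apply D2 (h *\<^sub>R u)) u - \<epsilon> * (2 * ((h *\<^sub>R u) \<bullet> u)))) (at 0)"
      unfolding d_def[abs_def] by (intro has_derivative_diff 1 has_derivative_mult_right 2)
    then show ?thesis
      unfolding has_field_derivative_def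
      by (rule has_derivative_eq_rhs)
         (auto simp: fun_eq_iff blinfun.scaleR_right blinfun.scaleR_left power2_norm_eq_inner algebra_simps)
  qed
  have s1: "of_real s *s b = s *\<^sub>R b" "(\<i> * of_real s) *s b = s *\<^sub>R (\<i> *s b)" for s
    unfolding vec_eq_iff vector_smult_component vector_scaleR_component by (simp_all add: scaleR_conv_of_real)
  have "\<forall>\<^sub>F s in nhds 0. z0 + s *\<^sub>R u \<in> N" for u
  proof -
    have "((\<lambda>s. z0 + s *\<^sub>R u) \<longlongrightarrow> z0 + 0 *\<^sub>R u) (nhds 0)"
      by (intro tendsto_intros filterlim_ident)
    then show ?thesis using assms(1,2) topological_tendstoD[of _ _ _ N] by auto
  qed
  then have "\<forall>\<^sub>F s in nhds 0. z0 + s *\<^sub>R b \<in> N \<and> z0 + s *\<^sub>R (\<i> *s b) \<in> N"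
    by (simp add: eventually_conj)
  then obtain R where R: "R > 0" "\<And>s. \<bar>s\<bar> < R \<Longrightarrow> z0 + s *\<^sub>R b \<in> N \<and> z0 + s *\<^sub>R (\<i> *s b) \<in> N"
    unfolding eventually_nhds_metric by (auto simp: dist_real_def)
  have "norm (\<i> *s b) = norm b"
    unfolding norm_vec_def by (simp add: norm_mult)
  then have nn: "0 \<le> k * (blinfun_apply (blinfun_apply D2 b) b - 2 * \<epsilon> * (norm b)\<^sup>2)
      + k * (blinfun_apply (blinfun_apply D2 (\<i> *s b)) (\<i> *s b) - 2 * \<epsilon> * (norm (\<i> *s b))\<^sup>2)"
    unfolding distrib_left[symmetric] using levi assms(4) by (intro mult_nonneg_nonneg) auto
  have vs: "viscosity_subharmonic_at (\<lambda>\<tau>. ereal (k * f (z0 + \<tau> *s b))) 0"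
  proof (rule viscosity_subharmonic_at_if_laplacian_nonneg[OF R(1) _ _ nn])
    fix s assume s: "\<bar>s\<bar> < R"
    show "((\<lambda>s. k * f (z0 + (0 + of_real s) *s b) + k * f (z0 + (0 + \<i> * of_real s) *s b)) has_real_derivative
        k * d b s + k * d (\<i> *s b) s) (at s)"
      unfolding add_0_left s1 using R(2)[OF s] by (intro DERIV_add DERIV_cmult df) auto
  next
    show "((\<lambda>s. k * d b s + k * d (\<i> *s b) s) has_real_derivative
        k * (blinfun_apply (blinfun_apply D2 b) b - 2 * \<epsilon> * (norm b)\<^sup>2)
        + k * (blinfun_apply (blinfun_apply D2 (\<i> *s b)) (\<i> *s b) - 2 * \<epsilon> * (norm (\<i> *s b))\<^sup>2)) (at 0)"
      by (intro DERIV_add DERIV_cmult dd)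
  qed
  obtain Q where Q: "Q holomorphic_on ball \<zeta>0 (norm \<zeta>0)"
    "\<And>\<zeta>. \<zeta> \<in> ball \<zeta>0 (norm \<zeta>0) \<Longrightarrow> ln (norm \<zeta>) = Re (Q \<zeta>)"
    using harmonic_ln_norm[OF assms(3)] by blast
  define s where "s = norm \<zeta>0 / (norm \<beta> + 1)"
  have pos1: "norm \<beta> + 1 > 0" by (simp add: add_nonneg_pos)
  then have s: "s > 0" using assms(3) by (simp add: s_def)
  have ball: "\<zeta>0 + \<tau> * \<beta> \<in> ball \<zeta>0 (norm \<zeta>0)" if "\<tau> \<in> ball 0 s" for \<tau>
  proof -
    have "norm \<tau> * norm \<beta> \<le> norm \<tau> * (norm \<beta> + 1)" by (intro mult_left_mono) auto
    also have "\<dots> < s * (norm \<beta> + 1)" using that pos1 by (intro mult_strict_right_mono) auto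
    also have "\<dots> = norm \<zeta>0" using pos1 by (simp add: s_def)
    finally show ?thesis by (simp add: dist_norm norm_mult)
  qed
  have hol: "(\<lambda>\<tau>. of_real c0 + of_real c1 * Q (\<zeta>0 + \<tau> * \<beta>)) holomorphic_on ball 0 s"
  proof -
    have "(Q \<circ> (\<lambda>\<tau>. \<zeta>0 + \<tau> * \<beta>)) holomorphic_on ball 0 s"
      by (rule holomorphic_on_compose_gen[OF _ Q(1)]) (use ball in \<open>auto intro!: holomorphic_intros\<close>)
    then show ?thesis unfolding o_def by (intro holomorphic_intros)
  qed
  show ?thesis
  proof (rule viscosity_subharmonic_at_touching[OF viscosity_subharmonic_at_add_harmonic[OF vs hol s]])
    have eq: "Re (of_real c0 + of_real c1 * Q (\<zeta>0 + \<tau> * \<beta>)) = c0 + c1 * ln (norm (\<zeta>0 + \<tau> * \<beta>))"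
      if "\<tau> \<in> ball 0 s" for \<tau>
      using Q(2)[OF ball[OF that]] by simp
    have "(0 :: complex) \<in> ball 0 s" using s by simp
    from eq[OF this]
    show "ereal (k * f (z0 + 0 *s b)) + ereal (Re (of_real c0 + of_real c1 * Q (\<zeta>0 + 0 * \<beta>)))
      = ereal (k * (\<rho> (z0 + 0 *s b) - \<epsilon> * (norm (z0 + 0 *s b - w))\<^sup>2) + (c0 + c1 * ln (norm (\<zeta>0 + 0 * \<beta>))))"
      by (simp add: f_def)
    have "\<forall>\<^sub>F \<tau> in nhds 0. \<tau> \<in> ball (0::complex) s"
      using s by (intro eventually_nhds_in_open) auto
    then show "\<forall>\<^sub>F \<tau> in nhds 0. ereal (k * f (z0 + \<tau> *s b)) + ereal (Re (of_real c0 + of_real c1 * Q (\<zeta>0 + \<tau> * \<beta>)))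
      \<le> ereal (k * (\<rho> (z0 + \<tau> *s b) - \<epsilon> * (norm (z0 + \<tau> *s b - w))\<^sup>2) + (c0 + c1 * ln (norm (\<zeta>0 + \<tau> * \<beta>))))"
      by eventually_elim (simp only: eq f_def plus_ereal.simps order_refl)
  qed
qed

section \<open>Barriers on strongly pseudoconvex domains\<close>

lemma powr_le_tangent:
  fixes r r0 \<beta> :: real
  assumes "0 < r" "0 < r0" "0 \<le> \<beta>" "\<beta> \<le> 1"
  shows "r powr \<beta> \<le> r0 powr \<beta> + \<beta> * r0 powr (\<beta> - 1) * (r - r0)"
proof -
  have "r powr \<beta> * r0 powr (1 - \<beta>) \<le> \<beta> * r + (1 - \<beta>) * r0"
    using assms by (intro Youngs_inequality_0) auto
  then have "r powr \<beta> * r0 powr (1 - \<beta>) * r0 powr (\<beta> - 1) \<le> (\<beta> * r + (1 - \<beta>) * r0) * r0 powr (\<beta> - 1)"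
    by (rule mult_right_mono) simp
  moreover have "r0 powr (1 - \<beta>) * r0 powr (\<beta> - 1) = 1"
    using assms by (simp add: powr_add[symmetric])
  moreover have "r0 * r0 powr (\<beta> - 1) = r0 powr \<beta>"
    using assms by (simp add: powr_mult_base)
  ultimately show ?thesis by (simp add: algebra_simps)
qed

lemma powr_add_le:
  fixes a b \<beta> :: real
  assumes "0 \<le> a" "0 \<le> b" "0 < \<beta>" "\<beta> \<le> 1"
  shows "(a + b) powr \<beta> \<le> a powr \<beta> + b powr \<beta>"
proof (cases "a + b = 0")
  case False
  then have ab: "a + b > 0" using assms by simp
  have le: "t \<le> t powr \<beta>" if "0 \<le> t" "t \<le> 1" for t :: real
    using powr_mono'[of \<beta> 1 t] that assms by simp
  have "1 = a / (a + b) + b / (a + b)" using ab by (simp add: add_divide_distrib[symmetric])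
  also have "\<dots> \<le> (a / (a + b)) powr \<beta> + (b / (a + b)) powr \<beta>"
    using ab assms by (intro add_mono le) auto
  also have "\<dots> = (a powr \<beta> + b powr \<beta>) / (a + b) powr \<beta>"
    using ab assms by (simp add: powr_divide add_divide_distrib)
  finally show ?thesis using ab by (simp add: field_simps)
qed (use assms in auto)

lemma abs_powr_diff_le:
  fixes x y \<beta> :: real
  assumes "0 \<le> x" "0 \<le> y" "0 < \<beta>" "\<beta> \<le> 1"
  shows "\<bar>x powr \<beta> - y powr \<beta>\<bar> \<le> \<bar>x - y\<bar> powr \<beta>"
proof -
  have *: "\<bar>x powr \<beta> - y powr \<beta>\<bar> \<le> \<bar>x - y\<bar> powr \<beta>" if "0 \<le> y" "y \<le> x" for x y
    using powr_add_le[of y "x - y" \<beta>] powr_mono2[of \<beta> y x] that assms by simp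
  show ?thesis
    using *[of y x] *[of x y] assms by (cases "y \<le> x") (auto simp: abs_minus_commute)
qed

text \<open>
  The last assumption says that \<open>\<rho> - \<epsilon> |z - w|\<^sup>2\<close> is plurisubharmonic on \<open>\<Omega>\<close> for every \<open>w\<close>.
\<close>

locale strongly_pseudoconvex_data =
  C1_sublevel_domain \<Omega> N \<rho> D
  for \<Omega> N :: "(complex ^ 'n::finite) set" and \<rho> D +
  fixes D2 :: "complex ^ 'n \<Rightarrow> (complex ^ 'n) \<Rightarrow>\<^sub>L (complex ^ 'n) \<Rightarrow>\<^sub>L real" and \<epsilon> :: real
  assumes der2: "\<And>z. z \<in> N \<Longrightarrow> (D has_derivative blinfun_apply (D2 z)) (at z)"
    and \<epsilon>_pos: "\<epsilon> > 0"
    and levi: "\<And>z b. z \<in> closure \<Omega> \<Longrightarrow> 4 * \<epsilon> * (norm b)\<^sup>2 \<le>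
     line_laplacian (D2 z) b"
begin

lemma \<Omega>_subset: "\<Omega> \<subseteq> N" "\<Omega> \<subseteq> closure \<Omega>"
  using closure_\<Omega> closure_subset by blast+

lemma open_prod_annulus: "open (\<Omega> \<times> annulus)"
  using open_\<Omega> open_annulus by (rule open_Times)

lemma slice_in_prod:
  assumes "p \<in> \<Omega> \<times> annulus"
  shows "\<forall>\<^sub>F \<tau> in nhds 0. (fst p + \<tau> *s b, snd p + \<tau> * \<beta>) \<in> \<Omega> \<times> annulus"
proof -
  have "\<forall>\<^sub>F q in nhds p. q \<in> \<Omega> \<times> annulus"
    using open_prod_annulus assms by (rule eventually_nhds_in_open)
  from vec_prod.eventually_slice[OF this, of "(b, \<beta>)"] show ?thesis
    by (simp add: plus_prod_def)
qed

lemma psh_prod_onI: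
  assumes cont: "continuous_on (\<Omega> \<times> annulus) b"
    and sub: "\<And>p v \<beta>. p \<in> \<Omega> \<times> annulus \<Longrightarrow>
      viscosity_subharmonic_at (\<lambda>\<tau>. ereal (b (fst p + \<tau> *s v, snd p + \<tau> * \<beta>))) 0"
  shows "psh_prod_on (\<Omega> \<times> annulus) (\<lambda>p. ereal (b p))"
  unfolding vec_prod.psh_wrt_iff_viscosity_subharmonic[OF open_prod_annulus]
proof (intro conjI ballI allI)
  show "usc_on (\<Omega> \<times> annulus) (\<lambda>p. ereal (b p))" by (rule usc_on_continuous[OF cont])
  fix p y :: "(complex ^ 'n) \<times> complex"
  assume "p \<in> \<Omega> \<times> annulus"
  from sub[OF this, of "fst y" "snd y"]
  show "viscosity_subharmonic_at (\<lambda>\<tau>. ereal (b (p + (case y of (z, \<zeta>) \<Rightarrow> (\<tau> *s z, \<tau> * \<zeta>))))) 0"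
    by (simp add: case_prod_beta plus_prod_def)
qed simp

text \<open>
  For a fixed \<open>w\<close>, the function \<open>\<rho> - \<epsilon> |z - w|\<^sup>2\<close> is plurisubharmonic and negative. Applying the
  increasing convex function \<open>s \<mapsto> - k (- s)\<^sup>\<beta>\<close> with \<open>\<beta> = \<alpha> / 2\<close> keeps plurisubharmonicity and makes it at
  most \<open>- H |z - w|\<^sup>\<alpha>\<close>, which is enough for the chord at \<open>w\<close> plus this function to stay below the
  chord at \<open>z\<close>. The barrier is the supremum over all \<open>w\<close>. The exponent is halved because \<open>\<rho>\<close>
  itself vanishes only to first order at \<open>w\<close>.
\<close>

lemma holder_barrier:
  assumes \<alpha>: "0 < \<alpha>" "\<alpha> \<le> 1" and cont: "continuous_on (closure \<Omega>) u0" "continuous_on (closure \<Omega>) u1"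
    and hold: "holder_on \<alpha> (closure \<Omega>) u0" "holder_on \<alpha> (closure \<Omega>) u1"
  shows "\<exists>b K C. geodesic_barrier \<Omega> u0 u1 b (\<alpha> / 2) K C"
proof -
  obtain H0 H1 where H0: "\<forall>z\<in>closure \<Omega>. \<forall>w\<in>closure \<Omega>. \<bar>u0 z - u0 w\<bar> \<le> H0 * dist z w powr \<alpha>"
    and H1: "\<forall>z\<in>closure \<Omega>. \<forall>w\<in>closure \<Omega>. \<bar>u1 z - u1 w\<bar> \<le> H1 * dist z w powr \<alpha>"
    using hold unfolding holder_on_def by blast
  define H where "H = max 0 (max H0 H1)"
  have H_nonneg: "H \<ge> 0" by (simp add: H_def)
  have H: "\<bar>u0 z - u0 w\<bar> \<le> H * dist z w powr \<alpha>" "\<bar>u1 z - u1 w\<bar> \<le> H * dist z w powr \<alpha>"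
    if "z \<in> closure \<Omega>" "w \<in> closure \<Omega>" for z w
  proof -
    have "H0 * dist z w powr \<alpha> \<le> H * dist z w powr \<alpha>" "H1 * dist z w powr \<alpha> \<le> H * dist z w powr \<alpha>"
      by (auto simp: H_def intro!: mult_right_mono)
    then show "\<bar>u0 z - u0 w\<bar> \<le> H * dist z w powr \<alpha>" "\<bar>u1 z - u1 w\<bar> \<le> H * dist z w powr \<alpha>"
      using H0 H1 that by (meson order_trans)+
  qed
  obtain \<Delta> where \<Delta>0: "\<forall>z\<in>closure \<Omega>. \<forall>w\<in>closure \<Omega>. dist z w \<le> \<Delta>"
    using bounded_closure[OF bounded_\<Omega>] unfolding bounded_two_points by blast
  define d where "d = \<bar>\<Delta>\<bar>"
  have d: "d \<ge> 0" "\<And>z w. z \<in> closure \<Omega> \<Longrightarrow> w \<in> closure \<Omega> \<Longrightarrow> dist z w \<le> d"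
    using \<Delta>0 by (auto simp: d_def intro: order_trans[OF _ abs_ge_self])
  obtain L where L: "L-lipschitz_on (closure \<Omega>) \<rho>" using lipschitz_\<rho> by blast
  have L_nonneg: "L \<ge> 0" using L by (rule lipschitz_on_nonneg)
  obtain B where B: "\<forall>z\<in>closure \<Omega>. norm (u1 z - u0 z) \<le> B"
    using continuous_on_compact_norm_bound[OF continuous_on_diff[OF cont(2,1)] compact_closure_\<Omega>] ..
  define \<beta> where "\<beta> = \<alpha> / 2"
  have \<beta>: "0 < \<beta>" "\<beta> \<le> 1" "\<beta> + \<beta> = \<alpha>" using \<alpha> by (auto simp: \<beta>_def)
  define r where "r z w = \<epsilon> * (norm (z - w))\<^sup>2 - \<rho> z" for z w
  have r_pos: "r z w > 0" if "z \<in> \<Omega>" for z w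
    using that \<epsilon>_pos unfolding r_def \<Omega>_eq by (simp add: add_nonneg_pos diff_conv_add_uminus del: add_uminus_conv_diff)
  have r_diff: "\<bar>r z w - r z' w\<bar> \<le> (2 * \<epsilon> * d + L) * dist z z'"
    if "z \<in> closure \<Omega>" "z' \<in> closure \<Omega>" "w \<in> closure \<Omega>" for z z' w
  proof -
    have "\<bar>(norm (z - w))\<^sup>2 - (norm (z' - w))\<^sup>2\<bar> = (norm (z - w) + norm (z' - w)) * \<bar>norm (z - w) - norm (z' - w)\<bar>"
      by (simp add: power2_eq_square square_diff_square_factored abs_mult)
    also have "\<dots> \<le> (2 * d) * dist z z'"
    proof (rule mult_mono)
      show "norm (z - w) + norm (z' - w) \<le> 2 * d"
        using d(2)[OF that(1,3)] d(2)[OF that(2,3)] by (simp add: dist_norm)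
      show "\<bar>norm (z - w) - norm (z' - w)\<bar> \<le> dist z z'"
        using norm_triangle_ineq3[of "z - w" "z' - w"] by (simp add: dist_norm)
    qed (use d in auto)
    finally have "\<epsilon> * \<bar>(norm (z - w))\<^sup>2 - (norm (z' - w))\<^sup>2\<bar> \<le> \<epsilon> * ((2 * d) * dist z z')"
      using \<epsilon>_pos by (intro mult_left_mono) auto
    then have "\<bar>\<epsilon> * (norm (z - w))\<^sup>2 - \<epsilon> * (norm (z' - w))\<^sup>2\<bar> \<le> 2 * \<epsilon> * d * dist z z'"
      using \<epsilon>_pos by (simp add: right_diff_distrib[symmetric] abs_mult mult_ac)
    moreover have "\<bar>\<rho> z - \<rho> z'\<bar> \<le> L * dist z z'"
      using lipschitz_onD[OF L that(1,2)] by (simp add: dist_real_def)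
    ultimately show ?thesis unfolding r_def by (simp add: distrib_right)
  qed
  define k where "k = H / \<epsilon> powr \<beta>"
  have k_nonneg: "k \<ge> 0" using H_nonneg by (simp add: k_def)
  define f where "f w p = chord u0 u1 (ln (norm (snd p))) w - k * r (fst p) w powr \<beta>" for w and p :: "(complex ^ 'n) \<times> complex"
  define b where "b p = (SUP w\<in>closure \<Omega>. f w p)" for p
  have attained: "\<exists>w0\<in>closure \<Omega>. b p = f w0 p \<and> (\<forall>w\<in>closure \<Omega>. f w p \<le> f w0 p)" if p: "p \<in> \<Omega> \<times> annulus" for p
  proof -
    have "continuous_on (closure \<Omega>) (\<lambda>w. f w p)"
      unfolding f_def r_def chord_def
    proof (intro continuous_intros cont ballI)
      fix w
      have "0 < \<epsilon> * (norm (fst p - w))\<^sup>2 - \<rho> (fst p)"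
        using r_pos[of "fst p" w] p unfolding r_def by auto
      then show "\<epsilon> * (norm (fst p - w))\<^sup>2 - \<rho> (fst p) \<noteq> 0"
        by simp
    qed
    moreover have "closure \<Omega> \<noteq> {}" using p \<Omega>_subset by auto
    ultimately obtain w0 where w0: "w0 \<in> closure \<Omega>" "\<forall>w\<in>closure \<Omega>. f w p \<le> f w0 p"
      using continuous_attains_sup[OF compact_closure_\<Omega>] by blast
    then have "b p = f w0 p"
      unfolding b_def by (intro cSup_eq_maximum) auto
    then show ?thesis using w0 by blast
  qed
  have b_upper: "f w p \<le> b p" if "p \<in> \<Omega> \<times> annulus" "w \<in> closure \<Omega>" for w p
    using attained[OF that(1)] that(2) by auto
  \<comment> \<open>A modulus of continuity common to all members of the family, hence also one of their supremum.\<close>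
  define \<omega> where "\<omega> p q = B * \<bar>ln (norm (snd q)) - ln (norm (snd p))\<bar> + k * ((2 * \<epsilon> * d + L) * dist (fst q) (fst p)) powr \<beta>"
    for p q :: "(complex ^ 'n) \<times> complex"
  have f_diff: "f w q \<le> f w p + \<omega> p q" if p: "p \<in> \<Omega> \<times> annulus" and q: "q \<in> \<Omega> \<times> annulus" and w: "w \<in> closure \<Omega>" for p q w
  proof -
    have z: "fst p \<in> \<Omega>" "fst q \<in> \<Omega>" using p q by auto
    have zc: "fst p \<in> closure \<Omega>" "fst q \<in> closure \<Omega>" using z \<Omega>_subset by blast+
    have "chord u0 u1 (ln (norm (snd q))) w - chord u0 u1 (ln (norm (snd p))) w
       = (ln (norm (snd q)) - ln (norm (snd p))) * (u1 w - u0 w)"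
      by (simp add: chord_def algebra_simps)
    also have "\<dots> \<le> \<bar>ln (norm (snd q)) - ln (norm (snd p))\<bar> * \<bar>u1 w - u0 w\<bar>"
      by (metis abs_ge_self abs_mult)
    also have "\<dots> \<le> \<bar>ln (norm (snd q)) - ln (norm (snd p))\<bar> * B"
      using B w by (intro mult_left_mono) auto
    finally have 1: "chord u0 u1 (ln (norm (snd q))) w - chord u0 u1 (ln (norm (snd p))) w \<le> B * \<bar>ln (norm (snd q)) - ln (norm (snd p))\<bar>"
      by (simp add: mult.commute)
    have "r (fst p) w powr \<beta> - r (fst q) w powr \<beta> \<le> \<bar>r (fst p) w - r (fst q) w\<bar> powr \<beta>"
      using abs_powr_diff_le[of "r (fst p) w" "r (fst q) w" \<beta>] r_pos[OF z(1), of w] r_pos[OF z(2), of w] \<beta> by linarith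
    also have "\<dots> \<le> ((2 * \<epsilon> * d + L) * dist (fst q) (fst p)) powr \<beta>"
      using r_diff[OF zc w] \<beta>(1) by (intro powr_mono2) (auto simp: dist_commute)
    finally have "k * (r (fst p) w powr \<beta> - r (fst q) w powr \<beta>) \<le> k * ((2 * \<epsilon> * d + L) * dist (fst q) (fst p)) powr \<beta>"
      using k_nonneg by (intro mult_left_mono)
    with 1 show ?thesis unfolding f_def \<omega>_def by (simp add: right_diff_distrib)
  qed
  have b_diff: "b q \<le> b p + \<omega> p q" if p: "p \<in> \<Omega> \<times> annulus" and q: "q \<in> \<Omega> \<times> annulus" for p q
  proof -
    obtain w where w: "w \<in> closure \<Omega>" "b q = f w q" using attained[OF q] by blast
    then show ?thesis using f_diff[OF p q w(1)] b_upper[OF p w(1)] by linarith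
  qed
  have \<omega>_sym: "\<omega> p q = \<omega> q p" for p q
    by (simp add: \<omega>_def abs_minus_commute dist_commute)
  have cont_b: "continuous_on (\<Omega> \<times> annulus) b"
    unfolding continuous_on_def
  proof
    fix p assume p: "p \<in> \<Omega> \<times> annulus"
    let ?F = "at p within \<Omega> \<times> annulus"
    have fs: "((\<lambda>q. fst q) \<longlongrightarrow> fst p) ?F" "((\<lambda>q. snd q) \<longlongrightarrow> snd p) ?F"
      by (intro tendsto_fst tendsto_snd tendsto_ident_at)+
    have 1: "((\<lambda>q. \<bar>ln (norm (snd q)) - ln (norm (snd p))\<bar>) \<longlongrightarrow> \<bar>ln (norm (snd p)) - ln (norm (snd p))\<bar>) ?F"
      by (intro tendsto_intros fs) (use p annulusD(1) in auto)
    have "((\<lambda>q. (2 * \<epsilon> * d + L) * dist (fst q) (fst p)) \<longlongrightarrow> (2 * \<epsilon> * d + L) * dist (fst p) (fst p)) ?F"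
      by (intro tendsto_intros fs)
    then have 2: "((\<lambda>q. ((2 * \<epsilon> * d + L) * dist (fst q) (fst p)) powr \<beta>) \<longlongrightarrow> 0) ?F"
      using \<beta>(1) \<epsilon>_pos d(1) L_nonneg by (intro tendsto_zero_powrI[OF _ tendsto_const]) auto
    have "((\<lambda>q. \<omega> p q) \<longlongrightarrow> 0) ?F"
      using tendsto_add[OF tendsto_mult[OF tendsto_const[of B] 1] tendsto_mult[OF tendsto_const[of k] 2]]
      unfolding \<omega>_def by simp
    moreover have "\<forall>\<^sub>F q in ?F. norm (b q - b p) \<le> \<omega> p q"
      unfolding eventually_at_filter
      using b_diff[OF p] b_diff[OF _ p] by (intro always_eventually allI impI) (simp add: abs_le_iff \<omega>_sym[of _ p] diff_le_eq add.commute)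
    ultimately have "((\<lambda>q. b q - b p) \<longlongrightarrow> 0) ?F"
      by (rule Lim_null_comparison[rotated])
    then show "(b \<longlongrightarrow> b p) ?F" by (simp add: LIM_zero_iff)
  qed
  have psh_b: "psh_prod_on (\<Omega> \<times> annulus) (\<lambda>p. ereal (b p))"
  proof (rule psh_prod_onI[OF cont_b])
    fix p and v :: "complex ^ 'n" and \<beta>'
    assume p: "p \<in> \<Omega> \<times> annulus"
    have z: "fst p \<in> \<Omega>" "fst p \<in> N" "fst p \<in> closure \<Omega>" and \<zeta>: "snd p \<noteq> 0"
      using p \<Omega>_subset annulusD(1) by auto
    obtain w0 where w0: "w0 \<in> closure \<Omega>" "b p = f w0 p" using attained[OF p] by blast
    define r0 where "r0 = r (fst p) w0"
    have r0: "r0 > 0" unfolding r0_def by (rule r_pos[OF z(1)])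
    define m where "m = k * (\<beta> * r0 powr (\<beta> - 1))"
    have m: "m \<ge> 0" using k_nonneg \<beta>(1) by (simp add: m_def)
    \<comment> \<open>Tangent to the power at \<open>r0\<close>: \<open>q\<close> lies below the barrier, agrees with it at \<open>p\<close>, and has nonnegative Laplacian along complex lines. It stands in for the composition with the convex function.\<close>
    define q where "q x = m * (\<rho> (fst x) - \<epsilon> * (norm (fst x - w0))\<^sup>2)
       + ((u0 w0 - k * r0 powr \<beta> + m * r0) + (u1 w0 - u0 w0) * ln (norm (snd x)))" for x :: "(complex ^ 'n) \<times> complex"
    have q_eq: "q x = chord u0 u1 (ln (norm (snd x))) w0 - k * (r0 powr \<beta> + \<beta> * r0 powr (\<beta> - 1) * (r (fst x) w0 - r0))" for x
      unfolding q_def chord_def r_def m_def by (simp add: algebra_simps)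
    have q_le: "q x \<le> b x" if "x \<in> \<Omega> \<times> annulus" for x
    proof -
      have "r (fst x) w0 powr \<beta> \<le> r0 powr \<beta> + \<beta> * r0 powr (\<beta> - 1) * (r (fst x) w0 - r0)"
        using that r_pos r0 \<beta> by (intro powr_le_tangent) auto
      then have "k * r (fst x) w0 powr \<beta> \<le> k * (r0 powr \<beta> + \<beta> * r0 powr (\<beta> - 1) * (r (fst x) w0 - r0))"
        using k_nonneg by (rule mult_left_mono)
      then have "q x \<le> f w0 x" unfolding q_eq f_def by simp
      then show ?thesis using b_upper[OF that w0(1)] by simp
    qed
    have "q p = b p" unfolding q_eq w0(2) f_def r0_def by simp
    have "viscosity_subharmonic_at (\<lambda>\<tau>. ereal (q (fst p + \<tau> *s v, snd p + \<tau> * \<beta>'))) 0"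
      unfolding q_def fst_conv snd_conv
      by (rule viscosity_subharmonic_slice_of_levi_bound[OF open_N z(2) \<zeta> m der der2[OF z(2)] levi[OF z(3)]])
    then show "viscosity_subharmonic_at (\<lambda>\<tau>. ereal (b (fst p + \<tau> *s v, snd p + \<tau> * \<beta>'))) 0"
    proof (rule viscosity_subharmonic_at_touching)
      show "ereal (q (fst p + 0 *s v, snd p + 0 * \<beta>')) = ereal (b (fst p + 0 *s v, snd p + 0 * \<beta>'))"
        using \<open>q p = b p\<close> by simp
      show "\<forall>\<^sub>F \<tau> in nhds 0. ereal (q (fst p + \<tau> *s v, snd p + \<tau> * \<beta>')) \<le> ereal (b (fst p + \<tau> *s v, snd p + \<tau> * \<beta>'))"
        using slice_in_prod[OF p, of v \<beta>'] by eventually_elim (use q_le in auto)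
    qed
  qed
  have b_le: "b (z, \<zeta>) \<le> chord u0 u1 (ln (norm \<zeta>)) z" if z: "z \<in> \<Omega>" and \<zeta>: "\<zeta> \<in> annulus" for z \<zeta>
  proof -
    obtain w where w: "w \<in> closure \<Omega>" "b (z, \<zeta>) = f w (z, \<zeta>)" using attained[of "(z, \<zeta>)"] z \<zeta> by blast
    have zc: "z \<in> closure \<Omega>" using z \<Omega>_subset by blast
    have "\<bar>chord u0 u1 (ln (norm \<zeta>)) w - chord u0 u1 (ln (norm \<zeta>)) z\<bar> \<le> H * dist w z powr \<alpha>"
      using annulusD(2,3)[OF \<zeta>] by (intro chord_diff_le H w(1) zc) auto
    moreover have "H * dist w z powr \<alpha> \<le> k * r z w powr \<beta>"
    proof -
      have "(\<epsilon> * (norm (z - w))\<^sup>2) powr \<beta> = \<epsilon> powr \<beta> * dist w z powr \<alpha>"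
        unfolding powr_mult \<beta>(3)[symmetric] powr_add power2_eq_square by (simp add: dist_norm norm_minus_commute powr_mult)
      then have "H * dist w z powr \<alpha> = k * (\<epsilon> * (norm (z - w))\<^sup>2) powr \<beta>"
        using \<epsilon>_pos by (simp add: k_def)
      also have "\<dots> \<le> k * r z w powr \<beta>"
        using z \<beta>(1) k_nonneg \<epsilon>_pos unfolding r_def \<Omega>_eq by (intro mult_left_mono powr_mono2) auto
      finally show ?thesis .
    qed
    ultimately show ?thesis unfolding w(2) f_def by simp
  qed
  have b_ge: "chord u0 u1 (ln (norm \<zeta>)) w - (k * (\<epsilon> * d + L) powr \<beta>) * dist z w powr \<beta> \<le> b (z, \<zeta>)"
    if z: "z \<in> \<Omega>" and w: "w \<in> frontier \<Omega>" and \<zeta>: "\<zeta> \<in> annulus" for z w \<zeta>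
  proof -
    have zc: "z \<in> closure \<Omega>" and wc: "w \<in> closure \<Omega>" using z w \<Omega>_subset by (auto simp: frontier_def)
    have "r z w \<le> (\<epsilon> * d + L) * dist z w"
    proof -
      have "(norm (z - w))\<^sup>2 \<le> d * dist z w"
        using d(2)[OF zc wc] by (simp add: power2_eq_square dist_norm mult_right_mono)
      then have "\<epsilon> * (norm (z - w))\<^sup>2 \<le> \<epsilon> * (d * dist z w)" using \<epsilon>_pos by (intro mult_left_mono) auto
      moreover have "\<bar>\<rho> z - \<rho> w\<bar> \<le> L * dist z w"
        using lipschitz_onD[OF L zc wc] by (simp add: dist_real_def)
      ultimately show ?thesis unfolding r_def \<rho>_frontier[OF w] by (simp add: algebra_simps)
    qed
    then have "r z w powr \<beta> \<le> ((\<epsilon> * d + L) * dist z w) powr \<beta>"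
      using r_pos[OF z, of w] \<beta>(1) by (intro powr_mono2) auto
    then have "k * r z w powr \<beta> \<le> k * ((\<epsilon> * d + L) powr \<beta> * dist z w powr \<beta>)"
      using k_nonneg unfolding powr_mult by (rule mult_left_mono)
    moreover have "f w (z, \<zeta>) \<le> b (z, \<zeta>)" using z \<zeta> wc by (intro b_upper) auto
    ultimately show ?thesis unfolding f_def by (simp add: mult.assoc)
  qed
  have hold\<beta>: "H * dist z w powr \<alpha> \<le> (H * d powr \<beta>) * dist z w powr \<beta>" if "z \<in> closure \<Omega>" "w \<in> closure \<Omega>" for z w
  proof -
    have "dist z w powr \<alpha> = dist z w powr \<beta> * dist z w powr \<beta>" unfolding \<beta>(3)[symmetric] powr_add ..
    also have "\<dots> \<le> d powr \<beta> * dist z w powr \<beta>"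
      using d(2)[OF that] \<beta>(1) by (intro mult_right_mono powr_mono2) auto
    finally show ?thesis using H_nonneg by (simp add: mult.assoc mult_left_mono)
  qed
  have H\<beta>: "\<bar>u0 z - u0 w\<bar> \<le> (H * d powr \<beta>) * dist z w powr \<beta>" "\<bar>u1 z - u1 w\<bar> \<le> (H * d powr \<beta>) * dist z w powr \<beta>"
    if "z \<in> closure \<Omega>" "w \<in> closure \<Omega>" for z w
    using H[OF that] hold\<beta>[OF that] by linarith+
  have "geodesic_barrier \<Omega> u0 u1 b \<beta> (H * d powr \<beta>) (k * (\<epsilon> * d + L) powr \<beta>)"
    by unfold_locales (use open_\<Omega> \<beta>(1) H\<beta> psh_b cont_b b_le b_ge in auto)
  then show ?thesis unfolding \<beta>_def by blast
qed

text \<open>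
  Here \<open>u1\<close> equals \<open>u0 - c'\<close> on the frontier, so \<open>u0 - c' ln |\<zeta>|\<close> has the right boundary values and is
  plurisubharmonic. It may exceed the chord inside; the excess is \<open>ln |\<zeta>|\<close> times \<open>u0 - c' - u1\<close>, a Lipschitz
  function vanishing on the frontier, and is removed by adding a large multiple of \<open>\<rho>\<close>.
\<close>

lemma lipschitz_barrier:
  assumes psh: "psh_on \<Omega> (\<lambda>z. ereal (u0 z))" and c11: "C11_on_closure \<Omega> u0" "C11_on_closure \<Omega> u1"
    and const: "(\<lambda>z. u0 z - u1 z) constant_on frontier \<Omega>"
  shows "\<exists>b K C. geodesic_barrier \<Omega> u0 u1 b 1 K C"
proof -
  have lip: "\<exists>L. L-lipschitz_on (closure \<Omega>) u" if u: "C11_on_closure \<Omega> u" for u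
  proof -
    obtain Du M where Du: "\<forall>z\<in>\<Omega>. (u has_derivative blinfun_apply (Du z)) (at z)" "M-lipschitz_on (closure \<Omega>) Du"
      and cu: "continuous_on (closure \<Omega>) u"
      using u unfolding C11_on_closure_def by blast
    obtain B where B: "\<forall>z\<in>closure \<Omega>. norm (Du z) \<le> B"
      using continuous_on_compact_norm_bound[OF lipschitz_on_continuous_on[OF Du(2)] compact_closure_\<Omega>] ..
    show ?thesis
      using lipschitz_on_closure_if_bounded_derivative[OF cu, of Du B] Du(1) B \<Omega>_subset by blast
  qed
  obtain L0 where L0: "L0-lipschitz_on (closure \<Omega>) u0" using lip[OF c11(1)] by blast
  obtain L1 where L1: "L1-lipschitz_on (closure \<Omega>) u1" using lip[OF c11(2)] by blast
  obtain L where L: "L-lipschitz_on (closure \<Omega>) \<rho>" using lipschitz_\<rho> by blast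
  obtain c' where "\<forall>z\<in>frontier \<Omega>. u0 z - u1 z = c'" using const unfolding constant_on_def by blast
  then have c: "u1 z = u0 z - c'" if "z \<in> frontier \<Omega>" for z using that by force
  define g where "g z = u0 z - c' - u1 z" for z
  have "(L0 + L1)-lipschitz_on (closure \<Omega>) g"
  proof (rule lipschitz_onI)
    show "0 \<le> L0 + L1" using lipschitz_on_nonneg[OF L0] lipschitz_on_nonneg[OF L1] by simp
    fix z w assume zw: "z \<in> closure \<Omega>" "w \<in> closure \<Omega>"
    show "dist (g z) (g w) \<le> (L0 + L1) * dist z w"
      using lipschitz_onD[OF L0 zw] lipschitz_onD[OF L1 zw] unfolding g_def dist_real_def by (simp add: distrib_right)
  qed
  moreover have "g z = 0" if "z \<in> frontier \<Omega>" for z using c[OF that] by (simp add: g_def)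
  ultimately have "\<exists>A\<ge>0. \<forall>z\<in>\<Omega>. g z \<le> A * (- \<rho> z)"
    by (rule vanishing_on_frontier_le_defining_function)
  then obtain A where A0: "A \<ge> 0" "\<forall>z\<in>\<Omega>. g z \<le> A * (- \<rho> z)" by blast
  note A = A0(1) bspec[OF A0(2)]
  define b where "b p = u0 (fst p) + (A * \<rho> (fst p) - c' * ln (norm (snd p)))" for p :: "(complex ^ 'n) \<times> complex"
  have cont_fst: "continuous_on (\<Omega> \<times> annulus) (\<lambda>p. h (fst p))" if "continuous_on (closure \<Omega>) h" for h :: "complex ^ 'n \<Rightarrow> real"
    by (rule continuous_on_compose2[OF that]) (use \<Omega>_subset in \<open>auto intro!: continuous_intros\<close>)
  have cont_u0: "continuous_on (\<Omega> \<times> annulus) (\<lambda>p. u0 (fst p))"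
    by (rule cont_fst[OF lipschitz_on_continuous_on[OF L0]])
  have cont_\<rho>: "continuous_on (\<Omega> \<times> annulus) (\<lambda>p. A * \<rho> (fst p) - c' * ln (norm (snd p)))"
    by (intro continuous_intros cont_fst[OF lipschitz_on_continuous_on[OF L]]) (use annulusD(1) in auto)
  have psh_u0: "psh_prod_on (\<Omega> \<times> annulus) (\<lambda>p. ereal (u0 (fst p)))"
    unfolding psh_wrt_def
  proof (intro conjI allI impI)
    show "usc_on (\<Omega> \<times> annulus) (\<lambda>p. ereal (u0 (fst p)))" by (rule usc_on_continuous[OF cont_u0])
    show "\<forall>p\<in>\<Omega> \<times> annulus. ereal (u0 (fst p)) < \<infinity>" by simp
    fix a y :: "(complex ^ 'n) \<times> complex"
    assume *: "\<forall>\<tau>\<in>cball 0 1. a + (case y of (z, \<zeta>) \<Rightarrow> (\<tau> *s z, \<tau> * \<zeta>)) \<in> \<Omega> \<times> annulus"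
    have fst_eq: "fst (a + (case y of (z, \<zeta>) \<Rightarrow> (\<tau> *s z, \<tau> * \<zeta>))) = fst a + \<tau> *s fst y" for \<tau>
      by (cases y) simp
    have "fst a + \<tau> *s fst y \<in> \<Omega>" if "\<tau> \<in> cball 0 1" for \<tau>
      using bspec[OF * that] fst_eq[of \<tau>] by (metis mem_Sigma_iff prod.collapse)
    then show "ereal (u0 (fst a)) \<le> circle_mean (\<lambda>\<theta>. ereal (u0 (fst (a + (case y of (z, \<zeta>) \<Rightarrow> (cis \<theta> *s z, cis \<theta> * \<zeta>))))))"
      using psh unfolding psh_wrt_def fst_eq by blast
  qed
  have psh_\<rho>: "psh_prod_on (\<Omega> \<times> annulus) (\<lambda>p. ereal (A * \<rho> (fst p) - c' * ln (norm (snd p))))"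
  proof (rule psh_prod_onI[OF cont_\<rho>])
    fix p and v :: "complex ^ 'n" and \<beta>'
    assume p: "p \<in> \<Omega> \<times> annulus"
    have z: "fst p \<in> N" "fst p \<in> closure \<Omega>" and \<zeta>: "snd p \<noteq> 0"
      using p \<Omega>_subset annulusD(1) by auto
    have "0 \<le> 4 * \<epsilon> * (norm v)\<^sup>2" using \<epsilon>_pos by simp
    with levi[OF z(2), of v] have "4 * 0 * (norm v)\<^sup>2 \<le> line_laplacian (D2 (fst p)) v" by simp
    from viscosity_subharmonic_slice_of_levi_bound[OF open_N z(1) \<zeta> A(1) der der2[OF z(1)] this, of 0 0 "- c'" \<beta>']
    show "viscosity_subharmonic_at (\<lambda>\<tau>. ereal (A * \<rho> (fst (fst p + \<tau> *s v, snd p + \<tau> * \<beta>'))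
        - c' * ln (norm (snd (fst p + \<tau> *s v, snd p + \<tau> * \<beta>'))))) 0"
      by simp
  qed
  have psh_b: "psh_prod_on (\<Omega> \<times> annulus) (\<lambda>p. ereal (b p))"
    unfolding b_def by (rule vec_prod.psh_wrt_add_continuous[OF psh_u0 cont_u0 psh_\<rho> cont_\<rho>])
  have cont_b: "continuous_on (\<Omega> \<times> annulus) b"
    unfolding b_def by (intro continuous_on_add cont_u0 cont_\<rho>)
  have b_le: "b (z, \<zeta>) \<le> chord u0 u1 (ln (norm \<zeta>)) z" if z: "z \<in> \<Omega>" and \<zeta>: "\<zeta> \<in> annulus" for z \<zeta>
  proof -
    define t where "t = ln (norm \<zeta>)"
    have t: "0 \<le> t" "t \<le> 1" using annulusD(2,3)[OF \<zeta>] by (auto simp: t_def)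
    have "\<rho> z \<le> 0" using z unfolding \<Omega>_eq by auto
    have "t * g z \<le> t * (A * (- \<rho> z))" using A(2)[OF z] t(1) by (rule mult_left_mono)
    also have "\<dots> \<le> 1 * (A * (- \<rho> z))"
      using t A(1) \<open>\<rho> z \<le> 0\<close> by (intro mult_right_mono) (auto simp: mult_nonneg_nonpos)
    finally show ?thesis
      unfolding b_def chord_def g_def t_def[symmetric] fst_conv snd_conv by (simp add: algebra_simps t_def)
  qed
  have b_ge: "chord u0 u1 (ln (norm \<zeta>)) w - (L0 + A * L) * dist z w powr 1 \<le> b (z, \<zeta>)"
    if z: "z \<in> \<Omega>" and w: "w \<in> frontier \<Omega>" and \<zeta>: "\<zeta> \<in> annulus" for z w \<zeta>
  proof -
    have zw: "z \<in> closure \<Omega>" "w \<in> closure \<Omega>" using z w \<Omega>_subset by (auto simp: frontier_def)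
    have "\<bar>u0 z - u0 w\<bar> \<le> L0 * dist z w" "\<bar>\<rho> z - \<rho> w\<bar> \<le> L * dist z w"
      using lipschitz_onD[OF L0 zw] lipschitz_onD[OF L zw] by (simp_all add: dist_real_def)
    moreover from this(2) have "A * (- \<rho> z) \<le> A * (L * dist z w)"
      using A(1) \<rho>_frontier[OF w] by (intro mult_left_mono) auto
    moreover have "chord u0 u1 (ln (norm \<zeta>)) w = u0 w - c' * ln (norm \<zeta>)"
      unfolding chord_def c[OF w] by (simp add: algebra_simps)
    ultimately show ?thesis unfolding b_def by (simp add: algebra_simps)
  qed
  have K: "L0 * dist z w \<le> max L0 L1 * dist z w powr 1" "L1 * dist z w \<le> max L0 L1 * dist z w powr 1" for z w :: "complex ^ 'n"
    by (auto intro!: mult_right_mono)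
  have "\<bar>u0 z - u0 w\<bar> \<le> max L0 L1 * dist z w powr 1" "\<bar>u1 z - u1 w\<bar> \<le> max L0 L1 * dist z w powr 1"
    if zw: "z \<in> closure \<Omega>" "w \<in> closure \<Omega>" for z w
    using lipschitz_onD[OF L0 zw] lipschitz_onD[OF L1 zw] K[of z w] unfolding dist_real_def by linarith+
  then have "geodesic_barrier \<Omega> u0 u1 b 1 (max L0 L1) (L0 + A * L)"
    by unfold_locales (use open_\<Omega> psh_b cont_b b_le b_ge in auto)
  then show ?thesis by blast
qed

end

lemma strongly_pseudoconvex_dataI:
  fixes \<Omega> :: "(complex ^ 'n::finite) set"
  assumes "bounded \<Omega>" "strongly_pseudoconvex_domain \<Omega>"
  shows "\<exists>N \<rho> D D2 \<epsilon>. strongly_pseudoconvex_data \<Omega> N \<rho> D D2 \<epsilon>"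
proof -
  obtain N \<rho> where N: "open N" "closure \<Omega> \<subseteq> N" "C2_strictly_psh_on N \<rho>" "\<Omega> = {z \<in> N. \<rho> z < 0}"
    and grad: "\<forall>z\<in>frontier \<Omega>. \<exists>g. g \<noteq> 0 \<and> (GDERIV \<rho> z :> g)"
    using assms(2) unfolding strongly_pseudoconvex_domain_def by (elim conjE exE) (rule that)
  obtain D D2 where D: "\<forall>z\<in>N. (\<rho> has_derivative blinfun_apply (D z)) (at z) \<and> (D has_derivative blinfun_apply (D2 z)) (at z)"
    and D2: "continuous_on N D2"
    using N(3) unfolding C2_strictly_psh_on_def C2_on_def by (elim conjE exE) (rule that)
  have pos: "\<forall>z\<in>N. \<forall>b. b \<noteq> 0 \<longrightarrow> 0 < Re (levi_form \<rho> z b)"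
    using N(3) unfolding C2_strictly_psh_on_def by simp
  have der: "(\<rho> has_derivative blinfun_apply (D z)) (at z)" and der2: "(D has_derivative blinfun_apply (D2 z)) (at z)" if "z \<in> N" for z
    using D that by auto
  have contD: "continuous_on N D"
    using der2 by (meson has_derivative_continuous continuous_at_imp_continuous_on)
  have nd: "D z \<noteq> 0" if z: "z \<in> frontier \<Omega>" for z
  proof
    assume "D z = 0"
    obtain g where g: "g \<noteq> 0" "GDERIV \<rho> z :> g" using grad z by blast
    have "z \<in> N" using z N(2) by (auto simp: frontier_def)
    then have "blinfun_apply (D z) = (\<lambda>h. h \<bullet> g)"
      using has_derivative_unique[OF der] g(2) unfolding gderiv_def by blast
    then have "g \<bullet> g = 0" using \<open>D z = 0\<close> by (metis zero_blinfun.rep_eq)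
    then show False using g(1) by simp
  qed
  have "compact (closure \<Omega>)" using assms(1) by simp
  obtain \<epsilon> where "\<epsilon> > 0" and \<epsilon>: "\<And>z b. z \<in> closure \<Omega> \<Longrightarrow> 4 * \<epsilon> * (norm b)\<^sup>2 \<le>
     line_laplacian (D2 z) b"
    by (rule levi_form_uniformly_positive[OF N(1) \<open>compact (closure \<Omega>)\<close> N(2) der der2 D2]) (use pos in auto)
  have "strongly_pseudoconvex_data \<Omega> N \<rho> D D2 \<epsilon>"
    by unfold_locales (use assms(1) N(1,2,4) der contD nd der2 \<open>\<epsilon> > 0\<close> \<epsilon> in auto)
  then show ?thesis by blast
qed

section \<open>Regularity of geodesics\<close>

theorem theoremB:
  fixes \<Omega> :: "(complex ^ 'n::finite) set" and u0 u1 :: "complex ^ 'n \<Rightarrow> real"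
  assumes "bounded \<Omega>" and "strongly_pseudoconvex_domain \<Omega>"
    and "psh_on \<Omega> (\<lambda>z. ereal (u0 z))" and "continuous_on (closure \<Omega>) u0"
    and "psh_on \<Omega> (\<lambda>z. ereal (u1 z))" and "continuous_on (closure \<Omega>) u1"
  shows
    "(\<forall>\<alpha>. 0 < \<alpha> \<and> \<alpha> \<le> 1 \<and> holder_on \<alpha> (closure \<Omega>) u0 \<and> holder_on \<alpha> (closure \<Omega>) u1 \<longrightarrow>
        (\<exists>C::real. \<forall>t\<in>{0..1}. \<forall>z\<in>closure \<Omega>. \<forall>w\<in>closure \<Omega>.
           \<bar>geodesic \<Omega> u0 u1 t z - geodesic \<Omega> u0 u1 t w\<bar> \<le> ereal (C * dist z w powr (\<alpha> / 2)))) \<and>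
     (C11_on_closure \<Omega> u0 \<and> C11_on_closure \<Omega> u1 \<and>
      (\<lambda>z. u0 z - u1 z) constant_on frontier \<Omega> \<longrightarrow>
        (\<exists>C::real. \<forall>t\<in>{0..1}. \<forall>z\<in>closure \<Omega>. \<forall>w\<in>closure \<Omega>.
           \<bar>geodesic \<Omega> u0 u1 t z - geodesic \<Omega> u0 u1 t w\<bar> \<le> ereal (C * dist z w)))"
proof -
  obtain N \<rho> D D2 \<epsilon> where "strongly_pseudoconvex_data \<Omega> N \<rho> D D2 \<epsilon>"
    using strongly_pseudoconvex_dataI[OF assms(1,2)] by (elim exE) (rule that)
  then interpret strongly_pseudoconvex_data \<Omega> N \<rho> D D2 \<epsilon> .
  show ?thesis
  proof (intro conjI allI impI; elim conjE)
    fix \<alpha> :: real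
    assume "0 < \<alpha>" "\<alpha> \<le> 1" "holder_on \<alpha> (closure \<Omega>) u0" "holder_on \<alpha> (closure \<Omega>) u1"
    then obtain b K C where "geodesic_barrier \<Omega> u0 u1 b (\<alpha> / 2) K C"
      using holder_barrier[of \<alpha> u0 u1] assms(4,6) by blast
    then interpret barrier: geodesic_barrier \<Omega> u0 u1 b "\<alpha> / 2" K C .
    show "\<exists>C::real. \<forall>t\<in>{0..1}. \<forall>z\<in>closure \<Omega>. \<forall>w\<in>closure \<Omega>.
           \<bar>geodesic \<Omega> u0 u1 t z - geodesic \<Omega> u0 u1 t w\<bar> \<le> ereal (C * dist z w powr (\<alpha> / 2))"
      using barrier.geodesic_holder by blast
  next
    assume "C11_on_closure \<Omega> u0" "C11_on_closure \<Omega> u1" "(\<lambda>z. u0 z - u1 z) constant_on frontier \<Omega>"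
    then obtain b K C where "geodesic_barrier \<Omega> u0 u1 b 1 K C"
      using lipschitz_barrier[OF assms(3)] by blast
    then interpret barrier: geodesic_barrier \<Omega> u0 u1 b 1 K C .
    show "\<exists>C::real. \<forall>t\<in>{0..1}. \<forall>z\<in>closure \<Omega>. \<forall>w\<in>closure \<Omega>.
           \<bar>geodesic \<Omega> u0 u1 t z - geodesic \<Omega> u0 u1 t w\<bar> \<le> ereal (C * dist z w)"
      using barrier.geodesic_holder by (intro exI[of _ barrier.M]) auto
  qed
qed

end
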